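(* Let $\Gamma=(\Omega,I,J,g,q)$ be a finite zero-sum stochastic game, with limit value $v^*$. Then there exists a family $(\sigma_n,\rho_n)_{n\ge1}$ of pairs of Markov strategies such that: (i) (asymptotic optimality) there exists a sequence $\varepsilon_n\to0$ such that for all $n\ge1$, $\sigma_n$ and $\rho_n$ are $\varepsilon_n$-optimal in the $n$-stage game $\Gamma_n$; and (ii) (constant payoff property) for all $t\in(0,1)$ and all $\omega\in\Omega$, $$\lim_{n\to+\infty}\mathbb{E}^\omega_{\sigma_n,\rho_n}\left[\frac{1}{tn}\sum_{m=1}^{\lceil tn\rceil}g_m\right]=v^*(\omega).$$
   Context: **Stochastic game.** A finite zero-sum stochastic game is a tuple $\Gamma=(\Omega,I,J,g,q)$ with $\Omega$ (states), $I$ (Player 1's actions), $J$ (Player 2's actions) nonempty finite sets, $g:\Omega\times I\times J\to\mathbb{R}$ the payoff function and $q:\Omega\times I\times J\to\Delta(\Omega)$ the transition function, where $\Delta(A)$ is the set of probability distributions on a finite set $A$. From an initial state $\omega_1=\omega$, at each stage $m\ge 1$ the players simultaneously and independently choose $i_m\in I$, $j_m\in J$; the stage payoff is $g_m:=g(\omega_m,i_m,j_m)$ to Player 1 and $-g_m$ to Player 2; $\omega_{m+1}$ is drawn from $q(\omega_m,i_m,j_m)$; players observe $(\omega_{m+1},i_m,j_m)$. **Strategies.** Let $H_m:=(\Omega\times I\times J)^{m-1}\times\Omega$. A strategy of Player 1 is a collection $\sigma=(\sigma_m)_{m\ge1}$ of maps $\sigma_m:H_m\to\Delta(I)$; a strategy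 of Player 2 is a collection $\rho=(\rho_m)_{m\ge 1}$ of maps $\rho_m:H_m\to\Delta(J)$. The sets of strategies are $\Sigma$ and $T$. A Markov strategy depends only on the current stage and the current state (a map $\mathbb{N}\times\Omega\to\Delta(I)$ for Player 1, resp. $\mathbb{N}\times\Omega\to\Delta(J)$ for Player 2). $\mathbb{E}^\omega_{\sigma,\rho}$ is the expectation for the probability induced on $(\Omega\times I\times J)^{\mathbb{N}}$ by initial state $\omega$ and the pair $(\sigma,\rho)$. **$n$-stage game.** $\gamma_n^\omega(\sigma,\rho)=\mathbb{E}^\omega_{\sigma,\rho}\left(\frac1n\sum_{m=1}^n g_m\right)$, with value $v_n(\omega)=\max_{\sigma\in\Sigma}\min_{\rho\in T}\gamma_n^\omega(\sigma,\rho)=\min_{\rho\in T}\max_{\sigma\in\Sigma}\gamma_n^\omega(\sigma,\rho)$. A strategy $\sigma$ of Player 1 is $\varepsilon$-optimal in $\Gamma_n$ if $\gamma_n^\omega(\sigma,\rho)\ge v_n(\omega)-\varepsilon$ for all $\rho\in T$ and all $\omega\in\Omega$; a strategy $\rho$ of Player 2 is $\varepsilon$-optimal in $\Gamma_n$ if $\gamma_n^\omega(\sigma,\rho)\le v_n(\omega)+\varepsilon$ for all $\sigma\in\Sigma$ and all $\omega\in\Omega$. **Limit value.** For $\lambda\in(0,1]$, let $v_\lambda(\omega)$ be the value of the $\lambda$-discounted game with payoff $\mathbb{E}^\omega_{\sigma,\rho}\left(\sum_{m\ge1}\lambda(1-\lambda)^{m-1}g_m\right)$. By a theorem of Bewley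 and Kohlberg, for finite stochastic games $v_n$ (as $n\to+\infty$) and $v_\lambda$ (as $\lambda\to0$) converge to the same limit $v^*:\Omega\to\mathbb{R}$, called the limit value. *)

theory Defs
  imports "HOL-Probability.Probability"
begin

text \<open>A finite zero-sum stochastic game: the state space and the two action sets are
  the (finite, nonempty) types \<open>'w\<close>, \<open>'i\<close>, \<open>'j\<close>.\<close>

record ('w, 'i, 'j) stochastic_game =
  payoff :: "'w \<Rightarrow> 'i \<Rightarrow> 'j \<Rightarrow> real"
  transition :: "'w \<Rightarrow> 'i \<Rightarrow> 'j \<Rightarrow> 'w pmf"

text \<open>A history in \<open>H_m\<close> is given by the list of the \<open>m - 1\<close> past triples (state, action, action),
  oldest first, together with the current state.  A single function on all lists and states is
  hence the same as a collection of maps on \<open>H_m\<close>, \<open>m \<ge> 1\<close>.\<close>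

type_synonym ('w, 'i, 'j, 'a) strategy = "('w \<times> 'i \<times> 'j) list \<Rightarrow> 'w \<Rightarrow> 'a pmf"

text \<open>A list of length \<open>m - 1\<close> is seen at stage \<open>m\<close>.\<close>

definition markov :: "('w, 'i, 'j, 'a) strategy \<Rightarrow> bool" where
  "markov \<sigma> \<longleftrightarrow> (\<exists>f :: nat \<Rightarrow> 'w \<Rightarrow> 'a pmf. \<forall>h w. \<sigma> h w = f (Suc (length h)) w)"

definition state_law :: "('w, 'i, 'j) stochastic_game \<Rightarrow> 'w \<Rightarrow> ('w \<times> 'i \<times> 'j) list \<Rightarrow> 'w pmf" where
  "state_law G \<omega> h =
     (if h = [] then return_pmf \<omega> else (case last h of (w, i, j) \<Rightarrow> transition G w i j))"

definition stage_law ::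
  "('w, 'i, 'j) stochastic_game \<Rightarrow> 'w \<Rightarrow> ('w, 'i, 'j, 'i) strategy \<Rightarrow> ('w, 'i, 'j, 'j) strategy
    \<Rightarrow> ('w \<times> 'i \<times> 'j) list \<Rightarrow> ('w \<times> 'i \<times> 'j) pmf" where
  "stage_law G \<omega> \<sigma> \<rho> h =
     bind_pmf (state_law G \<omega> h) (\<lambda>w. map_pmf (\<lambda>(i, j). (w, i, j)) (pair_pmf (\<sigma> h w) (\<rho> h w)))"

text \<open>Plays are functions on \<open>nat\<close>, the triple of stage \<open>m \<ge> 1\<close> being at index \<open>m - 1\<close>.
  Their law is the measure obtained from the kernels below by the theorem of Ionescu-Tulcea;
  \<open>measure_play_cylinder\<close> gives its values on cylinders.\<close>

definition stage_kernel ::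
  "('w, 'i, 'j) stochastic_game \<Rightarrow> 'w \<Rightarrow> ('w, 'i, 'j, 'i) strategy \<Rightarrow> ('w, 'i, 'j, 'j) strategy
    \<Rightarrow> nat \<Rightarrow> (nat \<Rightarrow> 'w \<times> 'i \<times> 'j) \<Rightarrow> ('w \<times> 'i \<times> 'j) measure" where
  "stage_kernel G \<omega> \<sigma> \<rho> k x = measure_pmf (stage_law G \<omega> \<sigma> \<rho> (map x [0..<k]))"

definition play_measure ::
  "('w, 'i, 'j) stochastic_game \<Rightarrow> 'w \<Rightarrow> ('w, 'i, 'j, 'i) strategy \<Rightarrow> ('w, 'i, 'j, 'j) strategy
    \<Rightarrow> (nat \<Rightarrow> 'w \<times> 'i \<times> 'j) measure" where
  "play_measure G \<omega> \<sigma> \<rho> =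
     projective_family.lim UNIV
       (Ionescu_Tulcea.CI (stage_kernel G \<omega> \<sigma> \<rho>) (\<lambda>_. count_space UNIV)) (\<lambda>_. count_space UNIV)"

lemma Ionescu_Tulcea_stage_kernel:
  fixes G :: "('w::finite, 'i::finite, 'j::finite) stochastic_game"
  shows "Ionescu_Tulcea (stage_kernel G \<omega> \<sigma> \<rho>) (\<lambda>_. count_space UNIV)"
proof (rule Ionescu_Tulcea.intro)
  fix k :: nat
  let ?M = "PiM {0..<k} (\<lambda>_. count_space (UNIV :: ('w \<times> 'i \<times> 'j) set))"
  have "(\<lambda>x. map x [0..<k]) -` {l} \<inter> space ?M \<in> sets ?M" for l
  proof (cases "length l = k")
    case True
    have "map x [0..<k] = l \<longleftrightarrow> (\<forall>m<k. x m = l ! m)" for x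
      using True by (subst list_eq_iff_nth_eq) simp
    then have "(\<lambda>x. map x [0..<k]) -` {l} \<inter> space ?M = PiE {0..<k} (\<lambda>m. {l ! m})"
      by (auto simp: space_PiM PiE_def Pi_def)
    also have "\<dots> \<in> sets ?M"
      by (rule sets_PiM_I_finite) simp_all
    finally show ?thesis .
  next
    case False
    then have "(\<lambda>x. map x [0..<k]) -` {l} \<inter> space ?M = {}"
      by auto
    then show ?thesis
      by (simp only: sets.empty_sets)
  qed
  then have "(\<lambda>x. map x [0..<k]) \<in> measurable ?M (count_space UNIV)"
    by (intro measurable_count_space_eq2_countable[THEN iffD2] conjI ballI) simp_all
  moreover have "(\<lambda>l. measure_pmf (stage_law G \<omega> \<sigma> \<rho> l))
      \<in> measurable (count_space UNIV) (subprob_algebra (count_space UNIV))"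
    by (auto simp: space_subprob_algebra intro: measure_pmf.subprob_space_axioms)
  ultimately show "stage_kernel G \<omega> \<sigma> \<rho> k
      \<in> measurable ?M (subprob_algebra (count_space UNIV))"
    unfolding stage_kernel_def by (rule measurable_compose)
qed (unfold stage_kernel_def, rule measure_pmf.prob_space_axioms)

lemma
  fixes G :: "('w::finite, 'i::finite, 'j::finite) stochastic_game"
  shows prob_space_play_measure: "prob_space (play_measure G \<omega> \<sigma> \<rho>)"
    and sets_play_measure: "sets (play_measure G \<omega> \<sigma> \<rho>) = sets (PiM UNIV (\<lambda>_. count_space UNIV))"
    and measure_play_cylinder:
      "measure (play_measure G \<omega> \<sigma> \<rho>) {h. \<forall>k<n. h k = x k} =
         (\<Prod>k<n. pmf (stage_law G \<omega> \<sigma> \<rho> (map x [0..<k])) (x k))"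
proof -
  interpret IT: Ionescu_Tulcea "stage_kernel G \<omega> \<sigma> \<rho>" "\<lambda>_. count_space UNIV"
    by (rule Ionescu_Tulcea_stage_kernel)
  let ?M = "\<lambda>J. PiM J (\<lambda>_. count_space (UNIV :: ('w \<times> 'i \<times> 'j) set))"
  let ?u = "\<lambda>_::nat. undefined :: 'w \<times> 'i \<times> 'j"
  let ?X = "\<lambda>n. PiE {0..<n} (\<lambda>k. {x k})"
  have X: "?X n \<in> sets (?M {0..<n})" for n
    by (intro sets_PiM_I_finite) auto
  have u: "?u \<in> space (?M {0..<0})"
    by (auto simp: space_PiM)
  have emb: "prod_emb UNIV (\<lambda>_. count_space UNIV) {0..<n} (?X n) = {h. \<forall>k<n. h k = x k}" for n
    by (auto simp: prod_emb_def space_PiM PiE_iff restrict_def)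
  show s: "sets (play_measure G \<omega> \<sigma> \<rho>) = sets (?M UNIV)"
    by (simp add: play_measure_def)
  have lim: "emeasure (play_measure G \<omega> \<sigma> \<rho>) {h. \<forall>k<n. h k = x k} = emeasure (IT.C 0 n ?u) (?X n)" for n
  proof -
    have "emeasure (play_measure G \<omega> \<sigma> \<rho>) {h. \<forall>k<n. h k = x k} = emeasure (IT.CI {0..<n}) (?X n)"
      unfolding play_measure_def emb[symmetric] by (rule IT.lim) (use X in auto)
    also have "\<dots> = emeasure (IT.C 0 n ?u) (prod_emb {0..<n} (\<lambda>_. count_space UNIV) {0..<n} (?X n))"
      by (rule IT.emeasure_CI) (use X in auto)
    also have "prod_emb {0..<n} (\<lambda>_. count_space UNIV) {0..<n} (?X n) = ?X n"
      by (rule prod_emb_id) (auto simp: PiE_iff)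
    finally show ?thesis .
  qed
  have C: "emeasure (IT.C 0 n ?u) (?X n)
      = (\<Prod>k<n. ennreal (pmf (stage_law G \<omega> \<sigma> \<rho> (map x [0..<k])) (x k)))" for n
  proof (induction n)
    case 0
    have "emeasure (return (?M {0..<0}) ?u) (?X 0) = indicator (?X 0) ?u"
      by (rule emeasure_return[OF X])
    then show ?case by simp
  next
    case (Suc n)
    have m: "IT.eP n \<in> measurable (IT.C 0 n ?u) (subprob_algebra (?M {0..<Suc n}))"
      by (subst measurable_cong_sets[OF IT.sets_C[OF u, of n, unfolded add_0] refl])
         (rule IT.measurable_eP)
    have sC: "sets (IT.C 0 n ?u) = sets (?M {0..<n})"
      by (rule IT.sets_C[OF u, of n, unfolded add_0])
    have "emeasure (IT.C 0 (Suc n) ?u) (?X (Suc n))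
        = (\<integral>\<^sup>+y. emeasure (IT.eP n y) (?X (Suc n)) \<partial>IT.C 0 n ?u)"
      unfolding IT.C.simps add_0
      by (rule emeasure_bind[OF _ m X]) (rule prob_space.not_empty[OF IT.prob_space_C[OF u]])
    also have "\<dots> = (\<integral>\<^sup>+y. ennreal (pmf (stage_law G \<omega> \<sigma> \<rho> (map x [0..<n])) (x n)) * indicator (?X n) y \<partial>IT.C 0 n ?u)"
    proof (intro nn_integral_cong)
      fix y assume "y \<in> space (IT.C 0 n ?u)"
      then have y: "y \<in> space (?M {0..<n})"
        unfolding sets_eq_imp_space_eq[OF sC] .
      have "y(n := z) \<in> ?X (Suc n) \<longleftrightarrow> y \<in> ?X n \<and> z = x n" for z
      proof -
        have "y \<in> extensional {0..<n}" "y(n := z) \<in> extensional {0..<Suc n}"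
          using y by (auto simp: space_PiM PiE_iff extensional_def)
        then show ?thesis
          by (simp add: PiE_iff atLeast0_lessThan_Suc) (metis atLeastLessThan_iff less_irrefl)
      qed
      then have un: "(\<lambda>z. y(n := z)) -` ?X (Suc n) \<inter> UNIV = (if y \<in> ?X n then {x n} else {})"
        by (simp add: set_eq_iff)
      have mp: "map y [0..<n] = map x [0..<n]" if "y \<in> ?X n"
        using that by (auto simp: PiE_iff)
      have eP: "emeasure (IT.eP n y) (?X (Suc n))
          = emeasure (stage_kernel G \<omega> \<sigma> \<rho> n y) (if y \<in> ?X n then {x n} else {})"
        unfolding IT.emeasure_eP[OF y X[of "Suc n"]] space_count_space un ..
      show "emeasure (IT.eP n y) (?X (Suc n))
         = ennreal (pmf (stage_law G \<omega> \<sigma> \<rho> (map x [0..<n])) (x n)) * indicator (?X n) y"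
      proof (cases "y \<in> ?X n")
        case True
        show ?thesis
          unfolding eP stage_kernel_def mp[OF True] emeasure_pmf_single if_P[OF True]
            indicator_simps(1)[OF True] mult_1_right ..
      next
        case False
        show ?thesis
          unfolding eP if_not_P[OF False] indicator_simps(2)[OF False] mult_zero_right emeasure_empty ..
      qed
    qed
    also have "\<dots> = ennreal (pmf (stage_law G \<omega> \<sigma> \<rho> (map x [0..<n])) (x n)) * emeasure (IT.C 0 n ?u) (?X n)"
      by (rule nn_integral_cmult_indicator) (unfold sC, rule X)
    finally show ?case
      unfolding Suc.IH prod.lessThan_Suc by (rule trans) (rule mult.commute)
  qed
  show "prob_space (play_measure G \<omega> \<sigma> \<rho>)"
  proof
    have "space (play_measure G \<omega> \<sigma> \<rho>) = {h. \<forall>k<0. h k = x k}"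
      unfolding sets_eq_imp_space_eq[OF s] by (simp add: space_PiM)
    then show "emeasure (play_measure G \<omega> \<sigma> \<rho>) (space (play_measure G \<omega> \<sigma> \<rho>)) = 1"
      by (simp only: lim C lessThan_0 prod.empty)
  qed
  show "measure (play_measure G \<omega> \<sigma> \<rho>) {h. \<forall>k<n. h k = x k} =
         (\<Prod>k<n. pmf (stage_law G \<omega> \<sigma> \<rho> (map x [0..<k])) (x k))"
    unfolding measure_def lim C prod_ennreal[OF pmf_nonneg]
    by (intro enn2real_ennreal prod_nonneg pmf_nonneg)
qed

definition stage_payoff ::
  "('w, 'i, 'j) stochastic_game \<Rightarrow> nat \<Rightarrow> (nat \<Rightarrow> 'w \<times> 'i \<times> 'j) \<Rightarrow> real" where
  "stage_payoff G m h = (case h (m - 1) of (w, i, j) \<Rightarrow> payoff G w i j)"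

definition expect ::
  "('w, 'i, 'j) stochastic_game \<Rightarrow> 'w \<Rightarrow> ('w, 'i, 'j, 'i) strategy \<Rightarrow> ('w, 'i, 'j, 'j) strategy
    \<Rightarrow> ((nat \<Rightarrow> 'w \<times> 'i \<times> 'j) \<Rightarrow> real) \<Rightarrow> real" where
  "expect G \<omega> \<sigma> \<rho> X = (\<integral>h. X h \<partial>play_measure G \<omega> \<sigma> \<rho>)"

definition nstage_payoff ::
  "('w, 'i, 'j) stochastic_game \<Rightarrow> nat \<Rightarrow> 'w \<Rightarrow> ('w, 'i, 'j, 'i) strategy
    \<Rightarrow> ('w, 'i, 'j, 'j) strategy \<Rightarrow> real" where
  "nstage_payoff G n \<omega> \<sigma> \<rho> =
     expect G \<omega> \<sigma> \<rho> (\<lambda>h. (1 / real n) * (\<Sum>m = 1..n. stage_payoff G m h))"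

text \<open>The maximum and the minimum in the definition of the value are attained, so they are
  the supremum and the infimum over all strategies.\<close>

definition nstage_value :: "('w, 'i, 'j) stochastic_game \<Rightarrow> nat \<Rightarrow> 'w \<Rightarrow> real" where
  "nstage_value G n \<omega> = (SUP \<sigma>. INF \<rho>. nstage_payoff G n \<omega> \<sigma> \<rho>)"

definition eps_optimal1 ::
  "('w, 'i, 'j) stochastic_game \<Rightarrow> nat \<Rightarrow> real \<Rightarrow> ('w, 'i, 'j, 'i) strategy \<Rightarrow> bool" where
  "eps_optimal1 G n \<epsilon> \<sigma> \<longleftrightarrow> (\<forall>\<rho> \<omega>. nstage_payoff G n \<omega> \<sigma> \<rho> \<ge> nstage_value G n \<omega> - \<epsilon>)"

definition eps_optimal2 ::
  "('w, 'i, 'j) stochastic_game \<Rightarrow> nat \<Rightarrow> real \<Rightarrow> ('w, 'i, 'j, 'j) strategy \<Rightarrow> bool" where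
  "eps_optimal2 G n \<epsilon> \<rho> \<longleftrightarrow> (\<forall>\<sigma> \<omega>. nstage_payoff G n \<omega> \<sigma> \<rho> \<le> nstage_value G n \<omega> + \<epsilon>)"

text \<open>By the theorem of Bewley and Kohlberg the values of the \<open>n\<close>-stage games converge for every
  finite game, so \<open>lim\<close> is the actual limit; it is also the limit of the discounted values.\<close>

definition limit_value :: "('w, 'i, 'j) stochastic_game \<Rightarrow> 'w \<Rightarrow> real" where
  "limit_value G \<omega> = lim (\<lambda>n. nstage_value G n \<omega>)"

end

theory Submission
  imports Defs
begin

text \<open>The discounted value \<open>v\<^sub>l\<close> with discount factor \<open>l\<close> is the fixed point of the Shapley operator.
  Following Attia and Oliu-Barton, expanding \<open>det (I - (1 - l) Q)\<close> over pure stationary profiles turns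
  \<open>z = v\<^sub>l(k)\<close> into the statement that a single matrix game, with entries polynomial in \<open>(l, z)\<close>,
  has value \<open>0\<close>.  By a Shapley--Snow argument \<open>(l, v\<^sub>l(k))\<close> is then a zero of a nonzero polynomial,
  so all but finitely many levels are attained a bounded number of times.  Hence \<open>v\<^sub>l\<close> converges
  as \<open>l\<close> tends to \<open>0\<close>, and its variation on \<open>[s, a s]\<close> tends to \<open>0\<close> with \<open>s\<close>.

  Small variation and an envelope argument give, in every interval \<open>[s, a s]\<close> with \<open>s\<close> small, a factor \<open>l\<close>
  and a pair of optimal stationary strategies whose transition matrix satisfies
  \<open>Q v\<^sub>l - v\<^sub>l = (1 - l) Q \<pi> - \<pi>\<close> with a small vector \<open>\<pi>\<close>: the expectation of \<open>v\<^sub>l\<close> does not drift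
  over times of order \<open>1/l\<close>.

  In the \<open>n\<close>-stage game the players use such a pair with \<open>l\<close> close to, and not smaller than,
  the inverse of the number of remaining stages, changing \<open>l\<close> a bounded number of times.
  Since \<open>v\<^sub>l\<close> cannot move by more than \<open>O(l)\<close> per stage in the direction that hurts the player,
  these strategies are asymptotically optimal; since the expectation of the limit value is almost constant along
  the play, so is the average payoff.\<close>

text \<open>Optimality controls only a combination of payoff and continuation value, so an optimal
  pair may let the expected value drift while the payoffs compensate. If v_l were differentiable,
  the envelope theorem would give p = g - Q v_l + (1 - l) Q p for the derivative p and suitable
  optimal pairs; multiplied by l and combined with the Shapley equation, this is the drift identity
  with \<pi> = l p. One l per scale suffices, so small difference quotients replace the derivative,
  and a variation o(1) over [s, a s] is enough: an average slope o(1) / ((a - 1) s) times l \<le> a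
  s is small.

  The order of the constants matters. \<open>\<eta>\<close> (mismatch between l and the stages left)
  and \<open>\<theta>\<close> (fraction of stages given up at the end) come first and fix the bound
  \<open>K\<close> on the blocks; only then is \<open>\<delta>\<close> chosen, small compared with 1
  / \<open>K\<close>, because each change of l costs O(\<open>\<delta>\<close>). Without giving up
  the last stages the number of blocks would grow like log n.\<close>

section \<open>Functions with small level sets\<close>

text \<open>A level attained finitely often is avoided near 0, so by continuity f stays on one side
  of it there. \<open>A\<close> collects the levels that f eventually exceeds, and L is its
  supremum; staying above an admissible level c > L would put c into \<open>A\<close>.\<close>

lemma converges_at_right_if_finite_level_sets:
  fixes f :: "real \<Rightarrow> real"
  assumes cont: "continuous_on {0<..<1} f" and bd: "\<And>l. 0 < l \<Longrightarrow> l < 1 \<Longrightarrow> \<bar>f l\<bar> \<le> C"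
    and E: "finite E" and fin: "\<And>c. c \<notin> E \<Longrightarrow> finite {l \<in> {0<..<1}. f l = c}"
  shows "\<exists>L. (f \<longlongrightarrow> L) (at_right 0)"
proof -
  define A where "A = {c. \<forall>\<^sub>F l in at_right 0. f l > c}"
  have ev1: "\<forall>\<^sub>F l in at_right (0::real). l \<in> {0<..<1}"
    by (rule eventually_at_right_real) simp
  have mem: "- C - 1 \<in> A"
    unfolding A_def mem_Collect_eq using ev1
    by eventually_elim (use bd in \<open>force simp: abs_le_iff\<close>)
  have ub: "c \<le> C" if "c \<in> A" for c
  proof -
    have "\<forall>\<^sub>F l in at_right 0. f l > c \<and> l \<in> {0<..<1}"
      using that ev1 unfolding A_def by (auto intro: eventually_conj)
    then obtain l where "f l > c" "l \<in> {0<..<1}"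
      using eventually_happens[of _ "at_right (0::real)"] by (auto simp: trivial_limit_at_right_real)
    then show ?thesis using bd[of l] by force
  qed
  define L where "L = Sup A"
  have bA: "bdd_above A" using ub by (auto simp: bdd_above_def)
  have "(f \<longlongrightarrow> L) (at_right 0)"
  proof (rule order_tendstoI)
    fix a assume "a < L"
    then obtain c where "c \<in> A" "a < c"
      unfolding L_def using less_cSup_iff[OF _ bA] mem by blast
    then show "\<forall>\<^sub>F l in at_right 0. a < f l"
      unfolding A_def by (auto elim: eventually_mono)
  next
    fix b assume "L < b"
    have "infinite ({L<..<b} - E)" using \<open>L < b\<close> E by (simp add: infinite_Ioo)
    then obtain c where c: "L < c" "c < b" "c \<notin> E" by (metis Diff_iff ex_in_conv finite.emptyI greaterThanLessThan_iff)
    have "c \<notin> A" using c(1) cSup_upper[OF _ bA, of c] unfolding L_def by force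
    \<comment> \<open>The point 1 keeps \<open>F\<close> nonempty when the level c is never
      attained.\<close>
    define F where "F = insert 1 {l \<in> {0<..<1}. f l = c}"
    have F: "finite F" "F \<noteq> {}" unfolding F_def using fin[OF c(3)] by auto
    define d where "d = Min F"
    have d: "0 < d" "d \<le> 1" unfolding d_def using F by (auto simp: F_def)
    have nz: "f l \<noteq> c" if "0 < l" "l < d" for l
    proof
      assume "f l = c"
      then have "l \<in> F" using that d unfolding F_def by auto
      then have "d \<le> l" unfolding d_def using F by simp
      then show False using that by simp
    qed
    have evd: "\<forall>\<^sub>F l in at_right (0::real). l \<in> {0<..<d}"
      by (rule eventually_at_right_real) (rule d)
    have sub: "f l > c" if "0 < l" "l < d" "0 < l'" "l' < d" "f l' > c" for l l'
    proof (rule ccontr)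
      assume "\<not> f l > c"
      have seg: "closed_segment l l' \<subseteq> {0<..<d}" using that by (auto simp: closed_segment_eq_real_ivl)
      have "connected (f ` {0<..<d})"
        by (rule connected_continuous_image[OF continuous_on_subset[OF cont]]) (use d in auto)
      then have "c \<in> f ` {0<..<d}"
        using connectedD_interval[of "f ` {0<..<d}" "f l" "f l'" c] that \<open>\<not> f l > c\<close> by auto
      then obtain x where "x \<in> {0<..<d}" "f x = c" by blast
      then show False using nz[of x] by auto
    qed
    have "f l < c" if "0 < l" "l < d" for l
    proof (rule ccontr)
      assume "\<not> f l < c"
      then have "f l > c" using nz[OF that] by simp
      then have "\<forall>\<^sub>F l in at_right 0. f l > c"
        using evd sub that by (auto elim!: eventually_mono)
      then show False using \<open>c \<notin> A\<close> unfolding A_def by simp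
    qed
    then show "\<forall>\<^sub>F l in at_right 0. f l < b"
      using evd c(2) by (force elim!: eventually_mono)
  qed
  then show ?thesis by blast
qed

text \<open>Banach indicatrix: the variation is the integral over \<open>c\<close> of the number of crossings
  of the level \<open>c\<close>.\<close>

lemma variation_le_level_sets:
  fixes f :: "real \<Rightarrow> real"
  assumes cont: "continuous_on {s..t} f" and E: "finite E"
    and fin: "\<And>c. c \<notin> E \<Longrightarrow> finite {l \<in> {s..t}. f l = c} \<and> card {l \<in> {s..t}. f l = c} \<le> d"
    and range: "\<And>l. l \<in> {s..t} \<Longrightarrow> \<bar>f l - L\<bar> \<le> e" and e: "0 \<le> e"
    and p: "\<And>k. k \<le> K \<Longrightarrow> p k \<in> {s..t}" "\<And>k. k < K \<Longrightarrow> p k < p (Suc k)"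
  shows "(\<Sum>k<K. \<bar>f (p (Suc k)) - f (p k)\<bar>) \<le> 2 * e * real d"
proof -
  \<comment> \<open>The intervals are open, so the crossing of a level in \<open>J k\<close> lies
    strictly between \<open>p k\<close> and \<open>p (Suc k)\<close>; different k therefore give
    different preimages.\<close>
  define J where "J k = {min (f (p k)) (f (p (Suc k)))<..<max (f (p k)) (f (p (Suc k)))}" for k
  have mJ: "measure lborel (J k) = \<bar>f (p (Suc k)) - f (p k)\<bar>" for k
    unfolding J_def by (auto simp: min_def max_def)
  have iJ: "integrable lborel (indicator (J k) :: real \<Rightarrow> real)" for k
    unfolding J_def by (rule integrable_real_indicator) (auto simp: min_def max_def)
  have pm: "p k \<le> p k'" if "k \<le> k'" "k' \<le> K" for k k'
    using that
  proof (induction k')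
    case (Suc n)
    show ?case
    proof (cases "k = Suc n")
      case False
      then have "p k \<le> p n" using Suc by auto
      then show ?thesis using p(2)[of n] Suc by auto
    qed auto
  qed auto
  have root: "\<exists>x. p k < x \<and> x < p (Suc k) \<and> f x = c" if "k < K" "c \<in> J k" for k c
  proof -
    have c: "continuous_on {p k..p (Suc k)} f"
      by (rule continuous_on_subset[OF cont]) (use p[of k] p(1)[of "Suc k"] that in auto)
    have "\<exists>x. p k \<le> x \<and> x \<le> p (Suc k) \<and> f x = c"
    proof (cases "f (p k) \<le> f (p (Suc k))")
      case True
      show ?thesis by (rule IVT') (use True that p(2)[of k] c in \<open>auto simp: J_def\<close>)
    next
      case False
      show ?thesis by (rule IVT2') (use False that p(2)[of k] c in \<open>auto simp: J_def\<close>)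
    qed
    then obtain x where x: "p k \<le> x" "x \<le> p (Suc k)" "f x = c" by blast
    moreover have "x \<noteq> p k" "x \<noteq> p (Suc k)" using x that unfolding J_def by auto
    ultimately show ?thesis by (intro exI[of _ x]) auto
  qed
  have pt: "(\<Sum>k<K. indicator (J k) c) \<le> real d * indicator {L - e..L + e} c" if c: "c \<notin> E" for c
  proof (cases "\<exists>k<K. c \<in> J k")
    case False
    then have "(\<Sum>k<K. indicator (J k) c) = (0::real)" by (intro sum.neutral) auto
    then show ?thesis by simp
  next
    case True
    define I where "I = {k. k < K \<and> c \<in> J k}"
    have fI: "finite I" unfolding I_def by simp
    define x where "x k = (SOME x. p k < x \<and> x < p (Suc k) \<and> f x = c)" for k
    have x: "p k < x k" "x k < p (Suc k)" "f (x k) = c" if "k \<in> I" for k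
      using someI_ex[OF root[of k c]] that unfolding x_def[symmetric] I_def by auto
    have "inj_on x I"
    proof (rule inj_onI)
      fix k k' assume k: "k \<in> I" "k' \<in> I" "x k = x k'"
      show "k = k'"
      proof (rule ccontr)
        assume "k \<noteq> k'"
        then consider "Suc k \<le> k'" | "Suc k' \<le> k" by linarith
        then show False
        proof cases
          case 1
          then have "p (Suc k) \<le> p k'" using pm[of "Suc k" k'] k unfolding I_def by auto
          then show False using x[of k] x[of k'] k by auto
        next
          case 2
          then have "p (Suc k') \<le> p k" using pm[of "Suc k'" k] k unfolding I_def by auto
          then show False using x[of k] x[of k'] k by auto
        qed
      qed
    qed
    moreover have "x ` I \<subseteq> {l \<in> {s..t}. f l = c}"
    proof safe
      fix k assume k: "k \<in> I"
      then have "p k \<in> {s..t}" "p (Suc k) \<in> {s..t}" using p(1)[of k] p(1)[of "Suc k"] unfolding I_def by auto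
      then show "x k \<in> {s..t}" using x[OF k] by auto
      show "f (x k) = c" using x[OF k] by auto
    qed
    ultimately have "card I \<le> d"
      using fin[OF c] by (meson card_inj_on_le le_trans)
    moreover have "(\<Sum>k<K. indicator (J k) c) = real (card I)"
      by (subst sum.mono_neutral_right[of _ I]) (auto simp: I_def indicator_def)
    moreover have "c \<in> {L - e..L + e}"
    proof -
      obtain k where "k < K" "c \<in> J k" using True by blast
      then show ?thesis using range[OF p(1)[of k]] range[OF p(1)[of "Suc k"]]
        unfolding J_def by (auto simp: min_def max_def abs_le_iff split: if_splits)
    qed
    ultimately show ?thesis by simp
  qed
  have "(\<Sum>k<K. \<bar>f (p (Suc k)) - f (p k)\<bar>) = (\<integral>c. (\<Sum>k<K. indicator (J k) c) \<partial>lborel)"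
    by (subst Bochner_Integration.integral_sum) (use iJ mJ in auto)
  also have "\<dots> \<le> (\<integral>c. real d * indicator {L - e..L + e} c \<partial>lborel)"
  proof (rule integral_mono_AE)
    have "E \<in> null_sets lborel" by (rule finite_imp_null_set_lborel[OF E])
    then have "AE c in lborel. c \<notin> E" by (rule AE_not_in)
    then show "AE c in lborel. (\<Sum>k<K. indicator (J k) c) \<le> real d * indicator {L - e..L + e} c"
      by eventually_elim (rule pt)
    show "integrable lborel (\<lambda>c. \<Sum>k<K. indicator (J k) c :: real)" using iJ by auto
    show "integrable lborel (\<lambda>c. real d * indicator {L - e..L + e} c :: real)"
      using e by (auto intro!: integrable_mult_right integrable_real_indicator)
  qed
  also have "\<dots> = 2 * e * real d" using e by simp
  finally show ?thesis .
qed

section \<open>Matrix games\<close>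

definition mixed :: "(real^'n) set" where
  "mixed = {x. (\<forall>i. 0 \<le> x$i) \<and> (\<Sum>i\<in>UNIV. x$i) = 1}"

definition mexp :: "('i::finite \<Rightarrow> 'j::finite \<Rightarrow> real) \<Rightarrow> real^'i \<Rightarrow> real^'j \<Rightarrow> real" where
  "mexp A x y = (\<Sum>i\<in>UNIV. \<Sum>j\<in>UNIV. x$i * y$j * A i j)"

definition is_value :: "('i::finite \<Rightarrow> 'j::finite \<Rightarrow> real) \<Rightarrow> real \<Rightarrow> bool" where
  "is_value A t \<longleftrightarrow> (\<exists>x\<in>mixed. \<forall>y\<in>mixed. t \<le> mexp A x y) \<and> (\<exists>y\<in>mixed. \<forall>x\<in>mixed. mexp A x y \<le> t)"

lemma mixedI: "(\<And>i. 0 \<le> x$i) \<Longrightarrow> (\<Sum>i\<in>UNIV. x$i) = 1 \<Longrightarrow> x \<in> mixed"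
  by (simp add: mixed_def)

lemma mixed_nonneg: "x \<in> mixed \<Longrightarrow> 0 \<le> x$i"
  by (simp add: mixed_def)

lemma mixed_sum: "x \<in> mixed \<Longrightarrow> (\<Sum>i\<in>UNIV. x$i) = 1"
  by (simp add: mixed_def)

lemma mixed_axis: "axis i 1 \<in> mixed"
  by (auto simp: mixed_def axis_def)

lemma mixed_nonempty: "mixed \<noteq> {}"
  using mixed_axis by blast

lemma convex_mixed: "convex mixed"
  by (rule convexI) (auto simp: mixed_def sum.distrib sum_distrib_left[symmetric])

lemma closed_mixed: "closed (mixed :: (real^'n) set)"
proof -
  have "mixed = (\<Inter>i. {x::real^'n. 0 \<le> x$i}) \<inter> {x. (\<Sum>i\<in>UNIV. x$i) = 1}"
    by (auto simp: mixed_def)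
  moreover have "closed \<dots>"
    by (intro closed_Int closed_INT ballI closed_Collect_le closed_Collect_eq continuous_intros)
  ultimately show ?thesis by simp
qed

lemma norm_mixed: "x \<in> mixed \<Longrightarrow> norm x \<le> 1"
  using norm_le_l1_cart[of x] mixed_sum[of x] mixed_nonneg[of x] by simp

lemma compact_mixed: "compact (mixed :: (real^'n) set)"
  using closed_mixed norm_mixed by (auto simp: compact_eq_bounded_closed bounded_iff)

lemma mexp_axis_left: "mexp A (axis i 1) y = (\<Sum>j\<in>UNIV. y$j * A i j)"
proof -
  have "mexp A (axis i 1) y = (\<Sum>i'\<in>UNIV. if i' = i then (\<Sum>j\<in>UNIV. y$j * A i' j) else 0)"
    unfolding mexp_def by (intro sum.cong) (auto simp: axis_def)
  then show ?thesis by simp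
qed

lemma mexp_axis_right: "mexp A x (axis j 1) = (\<Sum>i\<in>UNIV. x$i * A i j)"
proof -
  have "mexp A x (axis j 1) = (\<Sum>i\<in>UNIV. \<Sum>j'\<in>UNIV. if j' = j then x$i * A i j' else 0)"
    unfolding mexp_def by (intro sum.cong) (auto simp: axis_def)
  then show ?thesis by simp
qed

lemma mexp_left: "mexp A x y = (\<Sum>i\<in>UNIV. x$i * mexp A (axis i 1) y)"
  unfolding mexp_axis_left by (simp add: mexp_def sum_distrib_left mult_ac)

lemma mexp_add: "mexp (\<lambda>i j. A i j + B i j) x y = mexp A x y + mexp B x y"
  and mexp_diff: "mexp (\<lambda>i j. A i j - B i j) x y = mexp A x y - mexp B x y"
  and mexp_cmult: "mexp (\<lambda>i j. c * A i j) x y = c * mexp A x y"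
  by (simp_all add: mexp_def algebra_simps sum.distrib sum_subtractf sum_distrib_left)

lemma mexp_const: "x \<in> mixed \<Longrightarrow> y \<in> mixed \<Longrightarrow> mexp (\<lambda>i j. c) x y = c"
  by (simp add: mexp_def sum_distrib_left[symmetric] sum_distrib_right[symmetric] mixed_sum)

lemma mexp_mono:
  assumes "x \<in> mixed" "y \<in> mixed" "\<And>i j. A i j \<le> B i j"
  shows "mexp A x y \<le> mexp B x y"
  unfolding mexp_def by (intro sum_mono mult_left_mono assms mult_nonneg_nonneg mixed_nonneg)

text \<open>Separation: by hypothesis the payoff vectors of the mixed y, a convex set
  \<open>P\<close>, miss the open negative orthant \<open>N\<close>. The normal a of a separating
  hyperplane has no negative component, since inner products over \<open>N\<close> would be
  unbounded, and b is not negative, since 0 lies in the closure of \<open>N\<close>. Dividing a by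
  the sum of its components gives the strategy.\<close>

lemma minimax_alternative:
  fixes A :: "'i::finite \<Rightarrow> 'j::finite \<Rightarrow> real"
  assumes "\<And>y. y \<in> mixed \<Longrightarrow> \<exists>i. 0 \<le> mexp A (axis i 1) y"
  shows "\<exists>x\<in>mixed. \<forall>y\<in>mixed. 0 \<le> mexp A x y"
proof -
  define N :: "(real^'i) set" where "N = {z. \<forall>i. z$i < 0}"
  define P where "P = (\<lambda>y. \<chi> i. mexp A (axis i 1) y) ` mixed"
  have lin: "linear (\<lambda>y. (\<chi> i. mexp A (axis i 1) y) :: real^'i)"
    by (rule linearI) (auto simp: vec_eq_iff mexp_axis_left algebra_simps sum.distrib sum_distrib_left)
  have cP: "convex P" unfolding P_def by (rule convex_linear_image[OF lin convex_mixed])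
  have cN: "convex N"
  proof (rule convexI)
    fix x y :: "real^'i" and u v :: real
    assume "x \<in> N" "y \<in> N" "0 \<le> u" "0 \<le> v" "u + v = 1"
    then show "u *\<^sub>R x + v *\<^sub>R y \<in> N"
      unfolding N_def using convex_bound_lt[of _ 0 _ u v] by auto
  qed
  have neN: "N \<noteq> {}" using exI[of "\<lambda>z. z \<in> N" "\<chi> i. -1"] unfolding N_def by auto
  have neP: "P \<noteq> {}" unfolding P_def using mixed_nonempty by auto
  have dis: "N \<inter> P = {}" unfolding N_def P_def using assms by (force simp: not_less[symmetric])
  obtain a b where a: "a \<noteq> 0" and aN: "\<And>z. z \<in> N \<Longrightarrow> inner a z \<le> b" and aP: "\<And>z. z \<in> P \<Longrightarrow> inner a z \<ge> b"
    using separating_hyperplane_sets[OF cN cP neN neP dis] by blast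
  have b0: "0 \<le> b"
  proof (rule ccontr)
    assume "\<not> 0 \<le> b"
    define c where "c = b / 2"
    define s where "s = (\<Sum>i\<in>UNIV. a$i)"
    \<comment> \<open>The point with all components -e lies in \<open>N\<close>, and e is so small
      that its inner product with a is at least b / 2, hence above the negative b.\<close>
    define e where "e = - c / (\<bar>s\<bar> + 1)"
    have e: "e > 0" unfolding e_def by (rule divide_pos_pos) (use \<open>\<not> 0 \<le> b\<close> in \<open>auto simp: c_def\<close>)
    then have "inner a (\<chi> i. - e) \<le> b" by (intro aN) (auto simp: N_def)
    then have "- e * s \<le> b" by (simp add: inner_vec_def s_def sum_distrib_left sum_negf mult_ac)
    moreover have "e * \<bar>s\<bar> \<le> e * (\<bar>s\<bar> + 1)" using e by simp
    moreover have "e * (\<bar>s\<bar> + 1) = - c" unfolding e_def by (simp add: field_simps add_pos_nonneg)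
    moreover have "e * s \<le> e * \<bar>s\<bar>" using e by (intro mult_left_mono) auto
    ultimately show False using \<open>\<not> 0 \<le> b\<close> unfolding c_def by simp
  qed
  have nn: "0 \<le> a$k" for k
  proof (rule ccontr)
    assume "\<not> 0 \<le> a$k"
    define s where "s = (\<Sum>i\<in>UNIV. a$i)"
    \<comment> \<open>Makes the k-th component outweigh all others: the inner product becomes at
      least b + 1.\<close>
    define M where "M = (b + 1 + \<bar>s\<bar>) / (- a$k)"
    have M: "M > 0" unfolding M_def by (rule divide_pos_pos) (use \<open>\<not> 0 \<le> a$k\<close> b0 in auto)
    have "inner a (\<chi> i. if i = k then - M - 1 else - 1) \<le> b"
      by (intro aN) (use M in \<open>auto simp: N_def\<close>)
    moreover have "inner a (\<chi> i. if i = k then - M - 1 else - 1) = (\<Sum>i\<in>UNIV. - a$i + (if i = k then - M * a$i else 0))"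
      by (auto simp: inner_vec_def algebra_simps intro!: sum.cong)
    then have "inner a (\<chi> i. if i = k then - M - 1 else - 1) = - s - M * a$k"
      by (simp add: sum_subtractf s_def)
    moreover have "M * a$k = - (b + 1 + \<bar>s\<bar>)" unfolding M_def using \<open>\<not> 0 \<le> a$k\<close> by (simp add: field_simps)
    ultimately show False by linarith
  qed
  define s where "s = (\<Sum>i\<in>UNIV. a$i)"
  have s: "s > 0"
  proof -
    obtain k where "a$k \<noteq> 0" using a by (auto simp: vec_eq_iff)
    then have "0 < a$k" using nn[of k] by simp
    also have "a$k \<le> s" unfolding s_def using nn by (intro member_le_sum) auto
    finally show ?thesis .
  qed
  define x where "x = (\<chi> i. a$i / s)"
  have "x \<in> mixed" unfolding x_def using s nn by (intro mixedI) (auto simp: sum_divide_distrib[symmetric] s_def)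
  moreover have "0 \<le> mexp A x y" if "y \<in> mixed" for y
  proof -
    have "b \<le> inner a (\<chi> i. mexp A (axis i 1) y)" using aP that unfolding P_def by blast
    then have "0 \<le> inner a (\<chi> i. mexp A (axis i 1) y) / s" using b0 s by auto
    also have "\<dots> = mexp A x y"
      by (subst mexp_left) (simp add: inner_vec_def x_def sum_divide_distrib)
    finally show ?thesis .
  qed
  ultimately show ?thesis by blast
qed

lemma continuous_on_mexp_right: "continuous_on S (mexp A x)"
  unfolding mexp_def by (intro continuous_intros)

lemma continuous_on_MAX:
  fixes g :: "'a \<Rightarrow> 'b::topological_space \<Rightarrow> real"
  assumes "finite I" "I \<noteq> {}" "\<And>i. i \<in> I \<Longrightarrow> continuous_on S (g i)"
  shows "continuous_on S (\<lambda>y. MAX i\<in>I. g i y)"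
  using assms
proof (induction I rule: finite_ne_induct)
  case (insert i I)
  then have "continuous_on S (\<lambda>y. max (g i y) (MAX i\<in>I. g i y))"
    by (intro continuous_on_max) auto
  then show ?case using insert.hyps by (simp add: Max_insert)
qed simp

text \<open>The value is the minimum over y of the largest row payoff. Every y' leaves some row at
  or above this minimum, so the alternative, applied to the matrix shifted by it, supplies the
  strategy of player 1; the minimiser serves player 2.\<close>

lemma ex_is_value: "\<exists>t. is_value A t"
proof -
  define f where "f y = (MAX i\<in>UNIV. mexp A (axis i 1) y)" for y
  have f_le: "f y \<le> t \<longleftrightarrow> (\<forall>i. mexp A (axis i 1) y \<le> t)" for y t
    unfolding f_def by auto
  have f_ge: "t \<le> f y \<longleftrightarrow> (\<exists>i. t \<le> mexp A (axis i 1) y)" for y t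
    unfolding f_def by (subst Max_ge_iff) auto
  have cont: "continuous_on mixed f"
    unfolding f_def by (rule continuous_on_MAX) (auto intro: continuous_on_mexp_right)
  obtain y where y: "y \<in> mixed" "\<And>y'. y' \<in> mixed \<Longrightarrow> f y \<le> f y'"
    using continuous_attains_inf[OF compact_mixed mixed_nonempty cont] by blast
  have "\<exists>x\<in>mixed. \<forall>y'\<in>mixed. 0 \<le> mexp (\<lambda>i j. A i j - f y) x y'"
  proof (rule minimax_alternative)
    fix y' :: "real^'b" assume y': "y' \<in> mixed"
    from y(2)[OF y'] obtain i where "f y \<le> mexp A (axis i 1) y'" using f_ge by blast
    then show "\<exists>i. 0 \<le> mexp (\<lambda>i j. A i j - f y) (axis i 1) y'"
      by (intro exI[of _ i]) (simp add: mexp_diff mexp_const mixed_axis y')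
  qed
  then obtain x where x: "x \<in> mixed" "\<And>y'. y' \<in> mixed \<Longrightarrow> f y \<le> mexp A x y'"
    by (auto simp: mexp_diff mexp_const)
  have "mexp A x' y \<le> f y" if "x' \<in> mixed" for x'
  proof -
    have "mexp A x' y \<le> (\<Sum>i\<in>UNIV. x'$i * f y)"
      by (subst mexp_left) (use f_le[of y "f y"] in \<open>auto intro!: sum_mono mult_left_mono mixed_nonneg that\<close>)
    then show ?thesis by (simp add: sum_distrib_right[symmetric] mixed_sum[OF that])
  qed
  then show ?thesis unfolding is_value_def using x y(1) by blast
qed

text \<open>Let the strategy of player 1 that is optimal in A meet the strategy of player 2 that is
  optimal in B. For A = B and e = 0 this is uniqueness of the value.\<close>

lemma is_value_le:
  assumes "is_value A s" "is_value B t" "\<And>i j. A i j \<le> B i j + e"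
  shows "s \<le> t + e"
proof -
  obtain x where x: "x \<in> mixed" "\<And>y. y \<in> mixed \<Longrightarrow> s \<le> mexp A x y"
    using assms(1) unfolding is_value_def by blast
  obtain y where y: "y \<in> mixed" "\<And>x. x \<in> mixed \<Longrightarrow> mexp B x y \<le> t"
    using assms(2) unfolding is_value_def by blast
  have "s \<le> mexp A x y" using x y by simp
  also have "\<dots> \<le> mexp (\<lambda>i j. B i j + e) x y" by (rule mexp_mono[OF x(1) y(1) assms(3)])
  also have "\<dots> = mexp B x y + e" by (simp add: mexp_add mexp_const x y)
  also have "\<dots> \<le> t + e" using x y by simp
  finally show ?thesis .
qed

definition game_value :: "('i::finite \<Rightarrow> 'j::finite \<Rightarrow> real) \<Rightarrow> real" where
  "game_value A = (SOME t. is_value A t)"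

lemma is_value_game_value: "is_value A (game_value A)"
  unfolding game_value_def by (rule someI_ex[OF ex_is_value])

lemma game_value_diff_le:
  assumes "\<And>i j. \<bar>A i j - B i j\<bar> \<le> e"
  shows "\<bar>game_value A - game_value B\<bar> \<le> e"
proof -
  have "A i j \<le> B i j + e" "B i j \<le> A i j + e" for i j using assms[of i j] by auto
  then have "game_value A \<le> game_value B + e" "game_value B \<le> game_value A + e"
    by (auto intro: is_value_le is_value_game_value)
  then show ?thesis by auto
qed

section \<open>Discounted games\<close>

definition nextv :: "('w::finite, 'i, 'j) stochastic_game \<Rightarrow> real^'w \<Rightarrow> 'w \<Rightarrow> 'i \<Rightarrow> 'j \<Rightarrow> real" where
  "nextv G v w i j = (\<Sum>w'\<in>UNIV. pmf (transition G w i j) w' * v$w')"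

definition shapley_mat :: "('w::finite, 'i, 'j) stochastic_game \<Rightarrow> real \<Rightarrow> real^'w \<Rightarrow> 'w \<Rightarrow> 'i \<Rightarrow> 'j \<Rightarrow> real" where
  "shapley_mat G l v w i j = l * payoff G w i j + (1 - l) * nextv G v w i j"

definition opt1 :: "('w::finite, 'i::finite, 'j::finite) stochastic_game \<Rightarrow> real \<Rightarrow> real^'w \<Rightarrow> real^'i^'w \<Rightarrow> bool" where
  "opt1 G l v x \<longleftrightarrow> (\<forall>w. x$w \<in> mixed \<and> (\<forall>y\<in>mixed. v$w \<le> mexp (shapley_mat G l v w) (x$w) y))"

definition opt2 :: "('w::finite, 'i::finite, 'j::finite) stochastic_game \<Rightarrow> real \<Rightarrow> real^'w \<Rightarrow> real^'j^'w \<Rightarrow> bool" where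
  "opt2 G l v y \<longleftrightarrow> (\<forall>w. y$w \<in> mixed \<and> (\<forall>x\<in>mixed. mexp (shapley_mat G l v w) x (y$w) \<le> v$w))"

definition payoff_bound :: "('w::finite, 'i::finite, 'j::finite) stochastic_game \<Rightarrow> real" where
  "payoff_bound G = Max (range (\<lambda>(w, i, j). \<bar>payoff G w i j\<bar>))"

text \<open>A bounded fixed point of the Shapley operator at which both players have optimal
  stationary strategies. The argument uses only these properties, so the infinite discounted game is
  never formed.\<close>

definition discounted_value :: "('w::finite, 'i::finite, 'j::finite) stochastic_game \<Rightarrow> real \<Rightarrow> real^'w" where
  "discounted_value G l =
     (SOME v. (\<forall>w. \<bar>v$w\<bar> \<le> payoff_bound G) \<and> (\<exists>x. opt1 G l v x) \<and> (\<exists>y. opt2 G l v y))"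

lemma payoff_le_bound: "\<bar>payoff G w i j\<bar> \<le> payoff_bound G"
  unfolding payoff_bound_def by (rule Max_ge) (auto intro: rev_image_eqI[of "(w, i, j)"])

lemma payoff_bound_nonneg: "0 \<le> payoff_bound G"
  by (rule order_trans[OF abs_ge_zero payoff_le_bound])

lemma sum_pmf_UNIV: "(\<Sum>w\<in>UNIV. pmf p (w::'w::finite)) = 1"
  by (rule sum_pmf_eq_1) auto

lemma nextv_le:
  assumes "\<And>w'. v$w' \<le> c"
  shows "nextv G v w i j \<le> c"
proof -
  have "nextv G v w i j \<le> (\<Sum>w'\<in>UNIV. pmf (transition G w i j) w' * c)"
    unfolding nextv_def by (intro sum_mono mult_left_mono assms) auto
  then show ?thesis by (simp add: sum_distrib_right[symmetric] sum_pmf_UNIV)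
qed

lemma nextv_diff: "nextv G (u - v) w i j = nextv G u w i j - nextv G v w i j"
  and nextv_minus: "nextv G (- v) w i j = - nextv G v w i j"
  and nextv_scaleR: "nextv G (c *\<^sub>R v) w i j = c * nextv G v w i j"
  by (simp_all add: nextv_def algebra_simps sum.distrib sum_subtractf sum_distrib_left sum_negf)

lemma nextv_abs_le:
  assumes "\<And>w'. \<bar>v$w'\<bar> \<le> c"
  shows "\<bar>nextv G v w i j\<bar> \<le> c"
  using nextv_le[of v c G w i j] nextv_le[of "- v" c G w i j] assms
  by (auto simp: nextv_minus abs_le_iff)

lemma convex_comb_abs_le:
  assumes "\<bar>a\<bar> \<le> C" "\<bar>b\<bar> \<le> C" "0 \<le> l" "l \<le> (1::real)"
  shows "\<bar>l * a + (1 - l) * b\<bar> \<le> C"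
proof -
  have "\<bar>l * a + (1 - l) * b\<bar> \<le> l * \<bar>a\<bar> + (1 - l) * \<bar>b\<bar>"
    using assms abs_triangle_ineq[of "l * a" "(1 - l) * b"] by (simp add: abs_mult)
  also have "\<dots> \<le> l * C + (1 - l) * C" using assms by (intro add_mono mult_left_mono) auto
  finally show ?thesis by (simp add: algebra_simps)
qed

lemma game_value_abs_le:
  assumes "\<And>i j. \<bar>A i j\<bar> \<le> c"
  shows "\<bar>game_value A\<bar> \<le> c"
proof -
  have 0: "is_value (\<lambda>i j. 0) 0"
    unfolding is_value_def by (intro conjI bexI[OF _ mixed_axis[of undefined]]) (auto simp: mexp_def)
  have "game_value A \<le> 0 + c"
    by (rule is_value_le[OF is_value_game_value 0]) (use assms in \<open>auto simp: abs_le_iff\<close>)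
  moreover have "0 \<le> A i j + c" for i j using assms[of i j] by linarith
  then have "0 \<le> game_value A + c"
    by (rule is_value_le[OF 0 is_value_game_value])
  ultimately show ?thesis by auto
qed

text \<open>Brouwer's theorem on the cube of vectors within the payoff bound. The operator maps the
  cube into itself, because every matrix entry is a convex combination of numbers within the bound,
  and it is continuous, because the value of a matrix game is nonexpansive in the entries.\<close>

lemma ex_shapley_fixpoint:
  fixes G :: "('w::finite, 'i::finite, 'j::finite) stochastic_game"
  assumes l: "0 < l" "l \<le> 1"
  shows "\<exists>v. (\<forall>w. \<bar>v$w\<bar> \<le> payoff_bound G) \<and> (\<forall>w. is_value (shapley_mat G l v w) (v$w))"
proof -
  define C where "C = payoff_bound G"
  define S :: "(real^'w) set" where "S = cbox (\<chi> w. - C) (\<chi> w. C)"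
  have S: "v \<in> S \<longleftrightarrow> (\<forall>w. \<bar>v$w\<bar> \<le> C)" for v
    unfolding S_def by (auto simp: mem_box_cart abs_le_iff minus_le_iff)
  define \<Psi> where "\<Psi> v = (\<chi> w. game_value (shapley_mat G l v w))" for v :: "real^'w"
  have lip: "\<bar>\<Psi> u $ w - \<Psi> v $ w\<bar> \<le> norm (u - v)" for u v w
  proof -
    have "\<bar>shapley_mat G l u w i j - shapley_mat G l v w i j\<bar> \<le> norm (u - v)" for i j
    proof -
      have "\<bar>nextv G (u - v) w i j\<bar> \<le> norm (u - v)"
        by (rule nextv_abs_le) (rule component_le_norm_cart)
      then have "(1 - l) * \<bar>nextv G (u - v) w i j\<bar> \<le> 1 * norm (u - v)"
        using l by (intro mult_mono) auto
      then show ?thesis using l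
        by (simp add: shapley_mat_def nextv_diff abs_mult flip: right_diff_distrib)
    qed
    then show ?thesis unfolding \<Psi>_def by (simp add: game_value_diff_le)
  qed
  have "continuous_on S \<Psi>"
    unfolding continuous_on_vec_lambda \<Psi>_def
  proof (intro continuous_on_vec_lambda)
    fix w
    show "continuous_on S (\<lambda>v. game_value (shapley_mat G l v w))"
      unfolding continuous_on_iff using lip[unfolded \<Psi>_def]
      by (auto simp: dist_norm intro!: exI[of _ "e" for e] intro: le_less_trans)
  qed
  moreover have "\<Psi> \<in> S \<rightarrow> S"
  proof
    fix v assume "v \<in> S"
    then have "\<bar>shapley_mat G l v w i j\<bar> \<le> C" for w i j
      unfolding shapley_mat_def C_def S using l
      by (intro convex_comb_abs_le payoff_le_bound nextv_abs_le) auto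
    then show "\<Psi> v \<in> S" unfolding S \<Psi>_def by (auto intro: game_value_abs_le)
  qed
  moreover have "S \<noteq> {}" using S[of 0] payoff_bound_nonneg[of G] by (auto simp: C_def)
  moreover have "compact S" "convex S" unfolding S_def by auto
  ultimately obtain v where v: "v \<in> S" "\<Psi> v = v" using brouwer[of S \<Psi>] by blast
  have "is_value (shapley_mat G l v w) (v$w)" for w
    using arg_cong[OF v(2), of "\<lambda>u. u$w"] is_value_game_value[of "shapley_mat G l v w"] unfolding \<Psi>_def by simp
  then show ?thesis using v(1) unfolding S C_def by blast
qed

lemma discounted_value:
  fixes G :: "('w::finite, 'i::finite, 'j::finite) stochastic_game"
  assumes l: "0 < l" "l \<le> 1"
  shows "\<bar>discounted_value G l $ w\<bar> \<le> payoff_bound G"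
    and "\<exists>x. opt1 G l (discounted_value G l) x"
    and "\<exists>y. opt2 G l (discounted_value G l) y"
proof -
  obtain v where v: "\<forall>w. \<bar>v$w\<bar> \<le> payoff_bound G" "\<And>w. is_value (shapley_mat G l v w) (v$w)"
    using ex_shapley_fixpoint[OF l, of G] by blast
  have "\<forall>w. \<exists>x\<in>mixed. \<forall>y\<in>mixed. v$w \<le> mexp (shapley_mat G l v w) x y"
    using v(2) unfolding is_value_def by blast
  then obtain x where "\<forall>w. x w \<in> mixed \<and> (\<forall>y\<in>mixed. v$w \<le> mexp (shapley_mat G l v w) (x w) y)"
    by metis
  then have "opt1 G l v (\<chi> w. x w)" unfolding opt1_def by simp
  moreover have "\<forall>w. \<exists>y\<in>mixed. \<forall>x\<in>mixed. mexp (shapley_mat G l v w) x y \<le> v$w"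
    using v(2) unfolding is_value_def by blast
  then obtain y where "\<forall>w. y w \<in> mixed \<and> (\<forall>x\<in>mixed. mexp (shapley_mat G l v w) x (y w) \<le> v$w)"
    by metis
  then have "opt2 G l v (\<chi> w. y w)" unfolding opt2_def by simp
  ultimately have "\<exists>v. (\<forall>w. \<bar>v$w\<bar> \<le> payoff_bound G) \<and> (\<exists>x. opt1 G l v x) \<and> (\<exists>y. opt2 G l v y)"
    using v(1) by blast
  from someI_ex[OF this, folded discounted_value_def]
  show "\<bar>discounted_value G l $ w\<bar> \<le> payoff_bound G" "\<exists>x. opt1 G l (discounted_value G l) x"
    "\<exists>y. opt2 G l (discounted_value G l) y" by auto
qed

text \<open>Both Shapley equations are compared at the pair of x, which guarantees v, and y, which
  caps v'. Used in both directions with l = l' > 0, this shows uniqueness of the discounted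
  value.\<close>

lemma opt_diff_le:
  fixes G :: "('w::finite, 'i::finite, 'j::finite) stochastic_game"
  assumes x: "opt1 G l v x" and y: "opt2 G l' v' y"
    and l: "0 \<le> l" "l \<le> 1" and l': "0 \<le> l'" "l' \<le> 1"
    and vC: "\<And>w. \<bar>v$w\<bar> \<le> C" and v'C: "\<And>w. \<bar>v'$w\<bar> \<le> C" and gC: "payoff_bound G \<le> C"
  shows "l * (v$w - v'$w) \<le> 2 * C * \<bar>l - l'\<bar>" "l' * (v$w - v'$w) \<le> 2 * C * \<bar>l - l'\<bar>"
proof -
  define m where "m = (MAX w\<in>UNIV. (v - v')$w)"
  have m: "(v - v')$w \<le> m" for w unfolding m_def by (intro Max_ge) auto
  have gn: "\<bar>payoff G w i j - nextv G u w i j\<bar> \<le> 2 * C" if "\<And>w. \<bar>u$w\<bar> \<le> C" for u w i j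
    using payoff_le_bound[of G w i j] gC nextv_abs_le[of u C G w i j, OF that] by linarith
  have prod: "(l - l') * (payoff G w i j - nextv G u w i j) \<le> 2 * C * \<bar>l - l'\<bar>" if "\<And>w. \<bar>u$w\<bar> \<le> C" for u w i j
  proof -
    have "(l - l') * (payoff G w i j - nextv G u w i j) \<le> \<bar>l - l'\<bar> * \<bar>payoff G w i j - nextv G u w i j\<bar>"
      by (metis abs_ge_self abs_mult)
    also have "\<dots> \<le> \<bar>l - l'\<bar> * (2 * C)" by (intro mult_left_mono gn that) auto
    finally show ?thesis by (simp add: mult_ac)
  qed
  have step: "(v - v')$w \<le> 2 * C * \<bar>l - l'\<bar> + (1 - l) * m \<and> (v - v')$w \<le> 2 * C * \<bar>l - l'\<bar> + (1 - l') * m" for w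
  proof -
    have xy: "x$w \<in> mixed" "y$w \<in> mixed" using x y unfolding opt1_def opt2_def by auto
    have "(v - v')$w \<le> mexp (shapley_mat G l v w) (x$w) (y$w) - mexp (shapley_mat G l' v' w) (x$w) (y$w)"
      using x y xy unfolding opt1_def opt2_def by (metis diff_mono vector_minus_component)
    also have "\<dots> = mexp (\<lambda>i j. shapley_mat G l v w i j - shapley_mat G l' v' w i j) (x$w) (y$w)"
      by (simp add: mexp_diff)
    finally have le: "(v - v')$w \<le> mexp (\<lambda>i j. shapley_mat G l v w i j - shapley_mat G l' v' w i j) (x$w) (y$w)" .
    have n: "nextv G (v - v') w i j \<le> m" for i j by (rule nextv_le[OF m])
    \<comment> \<open>Two ways to split the same difference, leaving the factor 1 - l or 1 - l' in
      front of the next value of v - v'. At a state where v - v' is maximal they yield the two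
      bounds.\<close>
    have e1: "shapley_mat G l v w i j - shapley_mat G l' v' w i j =
        (l - l') * (payoff G w i j - nextv G v' w i j) + (1 - l) * nextv G (v - v') w i j"
      and e2: "shapley_mat G l v w i j - shapley_mat G l' v' w i j =
        (l - l') * (payoff G w i j - nextv G v w i j) + (1 - l') * nextv G (v - v') w i j" for i j
      by (simp_all add: shapley_mat_def nextv_diff algebra_simps)
    have "shapley_mat G l v w i j - shapley_mat G l' v' w i j \<le> 2 * C * \<bar>l - l'\<bar> + (1 - l) * m" for i j
      unfolding e1 using l n by (intro add_mono prod v'C mult_left_mono) auto
    moreover have "shapley_mat G l v w i j - shapley_mat G l' v' w i j \<le> 2 * C * \<bar>l - l'\<bar> + (1 - l') * m" for i j
      unfolding e2 using l' n by (intro add_mono prod vC mult_left_mono) auto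
    ultimately show ?thesis
      using order_trans[OF le mexp_mono[OF xy]] by (metis (no_types, lifting) mexp_const xy)
  qed
  have "m \<in> range (\<lambda>w. (v - v')$w)" unfolding m_def by (rule Max_in) auto
  then obtain w0 where w0: "m = (v - v')$w0" by auto
  have mm: "l * m \<le> 2 * C * \<bar>l - l'\<bar>" "l' * m \<le> 2 * C * \<bar>l - l'\<bar>"
    using step[of w0] unfolding w0[symmetric] by (simp_all add: left_diff_distrib)
  have C: "0 \<le> C" using payoff_bound_nonneg[of G] gC by simp
  have fin: "k * (v$w - v'$w) \<le> 2 * C * \<bar>l - l'\<bar>" if "k * m \<le> 2 * C * \<bar>l - l'\<bar>" "0 \<le> k" for k
  proof -
    have "k * (v$w - v'$w) \<le> k * m" using m[of w] that by (intro mult_left_mono) auto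
    then show ?thesis using that by simp
  qed
  show "l * (v$w - v'$w) \<le> 2 * C * \<bar>l - l'\<bar>" by (rule fin[OF mm(1) l(1)])
  show "l' * (v$w - v'$w) \<le> 2 * C * \<bar>l - l'\<bar>" by (rule fin[OF mm(2) l'(1)])
qed

text \<open>The Lipschitz constant is of order 1 / l, which gives continuity but bounds the
  variation on [s, a s] only by O(1). The smallness needed for balanced pairs comes from the level
  sets instead.\<close>

lemma discounted_value_diff_le:
  fixes G :: "('w::finite, 'i::finite, 'j::finite) stochastic_game"
  assumes "0 < l" "l \<le> 1" "0 < l'" "l' \<le> 1"
  shows "\<bar>discounted_value G l $ w - discounted_value G l' $ w\<bar> \<le> 2 * payoff_bound G * \<bar>l - l'\<bar> / l"
proof -
  obtain x y x' y' where o: "opt1 G l (discounted_value G l) x" "opt2 G l (discounted_value G l) y"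
    "opt1 G l' (discounted_value G l') x'" "opt2 G l' (discounted_value G l') y'"
    using discounted_value assms by metis
  have "l * (discounted_value G l $ w - discounted_value G l' $ w) \<le> 2 * payoff_bound G * \<bar>l - l'\<bar>"
    by (rule opt_diff_le[OF o(1,4)]) (use assms discounted_value in auto)
  moreover have "l * (discounted_value G l' $ w - discounted_value G l $ w) \<le> 2 * payoff_bound G * \<bar>l' - l\<bar>"
    by (rule opt_diff_le[OF o(3,2)]) (use assms discounted_value in auto)
  ultimately show ?thesis using assms(1) by (simp add: field_simps abs_le_iff abs_minus_commute)
qed

lemma continuous_on_discounted_value: "continuous_on {0<..1} (\<lambda>l. discounted_value G l $ w)"
  unfolding continuous_on_iff
proof (intro ballI allI impI)
  fix l e :: real assume l: "l \<in> {0<..1}" and e: "0 < e"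
  \<comment> \<open>The added 1 keeps the divisor in \<open>e * l / C\<close> positive when all
    payoffs are 0.\<close>
  define C where "C = 2 * payoff_bound G + 1"
  have C: "C > 0" using payoff_bound_nonneg[of G] unfolding C_def by simp
  show "\<exists>d>0. \<forall>l'\<in>{0<..1}. dist l' l < d \<longrightarrow> dist (discounted_value G l' $ w) (discounted_value G l $ w) < e"
  proof (intro exI[of _ "e * l / C"] conjI ballI impI)
    show "0 < e * l / C" using l e C by simp
    fix l' assume l': "l' \<in> {0<..1}" "dist l' l < e * l / C"
    have "dist (discounted_value G l' $ w) (discounted_value G l $ w) \<le> 2 * payoff_bound G * \<bar>l - l'\<bar> / l"
      using discounted_value_diff_le[of l l' G w] l l' by (simp add: dist_real_def abs_minus_commute)
    also have "\<dots> \<le> C * \<bar>l - l'\<bar> / l" using l unfolding C_def by (intro divide_right_mono mult_right_mono) auto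
    also have "\<dots> < e" using l' l C by (simp add: field_simps dist_real_def abs_minus_commute)
    finally show "dist (discounted_value G l' $ w) (discounted_value G l $ w) < e" .
  qed
qed

section \<open>Determinants and extreme solutions\<close>

lemma matrix_vector_mult_minus: "A *v (- u) = - (A *v u)" for A :: "real^'n^'m"
  by (simp add: matrix_vector_mult_def vec_eq_iff sum_negf)

text \<open>Multilinearity in the rows. In the applications \<open>c w a\<close> is the probability
  of action a in state w, and f runs through the pure stationary strategies, weighted by the product
  distribution.\<close>

lemma det_rows_expand:
  fixes r :: "'w::finite \<Rightarrow> 'a::finite \<Rightarrow> real^'w"
  shows "det (\<chi> w. \<Sum>a\<in>UNIV. c w a *s r w a) =
    (\<Sum>f\<in>UNIV. (\<Prod>w\<in>UNIV. c w (f w)) * det (\<chi> w. r w (f w)))"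
proof -
  have "(\<Prod>w\<in>UNIV. \<Sum>a\<in>UNIV. c w a * r w a $ p w) =
      (\<Sum>f\<in>UNIV. (\<Prod>w\<in>UNIV. c w (f w)) * (\<Prod>w\<in>UNIV. r w (f w) $ p w))" for p
    using prod_sum_PiE[of UNIV "\<lambda>_. UNIV" "\<lambda>w a. c w a * r w a $ p w"] by (simp add: prod.distrib)
  then have "det (\<chi> w. \<Sum>a\<in>UNIV. c w a *s r w a) = (\<Sum>p | p permutes UNIV. \<Sum>f\<in>UNIV.
      (\<Prod>w\<in>UNIV. c w (f w)) * (of_int (sign p) * (\<Prod>w\<in>UNIV. r w (f w) $ p w)))"
    by (simp add: det_def sum_distrib_left mult_ac)
  also have "\<dots> = (\<Sum>f\<in>UNIV. (\<Prod>w\<in>UNIV. c w (f w)) * det (\<chi> w. r w (f w)))"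
    by (subst sum.swap) (simp add: det_def sum_distrib_left)
  finally show ?thesis .
qed

lemma sum_prod_mixed:
  fixes c :: "'w::finite \<Rightarrow> 'a::finite \<Rightarrow> real"
  assumes "\<And>w. (\<Sum>a\<in>UNIV. c w a) = 1"
  shows "(\<Sum>f\<in>UNIV. \<Prod>w\<in>UNIV. c w (f w)) = 1"
  using prod_sum_PiE[of UNIV "\<lambda>_. UNIV" c] assms by simp

text \<open>For a stationary profile with transition matrix Q and stage payoff vector g, the
  discounted payoff is the solution \<zeta> of
  \<open>resolvent_mat l Q *v \<zeta> = l g\<close>.\<close>

definition resolvent_mat :: "real \<Rightarrow> ('w::finite \<Rightarrow> 'w \<Rightarrow> real) \<Rightarrow> real^'w^'w" where
  "resolvent_mat l Q = (\<chi> w u. (if w = u then 1 else 0) - (1 - l) * Q w u)"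

lemma resolvent_mat_mult:
  "(resolvent_mat l Q *v z)$w = z$w - (1 - l) * (\<Sum>u\<in>UNIV. Q w u * z$u)"
proof -
  have "(resolvent_mat l Q *v z)$w = (\<Sum>u\<in>UNIV. (if w = u then z$u else 0) - (1 - l) * (Q w u * z$u))"
    unfolding matrix_vector_mult_def resolvent_mat_def by (auto simp: algebra_simps intro!: sum.cong)
  then show ?thesis by (simp add: sum_subtractf sum_distrib_left)
qed

text \<open>At a state where z attains its minimum m, the average under Q is at least m, so
  nonnegativity there leaves 0 \<le> l m.\<close>

lemma resolvent_mat_min_principle:
  assumes l: "0 < l" "l \<le> 1" and Q: "\<And>w u. 0 \<le> Q w u" "\<And>w. (\<Sum>u\<in>UNIV. Q w u) = 1"
    and nn: "\<And>w. 0 \<le> (resolvent_mat l Q *v z)$w"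
  shows "0 \<le> z$w"
proof -
  define m where "m = (MIN w\<in>UNIV. z$w)"
  have m: "m \<le> z$u" for u unfolding m_def by (rule Min_le) auto
  have "m \<in> range (($) z)" unfolding m_def by (rule Min_in) auto
  then obtain w0 where w0: "m = z$w0" by auto
  have "m * (\<Sum>u\<in>UNIV. Q w0 u) \<le> (\<Sum>u\<in>UNIV. Q w0 u * z$u)"
    unfolding sum_distrib_left by (intro sum_mono) (use m Q in \<open>auto simp: mult.commute[of m] intro: mult_left_mono\<close>)
  then have "(1 - l) * m \<le> (1 - l) * (\<Sum>u\<in>UNIV. Q w0 u * z$u)" using l Q(2) by (intro mult_left_mono) auto
  with nn[of w0] have "0 \<le> l * m" unfolding resolvent_mat_mult w0[symmetric] by (simp add: left_diff_distrib)
  then have "0 \<le> m" using l by (simp add: zero_le_mult_iff)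
  then show ?thesis using m[of w] by simp
qed

text \<open>The determinant is 1 at l = 1 and continuous in l. It has no zero on (0, 1], since the
  minimum principle, applied to a kernel vector and to its negative, makes the vector
  vanish.\<close>

lemma det_resolvent_mat_pos:
  assumes l: "0 < l" "l \<le> 1" and Q: "\<And>w u. 0 \<le> Q w u" "\<And>w. (\<Sum>u\<in>UNIV. Q w u) = 1"
  shows "0 < det (resolvent_mat l Q)"
proof (rule ccontr)
  assume neg: "\<not> 0 < det (resolvent_mat l Q)"
  have "det (resolvent_mat l Q) = (\<Sum>p | p permutes UNIV.
      of_int (sign p) * (\<Prod>w\<in>UNIV. (if w = p w then 1 else 0) - (1 - l) * Q w (p w)))" for l
    by (simp add: det_def resolvent_mat_def)
  then have "continuous_on {l..1} (\<lambda>l. det (resolvent_mat l Q))"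
    by (simp only:) (intro continuous_on_sum continuous_on_mult continuous_on_prod continuous_on_diff
      continuous_on_const continuous_on_id)
  moreover have "det (resolvent_mat 1 Q) = 1"
    using det_I[where 'a=real and 'n='a] by (simp add: resolvent_mat_def mat_def)
  ultimately obtain l' where l': "l \<le> l'" "l' \<le> 1" "det (resolvent_mat l' Q) = 0"
    using IVT'[of "\<lambda>l. det (resolvent_mat l Q)" l 0 1] neg l by auto
  have "z = 0" if "resolvent_mat l' Q *v z = 0" for z
  proof -
    have "0 \<le> z$w" "0 \<le> (-z)$w" for w
      by (rule resolvent_mat_min_principle[of l' Q]; use l l' Q that in \<open>simp add: matrix_vector_mult_minus\<close>)+
    then show ?thesis by (auto simp: vec_eq_iff intro: antisym)
  qed
  then have "invertible (resolvent_mat l' Q)"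
    by (simp add: invertible_left_inverse matrix_left_invertible_ker)
  then show False using l' by (simp add: invertible_det_nz)
qed

text \<open>The new column is the image under R of \<zeta> minus z times the k-th unit vector, so
  this is Cramer's rule for that vector.\<close>

lemma det_replace_column:
  fixes R :: "real^'w^'w"
  assumes "R *v \<zeta> = b"
  shows "det (\<chi> w u. if u = k then b$w - z * R$w$k else R$w$u) = (\<zeta>$k - z) * det R"
proof -
  have *: "b$w - z * R$w$k = (R *v (\<zeta> - z *s axis k 1))$w" for w
    using assms by (simp add: matrix_vector_mult_diff_distrib vector_scalar_commute matrix_vector_mult_basis column_def)
  have "(\<zeta> - z *s axis k 1)$k = \<zeta>$k - z" by (simp add: axis_def)
  then show ?thesis unfolding * cramer_lemma by simp
qed

lemma resolvent_mat_solvable: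
  assumes "0 < l" "l \<le> 1" "\<And>w u. 0 \<le> Q w u" "\<And>w. (\<Sum>u\<in>UNIV. Q w u) = 1"
  obtains \<zeta> where "resolvent_mat l Q *v \<zeta> = b"
proof -
  have "invertible (resolvent_mat l Q)"
    using det_resolvent_mat_pos[of l Q, OF assms] by (simp add: invertible_det_nz)
  then obtain A where "resolvent_mat l Q ** A = mat 1" unfolding invertible_def by blast
  then have "resolvent_mat l Q *v (A *v b) = b" by (simp add: matrix_vector_mul_assoc)
  then show ?thesis by (rule that)
qed

text \<open>The determinant is a positive multiple of \<zeta>$k - v$k, where \<zeta> solves the
  equation with right side b. A subsolution v lies below \<zeta> and a supersolution above it, by
  the minimum principle.\<close>

lemma det_replace_column_sign:
  assumes l: "0 < l" "l \<le> 1" and Q: "\<And>w u. 0 \<le> Q w u" "\<And>w. (\<Sum>u\<in>UNIV. Q w u) = 1"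
  shows "(\<And>w. v$w - (1 - l) * (\<Sum>u\<in>UNIV. Q w u * v$u) \<le> b$w) \<Longrightarrow>
      0 \<le> det (\<chi> w u. if u = k then b$w - v$k * resolvent_mat l Q$w$k else resolvent_mat l Q$w$u)"
    and "(\<And>w. b$w \<le> v$w - (1 - l) * (\<Sum>u\<in>UNIV. Q w u * v$u)) \<Longrightarrow>
      det (\<chi> w u. if u = k then b$w - v$k * resolvent_mat l Q$w$k else resolvent_mat l Q$w$u) \<le> 0"
proof -
  obtain \<zeta> where \<zeta>: "resolvent_mat l Q *v \<zeta> = b" by (rule resolvent_mat_solvable[of l Q, OF l Q])
  have pos: "0 < det (resolvent_mat l Q)" by (rule det_resolvent_mat_pos[of l Q, OF l Q])
  show "0 \<le> det (\<chi> w u. if u = k then b$w - v$k * resolvent_mat l Q$w$k else resolvent_mat l Q$w$u)"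
    if "\<And>w. v$w - (1 - l) * (\<Sum>u\<in>UNIV. Q w u * v$u) \<le> b$w"
  proof -
    have "0 \<le> (\<zeta> - v)$k"
      by (rule resolvent_mat_min_principle[OF l, of Q, OF Q])
        (use that in \<open>simp add: matrix_vector_mult_diff_distrib \<zeta> resolvent_mat_mult[of l Q v]\<close>)
    then show ?thesis unfolding det_replace_column[OF \<zeta>] using pos by simp
  qed
  show "det (\<chi> w u. if u = k then b$w - v$k * resolvent_mat l Q$w$k else resolvent_mat l Q$w$u) \<le> 0"
    if "\<And>w. b$w \<le> v$w - (1 - l) * (\<Sum>u\<in>UNIV. Q w u * v$u)"
  proof -
    have "0 \<le> (v - \<zeta>)$k"
      by (rule resolvent_mat_min_principle[OF l, of Q, OF Q])
        (use that in \<open>simp add: matrix_vector_mult_diff_distrib \<zeta> resolvent_mat_mult[of l Q v]\<close>)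
    then show ?thesis unfolding det_replace_column[OF \<zeta>] using pos by (simp add: mult_le_0_iff)
  qed
qed

text \<open>Take a nonzero feasible Y with the fewest nonzero coordinates and slack rows. If some u,
  not proportional to Y, kept all tight constraints tight, moving from Y along u or -u until a
  further constraint becomes tight would give a feasible vector with a smaller count.\<close>

lemma extreme_solution:
  fixes M :: "real^'c^'r"
  assumes "\<And>j. 0 \<le> Z$j" "Z \<noteq> 0" "\<And>i. (M *v Z)$i \<le> 0"
  shows "\<exists>Y. (\<forall>j. 0 \<le> Y$j) \<and> Y \<noteq> 0 \<and> (\<forall>i. (M *v Y)$i \<le> 0) \<and>
    (\<forall>u. (\<forall>j. Y$j = 0 \<longrightarrow> u$j = 0) \<and> (\<forall>i. (M *v Y)$i = 0 \<longrightarrow> (M *v u)$i = 0) \<longrightarrow> (\<exists>\<alpha>. u = \<alpha> *\<^sub>R Y))"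
proof -
  define F where "F y \<longleftrightarrow> (\<forall>j. 0 \<le> y$j) \<and> y \<noteq> 0 \<and> (\<forall>i. (M *v y)$i \<le> 0)" for y :: "real^'c"
  define \<mu> where "\<mu> y = card {j. y$j \<noteq> 0} + card {i. (M *v y)$i \<noteq> 0}" for y :: "real^'c"
  have "F Z" using assms unfolding F_def by simp
  then obtain Y where FY: "F Y" and min: "\<And>y. F y \<Longrightarrow> \<mu> Y \<le> \<mu> y"
    using ex_has_least_nat[of F Z \<mu>] by blast
  have Y: "\<And>j. 0 \<le> Y$j" "Y \<noteq> 0" "\<And>i. (M *v Y)$i \<le> 0" using FY unfolding F_def by auto
  \<comment> \<open>The negative coordinate guarantees that the motion along u is stopped; if u has
    none, \<open>par\<close> passes to -u.\<close>
  have neg: False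
    if u: "\<And>j. Y$j = 0 \<Longrightarrow> u$j = 0" "\<And>i. (M *v Y)$i = 0 \<Longrightarrow> (M *v u)$i = 0"
      and nm: "\<And>\<alpha>. u \<noteq> \<alpha> *\<^sub>R Y" and j0: "u$j0 < 0" for u j0
  proof -
    \<comment> \<open>\<open>T1\<close> holds the step lengths at which a coordinate vanishes,
      \<open>T2\<close> those at which a row becomes tight; the first such event, at s, still leaves
      a feasible point.\<close>
    define T1 where "T1 = (\<lambda>j. Y$j / (- u$j)) ` {j. u$j < 0}"
    define T2 where "T2 = (\<lambda>i. (- (M *v Y)$i) / (M *v u)$i) ` {i. (M *v u)$i > 0}"
    define s where "s = Min (T1 \<union> T2)"
    have fin: "finite (T1 \<union> T2)" "T1 \<union> T2 \<noteq> {}" unfolding T1_def T2_def using j0 by auto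
    have pos: "t > 0" if "t \<in> T1 \<union> T2" for t
      using that
    proof
      assume "t \<in> T1"
      then obtain j where j: "u$j < 0" "t = Y$j / (- u$j)" unfolding T1_def by auto
      then have "Y$j > 0" using u(1)[of j] Y(1)[of j] by force
      then show ?thesis using j by (auto intro: divide_pos_pos simp: divide_pos_neg)
    next
      assume "t \<in> T2"
      then obtain i where i: "(M *v u)$i > 0" "t = (- (M *v Y)$i) / (M *v u)$i" unfolding T2_def by auto
      then have "(M *v Y)$i < 0" using u(2)[of i] Y(3)[of i] by force
      then show ?thesis using i by (auto simp: divide_neg_pos)
    qed
    have sin: "s \<in> T1 \<union> T2" unfolding s_def by (rule Min_in[OF fin])
    have s: "s > 0" by (rule pos[OF sin])
    have sle: "s \<le> t" if "t \<in> T1 \<union> T2" for t unfolding s_def by (rule Min_le[OF fin(1) that])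
    define Y' where "Y' = Y + s *\<^sub>R u"
    have MY': "(M *v Y')$i = (M *v Y)$i + s * (M *v u)$i" for i
      unfolding Y'_def by (simp add: matrix_vector_right_distrib matrix_vector_mult_scaleR)
    have "0 \<le> Y'$j" for j
    proof (cases "u$j < 0")
      case True
      then have "s \<le> Y$j / (- u$j)" by (intro sle) (auto simp: T1_def)
      then show ?thesis using True unfolding Y'_def by (simp add: field_simps)
    next
      case False
      then show ?thesis using s Y(1)[of j] unfolding Y'_def by simp
    qed
    moreover have "(M *v Y')$i \<le> 0" for i
    proof (cases "(M *v u)$i > 0")
      case True
      then have "s \<le> (- (M *v Y)$i) / (M *v u)$i" by (intro sle) (auto simp: T2_def)
      then show ?thesis using True unfolding MY' by (simp add: field_simps)
    next
      case False
      then have "s * (M *v u)$i \<le> 0" using s by (simp add: mult_le_0_iff)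
      then show ?thesis using Y(3)[of i] unfolding MY' by simp
    qed
    moreover have "Y' \<noteq> 0"
    proof
      assume "Y' = 0"
      then have "u = (- 1 / s) *\<^sub>R Y" using s unfolding Y'_def
        by (simp add: vec_eq_iff field_simps add_eq_0_iff)
      then show False using nm by blast
    qed
    ultimately have "F Y'" unfolding F_def by simp
    have sub1: "{j. Y'$j \<noteq> 0} \<subseteq> {j. Y$j \<noteq> 0}" using u(1) unfolding Y'_def by auto
    have sub2: "{i. (M *v Y')$i \<noteq> 0} \<subseteq> {i. (M *v Y)$i \<noteq> 0}" using u(2) unfolding MY' by auto
    have "\<mu> Y' < \<mu> Y"
      using sin
    proof
      assume "s \<in> T1"
      then obtain j where j: "u$j < 0" "s = Y$j / (- u$j)" unfolding T1_def by auto
      then have "Y'$j = 0" "Y$j \<noteq> 0" using s unfolding Y'_def by (auto simp: field_simps)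
      then have "{j. Y'$j \<noteq> 0} \<subset> {j. Y$j \<noteq> 0}" using sub1 by blast
      then have "card {j. Y'$j \<noteq> 0} < card {j. Y$j \<noteq> 0}" by (intro psubset_card_mono) auto
      moreover have "card {i. (M *v Y')$i \<noteq> 0} \<le> card {i. (M *v Y)$i \<noteq> 0}" by (intro card_mono sub2) auto
      ultimately show ?thesis unfolding \<mu>_def by simp
    next
      assume "s \<in> T2"
      then obtain i where i: "(M *v u)$i > 0" "s = (- (M *v Y)$i) / (M *v u)$i" unfolding T2_def by auto
      then have "(M *v Y')$i = 0" "(M *v Y)$i \<noteq> 0" using s unfolding MY' by (auto simp: field_simps)
      then have "{i. (M *v Y')$i \<noteq> 0} \<subset> {i. (M *v Y)$i \<noteq> 0}" using sub2 by blast
      then have "card {i. (M *v Y')$i \<noteq> 0} < card {i. (M *v Y)$i \<noteq> 0}" by (intro psubset_card_mono) auto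
      moreover have "card {j. Y'$j \<noteq> 0} \<le> card {j. Y$j \<noteq> 0}" by (intro card_mono sub1) auto
      ultimately show ?thesis unfolding \<mu>_def by simp
    qed
    then show False using min[OF \<open>F Y'\<close>] by simp
  qed
  have par: "\<exists>\<alpha>. u = \<alpha> *\<^sub>R Y"
    if u: "\<And>j. Y$j = 0 \<Longrightarrow> u$j = 0" "\<And>i. (M *v Y)$i = 0 \<Longrightarrow> (M *v u)$i = 0" for u
  proof (rule ccontr)
    assume nm: "\<nexists>\<alpha>. u = \<alpha> *\<^sub>R Y"
    then have "u \<noteq> 0" by (metis scaleR_zero_left)
    then obtain j where j: "u$j \<noteq> 0" by (auto simp: vec_eq_iff)
    show False
    proof (cases "u$j < 0")
      case True
      then show False using neg[of u j] u nm by blast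
    next
      case False
      show False
      proof (rule neg[of "- u" j])
        show "- u \<noteq> \<alpha> *\<^sub>R Y" for \<alpha> using nm by (metis minus_minus scaleR_minus_left)
      qed (use u j False in \<open>auto simp: matrix_vector_mult_minus\<close>)
    qed
  qed
  show ?thesis by (rule exI[of _ Y], intro conjI allI impI) (use Y in simp_all, rule par, auto)
qed

text \<open>Substitute for the Shapley--Snow theorem.  On the support of an extreme \<open>Y\<close> the kernel of the
  tight rows of \<open>M\<close> is spanned by \<open>Y\<close>; multiplying by \<open>X\<close> from the left shows that a kernel vector \<open>u\<close>
  of \<open>M - t B\<close> satisfies \<open>X B u = 0\<close>, while \<open>X B Y > 0\<close>.\<close>

lemma shapley_snow_kernel:
  fixes M B :: "real^'c^'r"
  assumes X: "\<And>i. 0 \<le> X$i" "(\<Sum>i\<in>UNIV. X$i) = 1" "\<And>j. 0 \<le> (\<Sum>i\<in>UNIV. X$i * M$i$j)"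
    and Z: "\<And>j. 0 \<le> Z$j" "(\<Sum>j\<in>UNIV. Z$j) = 1" "\<And>i. (\<Sum>j\<in>UNIV. M$i$j * Z$j) \<le> 0"
    and B: "\<And>i j. 0 < B$i$j"
  shows "\<exists>R C. (\<exists>u. u \<noteq> 0 \<and> (\<forall>j. j \<notin> C \<longrightarrow> u$j = 0) \<and> (\<forall>i\<in>R. (\<Sum>j\<in>UNIV. M$i$j * u$j) = 0)) \<and>
    (\<exists>t. \<forall>u. (\<forall>j. j \<notin> C \<longrightarrow> u$j = 0) \<and> (\<forall>i\<in>R. (\<Sum>j\<in>UNIV. (M$i$j - t * B$i$j) * u$j) = 0) \<longrightarrow> u = 0)"
proof -
  have mv: "(A *v u)$i = (\<Sum>j\<in>UNIV. A$i$j * u$j)" for A :: "real^'c^'r" and u i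
    by (simp add: matrix_vector_mult_def)
  have Z': "Z \<noteq> 0" "\<And>i. (M *v Z)$i \<le> 0" using Z(2,3) by (auto simp: mv)
  obtain Y where Y': "(\<forall>j. 0 \<le> Y$j) \<and> Y \<noteq> 0 \<and> (\<forall>i. (M *v Y)$i \<le> 0)"
    and ker: "\<forall>u. (\<forall>j. Y$j = 0 \<longrightarrow> u$j = 0) \<and> (\<forall>i. (M *v Y)$i = 0 \<longrightarrow> (M *v u)$i = 0) \<longrightarrow> (\<exists>\<alpha>. u = \<alpha> *\<^sub>R Y)"
    using extreme_solution[OF Z(1) Z'] by blast
  then have Y: "\<And>j. 0 \<le> Y$j" "Y \<noteq> 0" "\<And>i. (M *v Y)$i \<le> 0" by auto
  define R where "R = {i. (M *v Y)$i = 0}"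
  define C where "C = {j. Y$j \<noteq> 0}"
  define XM where "XM j = (\<Sum>i\<in>UNIV. X$i * M$i$j)" for j
  have swap: "(\<Sum>i\<in>UNIV. X$i * (\<Sum>j\<in>UNIV. A$i$j * u$j)) = (\<Sum>j\<in>UNIV. (\<Sum>i\<in>UNIV. X$i * A$i$j) * u$j)"
    for A :: "real^'c^'r" and u
    by (simp add: sum_distrib_left sum_distrib_right mult.assoc) (rule sum.swap)
  \<comment> \<open>Complementary slackness: X M Y is nonnegative by the column inequalities and
    nonpositive by the row inequalities, hence 0. So X vanishes off the tight rows \<open>R\<close>,
    and X M vanishes on the support \<open>C\<close> of Y.\<close>
  have a1: "(\<Sum>j\<in>UNIV. XM j * Y$j) = (\<Sum>i\<in>UNIV. X$i * (M *v Y)$i)"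
    unfolding mv swap XM_def ..
  have "(\<Sum>i\<in>UNIV. X$i * (M *v Y)$i) \<le> 0" using X(1) Y(3) by (intro sum_nonpos mult_nonneg_nonpos) auto
  moreover have XM: "0 \<le> XM j" for j using X(3) unfolding XM_def .
  then have "0 \<le> (\<Sum>j\<in>UNIV. XM j * Y$j)" using Y(1) by (intro sum_nonneg mult_nonneg_nonneg) auto
  ultimately have z: "(\<Sum>j\<in>UNIV. XM j * Y$j) = 0" "(\<Sum>i\<in>UNIV. - (X$i * (M *v Y)$i)) = 0" using a1 by (auto simp: sum_negf)
  have XMC: "XM j = 0" if "j \<in> C" for j
  proof -
    have "XM j * Y$j = 0"
      using z(1) XM Y(1) by (subst (asm) sum_nonneg_eq_0_iff) auto
    then show ?thesis using that unfolding C_def by simp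
  qed
  have XR: "X$i = 0" if "i \<notin> R" for i
  proof -
    have "- (X$i * (M *v Y)$i) = 0"
      using z(2) X(1) Y(3) by (subst (asm) sum_nonneg_eq_0_iff) (auto simp: mult_nonneg_nonpos)
    then show ?thesis using that unfolding R_def by simp
  qed
  have XBY: "0 < (\<Sum>i\<in>UNIV. X$i * (\<Sum>j\<in>UNIV. B$i$j * Y$j))"
  proof -
    obtain j0 where j0: "Y$j0 \<noteq> 0" using Y(2) by (auto simp: vec_eq_iff)
    then have Yj0: "0 < Y$j0" using Y(1)[of j0] by (simp add: less_le)
    have BY: "0 < (\<Sum>j\<in>UNIV. B$i$j * Y$j)" for i
      using Yj0 by (intro sum_pos2[of UNIV j0] mult_pos_pos mult_nonneg_nonneg less_imp_le[OF B] B Y(1)) auto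
    obtain i0 where "X$i0 \<noteq> 0" using X(2) by (metis (mono_tags) sum.neutral zero_neq_one)
    then have "0 < X$i0" using X(1)[of i0] by (simp add: less_le)
    then show ?thesis
      by (intro sum_pos2[of UNIV i0] mult_pos_pos mult_nonneg_nonneg less_imp_le[OF BY] BY X(1)) auto
  qed
  define XB where "XB u = (\<Sum>i\<in>UNIV. X$i * (\<Sum>j\<in>UNIV. B$i$j * u$j))" for u :: "real^'c"
  \<comment> \<open>On vectors supported in \<open>C\<close>, the tight rows have only multiples of
    Y in their kernel. As \<open>XB Y\<close> is positive, Y is not in \<open>H\<close>, so the
    tight rows are injective on \<open>H\<close>.\<close>
  define H where "H = {u. (\<forall>j. j \<notin> C \<longrightarrow> u$j = 0) \<and> XB u = 0}"
  have subH: "subspace H"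
    unfolding H_def XB_def by (rule subspaceI) (auto simp: algebra_simps sum.distrib sum_distrib_left[symmetric])
  define f where "f u = (\<chi> i. if i \<in> R then (M *v u)$i else 0)" for u
  have blf: "bounded_linear f"
    unfolding f_def by (intro linear_conv_bounded_linear[THEN iffD1] linearI)
      (auto simp: vec_eq_iff matrix_vector_right_distrib matrix_vector_mult_scaleR)
  have inj: "u = 0" if u: "u \<in> H" "f u = 0" for u
  proof -
    have "(M *v u)$i = 0" if "(M *v Y)$i = 0" for i
      using u(2) that unfolding f_def R_def by (auto simp: vec_eq_iff split: if_splits dest: spec[of _ i])
    moreover have "u$j = 0" if "Y$j = 0" for j using u(1) that unfolding H_def C_def by auto
    ultimately obtain \<alpha> where \<alpha>: "u = \<alpha> *\<^sub>R Y" using ker[THEN spec, of u] by blast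
    have "XB u = \<alpha> * XB Y" unfolding XB_def \<alpha> by (simp add: sum_distrib_left mult_ac)
    then show ?thesis using u(1) XBY \<alpha> unfolding H_def XB_def by auto
  qed
  obtain e where e: "e > 0" "\<And>u. u \<in> H \<Longrightarrow> norm (f u) \<ge> e * norm u"
    using injective_imp_isometric[OF closed_subspace[OF subH] subH blf] inj by blast
  define g where "g u = (\<chi> i. if i \<in> R then (B *v u)$i else 0)" for u
  have blg: "bounded_linear g"
    unfolding g_def by (intro linear_conv_bounded_linear[THEN iffD1] linearI)
      (auto simp: vec_eq_iff matrix_vector_right_distrib matrix_vector_mult_scaleR)
  obtain K where K: "K > 0" "\<And>u. norm (g u) \<le> norm u * K" using bounded_linear.pos_bounded[OF blg] by blast
  \<comment> \<open>On \<open>H\<close> the map f expands by at least e, while g expands by at most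
    K; half of the ratio keeps f - t g injective there.\<close>
  define t where "t = e / (2 * K)"
  have t: "t > 0" unfolding t_def using e K by simp
  have "u = 0" if u: "\<And>j. j \<notin> C \<Longrightarrow> u$j = 0" "\<And>i. i \<in> R \<Longrightarrow> (\<Sum>j\<in>UNIV. (M$i$j - t * B$i$j) * u$j) = 0" for u
  proof -
    have eq: "(M *v u)$i = t * (B *v u)$i" if "i \<in> R" for i
      using u(2)[OF that] unfolding mv by (simp add: algebra_simps sum_subtractf sum_distrib_left)
    have "(\<Sum>i\<in>UNIV. X$i * (M *v u)$i) = (\<Sum>i\<in>UNIV. X$i * (t * (B *v u)$i))"
      using eq XR by (intro sum.cong) auto
    moreover have "(\<Sum>i\<in>UNIV. X$i * (M *v u)$i) = (\<Sum>j\<in>UNIV. XM j * u$j)" unfolding mv swap XM_def ..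
    moreover have "\<dots> = 0" using u(1) XMC by (intro sum.neutral) auto
    moreover have "(\<Sum>i\<in>UNIV. X$i * (t * (B *v u)$i)) = t * XB u" unfolding XB_def mv by (simp add: sum_distrib_left mult_ac)
    ultimately have "XB u = 0" using t by simp
    then have "u \<in> H" using u(1) unfolding H_def by simp
    moreover have "f u = t *\<^sub>R g u" using eq by (auto simp: vec_eq_iff f_def g_def)
    ultimately have "e * norm u \<le> t * norm (g u)" using e(2)[of u] t by simp
    also have "\<dots> \<le> t * (norm u * K)" using t by (intro mult_left_mono K(2)) auto
    also have "\<dots> = e / 2 * norm u" unfolding t_def using K(1) by simp
    finally have "norm u \<le> 0" using e(1) by (simp add: mult_le_0_iff)
    then show ?thesis by simp
  qed
  then have "\<exists>t. \<forall>u. (\<forall>j. j \<notin> C \<longrightarrow> u$j = 0) \<and> (\<forall>i\<in>R. (\<Sum>j\<in>UNIV. (M$i$j - t * B$i$j) * u$j) = 0) \<longrightarrow> u = 0"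
    by blast
  moreover have "\<exists>u. u \<noteq> 0 \<and> (\<forall>j. j \<notin> C \<longrightarrow> u$j = 0) \<and> (\<forall>i\<in>R. (\<Sum>j\<in>UNIV. M$i$j * u$j) = 0)"
    using Y(2) unfolding R_def C_def mv by (intro exI[of _ Y]) auto
  ultimately show ?thesis by blast
qed

text \<open>The identity block outside \<open>C\<close> makes this matrix singular iff the \<open>R \<times> C\<close> submatrix of \<open>E\<close>
  has a nontrivial kernel.\<close>

definition gram :: "'r::finite set \<Rightarrow> 'c::finite set \<Rightarrow> ('r \<Rightarrow> 'c \<Rightarrow> real) \<Rightarrow> real^'c^'c" where
  "gram R C E = (\<chi> j l. if j \<in> C \<and> l \<in> C then \<Sum>i\<in>R. E i j * E i l else if j = l then 1 else 0)"

text \<open>Pairing the kernel equations with u itself turns them into a vanishing sum of squares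
  over R. The sets R and C may differ in size, so a Gram determinant takes the place of a minor; it
  is still polynomial in the entries.\<close>

lemma det_gram_eq_0_iff:
  "det (gram R C E) = 0 \<longleftrightarrow>
    (\<exists>u::real^'c. u \<noteq> 0 \<and> (\<forall>j. j \<notin> C \<longrightarrow> u$j = 0) \<and> (\<forall>i\<in>R. (\<Sum>j\<in>UNIV. E i j * u$j) = 0))"
  (is "?L \<longleftrightarrow> ?R")
proof -
  have GC: "(gram R C E *v u)$j = (if j \<in> C then \<Sum>i\<in>R. E i j * (\<Sum>l\<in>C. E i l * u$l) else u$j)" for u j
  proof (cases "j \<in> C")
    case True
    have "(gram R C E *v u)$j = (\<Sum>l\<in>UNIV. if l \<in> C then (\<Sum>i\<in>R. E i j * E i l) * u$l else 0)"
      unfolding matrix_vector_mult_def gram_def using True by (auto intro!: sum.cong)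
    also have "\<dots> = (\<Sum>l\<in>C. (\<Sum>i\<in>R. E i j * E i l) * u$l)" by (simp add: sum.If_cases)
    also have "\<dots> = (\<Sum>i\<in>R. E i j * (\<Sum>l\<in>C. E i l * u$l))"
      by (simp add: sum_distrib_left sum_distrib_right mult.assoc) (rule sum.swap)
    finally show ?thesis using True by simp
  next
    case False
    have "(if j = l then 1 else 0) * u$l = (if j = l then u$l else 0)" for l by simp
    then have "(gram R C E *v u)$j = (\<Sum>l\<in>UNIV. if j = l then u$l else 0)"
      unfolding matrix_vector_mult_def gram_def using False by simp
    then show ?thesis using False by simp
  qed
  have supp: "(\<Sum>j\<in>UNIV. E i j * u$j) = (\<Sum>j\<in>C. E i j * u$j)" if "\<forall>j. j \<notin> C \<longrightarrow> u$j = 0" for u :: "real^'c" and i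
    using that by (intro sum.mono_neutral_right) auto
  have "?L \<longleftrightarrow> \<not> invertible (gram R C E)" by (simp add: invertible_det_nz)
  also have "\<dots> \<longleftrightarrow> (\<exists>u. u \<noteq> 0 \<and> gram R C E *v u = 0)"
    by (auto simp: invertible_left_inverse matrix_left_invertible_ker)
  also have "\<dots> \<longleftrightarrow> ?R"
  proof (intro ex_cong1 conj_cong refl)
    fix u :: "real^'c"
    show "gram R C E *v u = 0 \<longleftrightarrow> (\<forall>j. j \<notin> C \<longrightarrow> u$j = 0) \<and> (\<forall>i\<in>R. (\<Sum>j\<in>UNIV. E i j * u$j) = 0)"
    proof (intro iffI conjI)
      assume "gram R C E *v u = 0"
      then have **: "(if j \<in> C then \<Sum>i\<in>R. E i j * (\<Sum>l\<in>C. E i l * u$l) else u$j) = 0" for j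
        unfolding GC[symmetric] by simp
      then have *: "j \<in> C \<Longrightarrow> (\<Sum>i\<in>R. E i j * (\<Sum>l\<in>C. E i l * u$l)) = 0" "j \<notin> C \<Longrightarrow> u$j = 0" for j
        using **[of j] by simp_all
      show s: "\<forall>j. j \<notin> C \<longrightarrow> u$j = 0" using *(2) by blast
      have "0 = (\<Sum>j\<in>C. u$j * (\<Sum>i\<in>R. E i j * (\<Sum>l\<in>C. E i l * u$l)))"
        using *(1) by (intro sum.neutral[symmetric]) auto
      also have "\<dots> = (\<Sum>i\<in>R. \<Sum>j\<in>C. u$j * (E i j * (\<Sum>l\<in>C. E i l * u$l)))"
        unfolding sum_distrib_left[of "u $ _"] by (rule sum.swap)
      also have "\<dots> = (\<Sum>i\<in>R. (\<Sum>l\<in>C. E i l * u$l)\<^sup>2)"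
        by (simp add: power2_eq_square sum_distrib_right mult_ac)
      finally have "\<forall>i\<in>R. (\<Sum>l\<in>C. E i l * u$l)\<^sup>2 = 0"
        by (metis (mono_tags, lifting) sum_nonneg_eq_0_iff finite zero_le_power2)
      then show "\<forall>i\<in>R. (\<Sum>j\<in>UNIV. E i j * u$j) = 0" by (simp add: supp[OF s])
    next
      assume "(\<forall>j. j \<notin> C \<longrightarrow> u$j = 0) \<and> (\<forall>i\<in>R. (\<Sum>j\<in>UNIV. E i j * u$j) = 0)"
      then show "gram R C E *v u = 0" using supp[of u] by (auto simp: vec_eq_iff GC)
    qed
  qed
  finally show ?thesis .
qed

section \<open>Polynomials in two variables\<close>

text \<open>The outer variable is z, inserted as a constant polynomial, and the coefficients are
  polynomials in l. Fixing z thus leaves a polynomial in l, whose roots can be counted level by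
  level.\<close>

definition bipoly :: "(real \<Rightarrow> real \<Rightarrow> real) \<Rightarrow> bool" where
  "bipoly f \<longleftrightarrow> (\<exists>P :: real poly poly. \<forall>l z. f l z = poly (poly P [:z:]) l)"

lemma bipoly_const: "bipoly (\<lambda>l z. c)"
  unfolding bipoly_def by (rule exI[of _ "[:[:c:]:]"]) simp

lemma bipoly_fst: "bipoly (\<lambda>l z. l)"
  unfolding bipoly_def by (rule exI[of _ "[:[:0, 1:]:]"]) simp

lemma bipoly_snd: "bipoly (\<lambda>l z. z)"
  unfolding bipoly_def by (rule exI[of _ "[:0, 1:]"]) simp

lemma bipoly_add: "bipoly f \<Longrightarrow> bipoly g \<Longrightarrow> bipoly (\<lambda>l z. f l z + g l z)"
  unfolding bipoly_def by (metis poly_add)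

lemma bipoly_diff: "bipoly f \<Longrightarrow> bipoly g \<Longrightarrow> bipoly (\<lambda>l z. f l z - g l z)"
  unfolding bipoly_def by (metis poly_diff)

lemma bipoly_mult: "bipoly f \<Longrightarrow> bipoly g \<Longrightarrow> bipoly (\<lambda>l z. f l z * g l z)"
  unfolding bipoly_def by (metis poly_mult)

lemma bipoly_sum: "(\<And>i. i \<in> I \<Longrightarrow> bipoly (f i)) \<Longrightarrow> bipoly (\<lambda>l z. \<Sum>i\<in>I. f i l z)"
  by (induction I rule: infinite_finite_induct) (auto intro: bipoly_add bipoly_const)

lemma bipoly_prod: "(\<And>i. i \<in> I \<Longrightarrow> bipoly (f i)) \<Longrightarrow> bipoly (\<lambda>l z. \<Prod>i\<in>I. f i l z)"
  by (induction I rule: infinite_finite_induct) (auto intro: bipoly_mult bipoly_const)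

lemma bipoly_det:
  assumes "\<And>i j. bipoly (\<lambda>l z. A l z $ i $ j)"
  shows "bipoly (\<lambda>l z. det (A l z))"
  unfolding det_def by (intro bipoly_sum bipoly_mult bipoly_prod bipoly_const assms)

lemmas bipoly_intros = bipoly_const bipoly_fst bipoly_snd bipoly_add bipoly_diff bipoly_mult bipoly_sum bipoly_prod

text \<open>Powers of a constant polynomial have degree 0, so the degrees of the coefficients bound
  the degree uniformly in c. This makes the number of preimages bounded uniformly over the
  levels.\<close>

lemma degree_poly_const_le:
  fixes P :: "real poly poly"
  shows "\<exists>d. \<forall>c. degree (poly P [:c:]) \<le> d"
proof (intro exI allI)
  fix c
  have "degree (coeff P i * [:c:] ^ i) \<le> (\<Sum>i\<le>degree P. degree (coeff P i))" if "i \<le> degree P" for i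
  proof -
    have "degree (coeff P i * [:c:] ^ i) \<le> degree (coeff P i) + degree ([:c:] ^ i)"
      by (rule degree_mult_le)
    also have "degree ([:c:] ^ i) = 0" using degree_power_le[of "[:c:]" i] by simp
    also have "degree (coeff P i) + 0 \<le> (\<Sum>i\<le>degree P. degree (coeff P i))"
      using member_le_sum[of i "{..degree P}" "\<lambda>i. degree (coeff P i)"] that by simp
    finally show ?thesis .
  qed
  then show "degree (poly P [:c:]) \<le> (\<Sum>i\<le>degree P. degree (coeff P i))"
    unfolding poly_altdef[of P] by (intro degree_sum_le) auto
qed

text \<open>The product Q of all nonzero members of the family vanishes at every (l, v l): the value
  z with \<open>F \<alpha> l z \<noteq> 0\<close> certifies that the member vanishing there is a
  nonzero polynomial.\<close>

lemma finite_level_sets: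
  fixes F :: "'a \<Rightarrow> real \<Rightarrow> real \<Rightarrow> real" and v :: "real \<Rightarrow> real"
  assumes I: "finite I" and F: "\<And>\<alpha>. \<alpha> \<in> I \<Longrightarrow> bipoly (F \<alpha>)"
    and root: "\<And>l. l \<in> S \<Longrightarrow> \<exists>\<alpha>\<in>I. F \<alpha> l (v l) = 0 \<and> (\<exists>z. F \<alpha> l z \<noteq> 0)"
  shows "\<exists>d E. finite E \<and> (\<forall>c. c \<notin> E \<longrightarrow> finite {l \<in> S. v l = c} \<and> card {l \<in> S. v l = c} \<le> d)"
proof -
  obtain P where P: "\<And>\<alpha> l z. \<alpha> \<in> I \<Longrightarrow> F \<alpha> l z = poly (poly (P \<alpha>) [:z:]) l"
    using F unfolding bipoly_def by metis
  define J where "J = {\<alpha> \<in> I. P \<alpha> \<noteq> 0}"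
  define Q where "Q = (\<Prod>\<alpha>\<in>J. P \<alpha>)"
  have fJ: "finite J" unfolding J_def using I by simp
  have Q: "Q \<noteq> 0" unfolding Q_def using fJ by (auto simp: J_def)
  obtain d where d: "\<And>c. degree (poly Q [:c:]) \<le> d" using degree_poly_const_le by blast
  \<comment> \<open>The levels at which Q vanishes identically in l. They are roots of the nonzero
    polynomial Q over the ring of polynomials in l, hence finite in number.\<close>
  define E where "E = {c. poly Q [:c:] = 0}"
  have "finite ((\<lambda>c. [:c:]) ` E)"
    by (rule finite_subset[OF _ poly_roots_finite[OF Q]]) (auto simp: E_def)
  then have "finite E" by (rule finite_imageD) (auto simp: inj_on_def)
  moreover have "finite {l \<in> S. v l = c} \<and> card {l \<in> S. v l = c} \<le> d" if "c \<notin> E" for c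
  proof -
    have nz: "poly Q [:c:] \<noteq> 0" using that unfolding E_def by simp
    have sub: "{l \<in> S. v l = c} \<subseteq> {l. poly (poly Q [:c:]) l = 0}"
    proof safe
      fix l assume l: "l \<in> S" "c = v l"
      obtain \<alpha> z where \<alpha>: "\<alpha> \<in> I" "F \<alpha> l (v l) = 0" "F \<alpha> l z \<noteq> 0" using root[OF l(1)] by blast
      then have "\<alpha> \<in> J" unfolding J_def using P[of \<alpha> l z] by auto
      moreover have "poly (poly (P \<alpha>) [:v l:]) l = 0" using \<alpha> P by simp
      ultimately show "poly (poly Q [:v l:]) l = 0"
        unfolding Q_def poly_prod using fJ by auto
    qed
    have "finite {l. poly (poly Q [:c:]) l = 0}" by (rule poly_roots_finite[OF nz])
    moreover have "card {l. poly (poly Q [:c:]) l = 0} \<le> d"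
      using card_poly_roots_bound[OF nz] d[of c] by linarith
    ultimately show ?thesis using sub by (meson card_mono finite_subset le_trans)
  qed
  ultimately show ?thesis by blast
qed

section \<open>Level sets of the discounted value\<close>

text \<open>Column \<open>k\<close> of \<open>I - (1 - l) Q\<close> is replaced by \<open>l g - z (I - (1 - l) Q)\<^sub>k\<close>, so that by Cramer's rule the
  determinant is \<open>(\<gamma>\<^sub>k - z) det (I - (1 - l) Q)\<close>, where \<open>\<gamma>\<close> is the discounted payoff of the profile.\<close>

definition profile_mat ::
  "('w::finite, 'i, 'j) stochastic_game \<Rightarrow> 'w \<Rightarrow> real \<Rightarrow> real \<Rightarrow> ('w \<Rightarrow> 'i) \<Rightarrow> ('w \<Rightarrow> 'j) \<Rightarrow> real^'w^'w" where
  "profile_mat G k l z i j = (\<chi> w u.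
     if u = k then l * payoff G w (i w) (j w) - z * ((if w = u then 1 else 0) - (1 - l) * pmf (transition G w (i w) (j w)) u)
     else (if w = u then 1 else 0) - (1 - l) * pmf (transition G w (i w) (j w)) u)"

definition profile_res ::
  "('w::finite, 'i, 'j) stochastic_game \<Rightarrow> real \<Rightarrow> ('w \<Rightarrow> 'i) \<Rightarrow> ('w \<Rightarrow> 'j) \<Rightarrow> real^'w^'w" where
  "profile_res G l i j = resolvent_mat l (\<lambda>w u. pmf (transition G w (i w) (j w)) u)"

text \<open>By Cramer's rule the determinant is affine in z, with slope minus
  \<open>det (profile_res G l i j)\<close>. Hence the perturbed matrix M - t B of the kernel lemma
  is the same matrix of profile determinants, taken at the level z + t.\<close>

lemma profile_mat_shift:
  assumes "0 < l" "l \<le> 1"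
  shows "det (profile_mat G k l z i j) - t * det (profile_res G l i j) = det (profile_mat G k l (z + t) i j)"
proof -
  define Q where "Q = (\<lambda>w u. pmf (transition G w (i w) (j w)) u)"
  define R where "R = resolvent_mat l Q"
  obtain \<zeta> where \<zeta>: "R *v \<zeta> = (\<chi> w. l * payoff G w (i w) (j w))"
    unfolding R_def by (rule resolvent_mat_solvable[of l Q]) (use assms in \<open>auto simp: Q_def sum_pmf_UNIV\<close>)
  have "profile_mat G k l z i j = (\<chi> w u. if u = k then (\<chi> w. l * payoff G w (i w) (j w))$w - z * R$w$k else R$w$u)" for z
    by (simp add: profile_mat_def R_def Q_def resolvent_mat_def vec_eq_iff)
  then have eq: "det (profile_mat G k l z i j) = (\<zeta>$k - z) * det R" for z
    using det_replace_column[OF \<zeta>] by simp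
  show ?thesis unfolding eq by (simp add: profile_res_def R_def Q_def algebra_simps)
qed

lemma profile_res_pos: "0 < l \<Longrightarrow> l \<le> 1 \<Longrightarrow> 0 < det (profile_res G l i j)"
  unfolding profile_res_def by (rule det_resolvent_mat_pos) (auto simp: sum_pmf_UNIV)

lemma bipoly_det_profile_mat: "bipoly (\<lambda>l z. det (profile_mat G k l z i j))"
proof (rule bipoly_det)
  fix w u
  show "bipoly (\<lambda>l z. profile_mat G k l z i j $ w $ u)"
  proof (cases "u = k")
    case True
    show ?thesis unfolding profile_mat_def vec_lambda_beta if_P[OF True] by (intro bipoly_intros)
  next
    case False
    show ?thesis unfolding profile_mat_def vec_lambda_beta if_not_P[OF False] by (intro bipoly_intros)
  qed
qed

text \<open>By multilinearity the average over player 1's pure stationary strategies is a single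
  determinant, built from the transitions Q and payoffs b that x induces against the pure stationary
  j. Optimality of x makes v a subsolution for these data, which fixes the sign.\<close>

lemma sum_profile1:
  fixes G :: "('w::finite, 'i::finite, 'j::finite) stochastic_game"
  assumes l: "0 < l" "l \<le> 1" and x: "opt1 G l v x"
  shows "0 \<le> (\<Sum>i\<in>UNIV. (\<Prod>w\<in>UNIV. x$w$(i w)) * det (profile_mat G k l (v$k) i j))"
proof -
  define Q where "Q w u = (\<Sum>a\<in>UNIV. x$w$a * pmf (transition G w a (j w)) u)" for w u
  define b where "b = (\<chi> w. l * (\<Sum>a\<in>UNIV. x$w$a * payoff G w a (j w)))"
  have xm: "x$w \<in> mixed" for w using x unfolding opt1_def by simp
  define r where "r w a = (\<chi> u.
     if u = k then l * payoff G w a (j w) - v$k * ((if w = u then 1 else 0) - (1 - l) * pmf (transition G w a (j w)) u)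
     else (if w = u then 1 else 0) - (1 - l) * pmf (transition G w a (j w)) u)" for w a
  have "(\<Sum>a\<in>UNIV. x$w$a *s r w a)$u = (if u = k then b$w - v$k * resolvent_mat l Q$w$k else resolvent_mat l Q$w$u)" for w u
  proof -
    have R: "resolvent_mat l Q $ w $ u = (\<Sum>a\<in>UNIV. x$w$a * ((if w = u then 1 else 0) - (1 - l) * pmf (transition G w a (j w)) u))"
      by (simp add: resolvent_mat_def Q_def right_diff_distrib sum_subtractf sum_distrib_left sum_distrib_right[symmetric] mixed_sum[OF xm] mult_ac)
    show ?thesis
    proof (cases "u = k")
      case True
      then show ?thesis using R
        by (simp add: r_def b_def sum_distrib_left right_diff_distrib[of "x$_$_" "_ * _" "v$k * _"] sum_subtractf mult_ac)
    next
      case False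
      then show ?thesis using R by (simp add: r_def)
    qed
  qed
  then have "(\<chi> w. \<Sum>a\<in>UNIV. x$w$a *s r w a) = (\<chi> w u. if u = k then b$w - v$k * resolvent_mat l Q$w$k else resolvent_mat l Q$w$u)"
    by (simp only: vec_eq_iff vec_lambda_beta simp_thms)
  moreover have "(\<Sum>i\<in>UNIV. (\<Prod>w\<in>UNIV. x$w$(i w)) * det (profile_mat G k l (v$k) i j)) = det (\<chi> w. \<Sum>a\<in>UNIV. x$w$a *s r w a)"
    unfolding det_rows_expand by (simp add: profile_mat_def r_def)
  moreover have "0 \<le> det (\<chi> w u. if u = k then b$w - v$k * resolvent_mat l Q$w$k else resolvent_mat l Q$w$u)"
  proof (rule det_replace_column_sign(1)[OF l])
    show "0 \<le> Q w u" for w u unfolding Q_def by (intro sum_nonneg mult_nonneg_nonneg mixed_nonneg[OF xm]) auto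
    show "(\<Sum>u\<in>UNIV. Q w u) = 1" for w
      unfolding Q_def by (subst sum.swap) (simp add: sum_distrib_left[symmetric] sum_pmf_UNIV mixed_sum[OF xm])
    show "v$w - (1 - l) * (\<Sum>u\<in>UNIV. Q w u * v$u) \<le> b$w" for w
    proof -
      have "v$w \<le> mexp (shapley_mat G l v w) (x$w) (axis (j w) 1)" using x mixed_axis unfolding opt1_def by blast
      also have "\<dots> = b$w + (1 - l) * (\<Sum>a\<in>UNIV. x$w$a * nextv G v w a (j w))"
        by (simp add: mexp_axis_right shapley_mat_def b_def algebra_simps sum.distrib sum_subtractf sum_distrib_left)
      also have "(\<Sum>a\<in>UNIV. x$w$a * nextv G v w a (j w)) = (\<Sum>u\<in>UNIV. Q w u * v$u)"
        unfolding nextv_def Q_def by (simp add: sum_distrib_left sum_distrib_right mult_ac) (rule sum.swap)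
      finally show ?thesis by simp
    qed
  qed
  ultimately show ?thesis by simp
qed

lemma sum_profile2:
  fixes G :: "('w::finite, 'i::finite, 'j::finite) stochastic_game"
  assumes l: "0 < l" "l \<le> 1" and y: "opt2 G l v y"
  shows "(\<Sum>j\<in>UNIV. det (profile_mat G k l (v$k) i j) * (\<Prod>w\<in>UNIV. y$w$(j w))) \<le> 0"
proof -
  define Q where "Q w u = (\<Sum>a\<in>UNIV. y$w$a * pmf (transition G w (i w) a) u)" for w u
  define b where "b = (\<chi> w. l * (\<Sum>a\<in>UNIV. y$w$a * payoff G w (i w) a))"
  have ym: "y$w \<in> mixed" for w using y unfolding opt2_def by simp
  define r where "r w a = (\<chi> u.
     if u = k then l * payoff G w (i w) a - v$k * ((if w = u then 1 else 0) - (1 - l) * pmf (transition G w (i w) a) u)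
     else (if w = u then 1 else 0) - (1 - l) * pmf (transition G w (i w) a) u)" for w a
  have "(\<Sum>a\<in>UNIV. y$w$a *s r w a)$u = (if u = k then b$w - v$k * resolvent_mat l Q$w$k else resolvent_mat l Q$w$u)" for w u
  proof -
    have R: "resolvent_mat l Q $ w $ u = (\<Sum>a\<in>UNIV. y$w$a * ((if w = u then 1 else 0) - (1 - l) * pmf (transition G w (i w) a) u))"
      by (simp add: resolvent_mat_def Q_def right_diff_distrib sum_subtractf sum_distrib_left sum_distrib_right[symmetric] mixed_sum[OF ym] mult_ac)
    show ?thesis
    proof (cases "u = k")
      case True
      then show ?thesis using R
        by (simp add: r_def b_def sum_distrib_left right_diff_distrib[of "y$_$_" "_ * _" "v$k * _"] sum_subtractf mult_ac)
    next
      case False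
      then show ?thesis using R by (simp add: r_def)
    qed
  qed
  then have "(\<chi> w. \<Sum>a\<in>UNIV. y$w$a *s r w a) = (\<chi> w u. if u = k then b$w - v$k * resolvent_mat l Q$w$k else resolvent_mat l Q$w$u)"
    by (simp only: vec_eq_iff vec_lambda_beta simp_thms)
  moreover have "(\<Sum>j\<in>UNIV. det (profile_mat G k l (v$k) i j) * (\<Prod>w\<in>UNIV. y$w$(j w))) = det (\<chi> w. \<Sum>a\<in>UNIV. y$w$a *s r w a)"
    unfolding det_rows_expand by (simp add: profile_mat_def r_def mult.commute)
  moreover have "det (\<chi> w u. if u = k then b$w - v$k * resolvent_mat l Q$w$k else resolvent_mat l Q$w$u) \<le> 0"
  proof (rule det_replace_column_sign(2)[OF l])
    show "0 \<le> Q w u" for w u unfolding Q_def by (intro sum_nonneg mult_nonneg_nonneg mixed_nonneg[OF ym]) auto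
    show "(\<Sum>u\<in>UNIV. Q w u) = 1" for w
      unfolding Q_def by (subst sum.swap) (simp add: sum_distrib_left[symmetric] sum_pmf_UNIV mixed_sum[OF ym])
    show "b$w \<le> v$w - (1 - l) * (\<Sum>u\<in>UNIV. Q w u * v$u)" for w
    proof -
      have "(\<Sum>u\<in>UNIV. Q w u * v$u) = (\<Sum>a\<in>UNIV. y$w$a * nextv G v w (i w) a)"
        unfolding nextv_def Q_def by (simp add: sum_distrib_left sum_distrib_right mult_ac) (rule sum.swap)
      then have "b$w + (1 - l) * (\<Sum>u\<in>UNIV. Q w u * v$u) = mexp (shapley_mat G l v w) (axis (i w) 1) (y$w)"
        by (simp add: mexp_axis_left shapley_mat_def b_def algebra_simps sum.distrib sum_subtractf sum_distrib_left)
      also have "\<dots> \<le> v$w" using y mixed_axis unfolding opt2_def by blast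
      finally show ?thesis by simp
    qed
  qed
  ultimately show ?thesis by simp
qed

text \<open>At each l the kernel lemma yields index sets R and C whose Gram determinant vanishes at
  z = v$k but not at z = v$k + t. There are finitely many such pairs, and they do not depend on l,
  so finitely many polynomials serve for all l.\<close>

lemma discounted_value_level_sets:
  fixes G :: "('w::finite, 'i::finite, 'j::finite) stochastic_game"
  shows "\<exists>d E. finite E \<and> (\<forall>c. c \<notin> E \<longrightarrow>
    finite {l \<in> {0<..1}. discounted_value G l $ k = c} \<and> card {l \<in> {0<..1}. discounted_value G l $ k = c} \<le> d)"
proof (rule finite_level_sets)
  define F where "F = (\<lambda>(R, C) l z. det (gram R C (\<lambda>i j. det (profile_mat G k l z i j))))"
  let ?I = "UNIV :: (('w \<Rightarrow> 'i) set \<times> ('w \<Rightarrow> 'j) set) set"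
  show "finite ?I" by simp
  show "bipoly (F \<alpha>)" if "\<alpha> \<in> ?I" for \<alpha>
  proof (cases \<alpha>)
    case (Pair R C)
    have "bipoly (\<lambda>l z. gram R C (\<lambda>i j. det (profile_mat G k l z i j)) $ p $ q)" for p q
      by (cases "p \<in> C \<and> q \<in> C"; cases "p = q")
        (auto simp: gram_def simp del: sum_constant intro!: bipoly_const bipoly_sum bipoly_mult bipoly_det_profile_mat)
    then show ?thesis unfolding F_def Pair by (auto intro: bipoly_det)
  qed
  fix l :: real assume "l \<in> {0<..1}"
  then have l: "0 < l" "l \<le> 1" by auto
  define v where "v = discounted_value G l"
  obtain x y where x: "opt1 G l v x" and y: "opt2 G l v y" using discounted_value[OF l] unfolding v_def by blast
  have m: "x$w \<in> mixed" "y$w \<in> mixed" for w using x y unfolding opt1_def opt2_def by auto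
  define M where "M = (\<chi> i j. det (profile_mat G k l (v$k) i j))"
  define B where "B = (\<chi> i j. det (profile_res G l i j))"
  have "\<exists>R C. (\<exists>u. u \<noteq> 0 \<and> (\<forall>j. j \<notin> C \<longrightarrow> u$j = 0) \<and> (\<forall>i\<in>R. (\<Sum>j\<in>UNIV. M$i$j * u$j) = 0)) \<and>
    (\<exists>t. \<forall>u. (\<forall>j. j \<notin> C \<longrightarrow> u$j = 0) \<and> (\<forall>i\<in>R. (\<Sum>j\<in>UNIV. (M$i$j - t * B$i$j) * u$j) = 0) \<longrightarrow> u = 0)"
  proof (rule shapley_snow_kernel[where X = "\<chi> i. \<Prod>w\<in>UNIV. x$w$(i w)" and Z = "\<chi> j. \<Prod>w\<in>UNIV. y$w$(j w)"])
    show "0 \<le> (\<Sum>i\<in>UNIV. (\<chi> i. \<Prod>w\<in>UNIV. x$w$(i w))$i * M$i$j)" for j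
      using sum_profile1[OF l x, of k j] by (simp add: M_def)
    show "(\<Sum>j\<in>UNIV. M$i$j * (\<chi> j. \<Prod>w\<in>UNIV. y$w$(j w))$j) \<le> 0" for i
      using sum_profile2[OF l y, of k i] by (simp add: M_def)
  qed (use m l in \<open>auto simp: B_def profile_res_pos mixed_sum intro!: sum_prod_mixed prod_nonneg mixed_nonneg\<close>)
  then obtain R C t where 1: "\<exists>u. u \<noteq> 0 \<and> (\<forall>j. j \<notin> C \<longrightarrow> u$j = 0) \<and> (\<forall>i\<in>R. (\<Sum>j\<in>UNIV. M$i$j * u$j) = 0)"
    and 2: "\<forall>u. (\<forall>j. j \<notin> C \<longrightarrow> u$j = 0) \<and> (\<forall>i\<in>R. (\<Sum>j\<in>UNIV. (M$i$j - t * B$i$j) * u$j) = 0) \<longrightarrow> u = 0"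
    by blast
  have "F (R, C) l (v$k) = 0"
    using 1 unfolding F_def prod.case det_gram_eq_0_iff by (simp add: M_def)
  moreover have "F (R, C) l (v$k + t) \<noteq> 0"
    using 2 unfolding F_def prod.case det_gram_eq_0_iff by (auto simp: M_def B_def profile_mat_shift[OF l])
  ultimately show "\<exists>\<alpha>\<in>?I. F \<alpha> l (discounted_value G l $ k) = 0 \<and> (\<exists>z. F \<alpha> l z \<noteq> 0)"
    unfolding v_def by blast
qed

section \<open>Balanced pairs of optimal strategies\<close>

lemma discounted_value_converges:
  fixes G :: "('w::finite, 'i::finite, 'j::finite) stochastic_game"
  shows "\<exists>V. \<forall>w. ((\<lambda>l. discounted_value G l $ w) \<longlongrightarrow> V$w) (at_right 0)"
proof -
  have "\<exists>L. ((\<lambda>l. discounted_value G l $ w) \<longlongrightarrow> L) (at_right 0)" for w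
  proof -
    obtain d E where E: "finite E" and fin: "\<And>c. c \<notin> E \<Longrightarrow> finite {l \<in> {0<..1}. discounted_value G l $ w = c}"
      using discounted_value_level_sets[of G w] by blast
    show ?thesis
    proof (rule converges_at_right_if_finite_level_sets[OF _ _ E])
      show "continuous_on {0<..<1} (\<lambda>l. discounted_value G l $ w)"
        by (rule continuous_on_subset[OF continuous_on_discounted_value]) auto
      show "finite {l \<in> {0<..<1}. discounted_value G l $ w = c}" if "c \<notin> E" for c
        by (rule finite_subset[OF _ fin[OF that]]) auto
      show "\<bar>discounted_value G l $ w\<bar> \<le> payoff_bound G" if "0 < l" "l < 1" for l
        by (rule discounted_value) (use that in auto)
    qed
  qed
  then obtain L where "\<And>w. ((\<lambda>l. discounted_value G l $ w) \<longlongrightarrow> L w) (at_right 0)" by metis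
  then show ?thesis by (intro exI[of _ "\<chi> w. L w"]) simp
qed

section \<open>Limits of optimal stationary strategies and difference quotients of the value\<close>

definition stationary :: "(real^'i^'w) set" where
  "stationary = {x. \<forall>w. x$w \<in> mixed}"

lemma compact_stationary: "compact (stationary :: (real^'i^'w) set)"
proof -
  have eq: "stationary = (\<Inter>w. (\<lambda>x::real^'i^'w. x$w) -` mixed)" by (auto simp: stationary_def)
  have "closed (stationary :: (real^'i^'w) set)"
    unfolding eq by (intro closed_INT ballI closed_vimage closed_mixed continuous_intros)
  moreover have "norm x \<le> real CARD('w)" if "x \<in> stationary" for x :: "real^'i^'w"
  proof -
    have "norm x \<le> (\<Sum>w\<in>UNIV. norm (x$w))" unfolding norm_vec_def by (rule L2_set_le_sum) simp
    also have "\<dots> \<le> (\<Sum>w\<in>(UNIV::'w set). 1)"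
      by (intro sum_mono norm_mixed) (use that in \<open>simp add: stationary_def\<close>)
    finally show ?thesis by simp
  qed
  ultimately show ?thesis by (auto simp: compact_eq_bounded_closed bounded_iff)
qed

lemma tendsto_mexp:
  assumes "\<And>i j. ((\<lambda>n. A n i j) \<longlongrightarrow> A' i j) F" "(x \<longlongrightarrow> x') F" "(y \<longlongrightarrow> y') F"
  shows "((\<lambda>n. mexp (A n) (x n) (y n)) \<longlongrightarrow> mexp A' x' y') F"
  unfolding mexp_def by (intro tendsto_intros assms)

lemma tendsto_nextv: "(v \<longlongrightarrow> v') F \<Longrightarrow> ((\<lambda>n. nextv G (v n) w i j) \<longlongrightarrow> nextv G v' w i j) F"
  unfolding nextv_def by (intro tendsto_intros)

lemma mexp_convex_left: "mexp A (u *\<^sub>R x + v *\<^sub>R x') y = u * mexp A x y + v * mexp A x' y"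
  and mexp_convex_right: "mexp A x (u *\<^sub>R y + v *\<^sub>R y') = u * mexp A x y + v * mexp A x y'"
  by (simp_all add: mexp_def algebra_simps sum.distrib sum_distrib_left)

text \<open>In the game b the strategy x guarantees vb, and in the game a the strategy y caps va, so
  at this pair both bounds act in the same direction. The difference of the two Shapley matrices is
  exactly b - a times the matrix shown, without a remainder.\<close>

lemma increment_le:
  assumes "a < b" and x: "opt1 G b vb x" and y: "opt2 G a va y" and p: "p = (1 / (b - a)) *\<^sub>R (vb - va)"
  shows "p$w \<le> mexp (\<lambda>i j. payoff G w i j - nextv G va w i j + (1 - b) * nextv G p w i j) (x$w) (y$w)"
proof -
  have m: "x$w \<in> mixed" "y$w \<in> mixed" using x y unfolding opt1_def opt2_def by auto
  have "vb$w - va$w \<le> mexp (shapley_mat G b vb w) (x$w) (y$w) - mexp (shapley_mat G a va w) (x$w) (y$w)"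
    using x y m unfolding opt1_def opt2_def by (intro diff_mono) auto
  also have "\<dots> = mexp (\<lambda>i j. (b - a) * (payoff G w i j - nextv G va w i j + (1 - b) * nextv G p w i j)) (x$w) (y$w)"
    unfolding mexp_diff[symmetric] p nextv_scaleR nextv_diff shapley_mat_def using \<open>a < b\<close>
    by (intro arg_cong[where f = "\<lambda>A. mexp A _ _"] ext) (simp add: field_simps)
  finally have "vb$w - va$w \<le> (b - a) * mexp (\<lambda>i j. payoff G w i j - nextv G va w i j + (1 - b) * nextv G p w i j) (x$w) (y$w)"
    unfolding mexp_cmult .
  moreover have "p$w = (vb$w - va$w) / (b - a)" by (simp add: p)
  ultimately show ?thesis using \<open>a < b\<close> by (simp add: pos_divide_le_eq mult.commute)
qed

lemma increment_ge:
  assumes "a < b" and x: "opt1 G a va x" and y: "opt2 G b vb y" and p: "p = (1 / (b - a)) *\<^sub>R (vb - va)"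
  shows "mexp (\<lambda>i j. payoff G w i j - nextv G va w i j + (1 - b) * nextv G p w i j) (x$w) (y$w) \<le> p$w"
proof -
  have m: "x$w \<in> mixed" "y$w \<in> mixed" using x y unfolding opt1_def opt2_def by auto
  have "mexp (\<lambda>i j. (b - a) * (payoff G w i j - nextv G va w i j + (1 - b) * nextv G p w i j)) (x$w) (y$w)
      = mexp (shapley_mat G b vb w) (x$w) (y$w) - mexp (shapley_mat G a va w) (x$w) (y$w)"
    unfolding mexp_diff[symmetric] p nextv_scaleR nextv_diff shapley_mat_def using \<open>a < b\<close>
    by (intro arg_cong[where f = "\<lambda>A. mexp A _ _"] ext) (simp add: field_simps)
  also have "\<dots> \<le> vb$w - va$w"
    using x y m unfolding opt1_def opt2_def by (intro diff_mono) auto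
  finally have "(b - a) * mexp (\<lambda>i j. payoff G w i j - nextv G va w i j + (1 - b) * nextv G p w i j) (x$w) (y$w) \<le> vb$w - va$w"
    unfolding mexp_cmult .
  moreover have "p$w = (vb$w - va$w) / (b - a)" by (simp add: p)
  ultimately show ?thesis using \<open>a < b\<close> by (simp add: pos_le_divide_eq mult.commute)
qed

lemma opt1_limit:
  fixes G :: "('w::finite, 'i::finite, 'j::finite) stochastic_game"
  assumes "\<And>n. opt1 G (l n) (v n) (x n)" "l \<longlonglongrightarrow> l'" "v \<longlonglongrightarrow> v'" "x \<longlonglongrightarrow> x'" "x' \<in> stationary"
  shows "opt1 G l' v' x'"
  unfolding opt1_def
proof (intro allI conjI ballI)
  fix w and y :: "real^'j" assume y: "y \<in> mixed"
  show "v'$w \<le> mexp (shapley_mat G l' v' w) (x'$w) y"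
  proof (rule LIMSEQ_le)
    show "(\<lambda>n. v n $ w) \<longlonglongrightarrow> v'$w" by (intro tendsto_intros assms)
    show "(\<lambda>n. mexp (shapley_mat G (l n) (v n) w) (x n $ w) y) \<longlonglongrightarrow> mexp (shapley_mat G l' v' w) (x'$w) y"
      unfolding shapley_mat_def by (intro tendsto_mexp tendsto_intros tendsto_nextv assms)
    show "\<exists>N. \<forall>n\<ge>N. v n $ w \<le> mexp (shapley_mat G (l n) (v n) w) (x n $ w) y"
      using assms(1) y unfolding opt1_def by blast
  qed
qed (use assms(5) in \<open>simp add: stationary_def\<close>)

lemma opt2_limit:
  fixes G :: "('w::finite, 'i::finite, 'j::finite) stochastic_game"
  assumes "\<And>n. opt2 G (l n) (v n) (y n)" "l \<longlonglongrightarrow> l'" "v \<longlonglongrightarrow> v'" "y \<longlonglongrightarrow> y'" "y' \<in> stationary"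
  shows "opt2 G l' v' y'"
  unfolding opt2_def
proof (intro allI conjI ballI)
  fix w and x :: "real^'i" assume x: "x \<in> mixed"
  show "mexp (shapley_mat G l' v' w) x (y'$w) \<le> v'$w"
  proof (rule LIMSEQ_le)
    show "(\<lambda>n. v n $ w) \<longlonglongrightarrow> v'$w" by (intro tendsto_intros assms)
    show "(\<lambda>n. mexp (shapley_mat G (l n) (v n) w) x (y n $ w)) \<longlonglongrightarrow> mexp (shapley_mat G l' v' w) x (y'$w)"
      unfolding shapley_mat_def by (intro tendsto_mexp tendsto_intros tendsto_nextv assms)
    show "\<exists>N. \<forall>n\<ge>N. mexp (shapley_mat G (l n) (v n) w) x (y n $ w) \<le> v n $ w"
      using assms(1) x unfolding opt2_def by blast
  qed
qed (use assms(5) in \<open>simp add: stationary_def\<close>)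

text \<open>A discretised envelope theorem: in the limit of small increments of the discount factor,
  the pair \<open>(x\<^sub>b, y\<^sub>a)\<close> gives one inequality and \<open>(x\<^sub>a, y\<^sub>b)\<close> the other one; on the segment
  joining the two limit pairs some pair gives equality in each state.\<close>

lemma ex_envelope_pair:
  fixes G :: "('w::finite, 'i::finite, 'j::finite) stochastic_game"
  assumes s: "0 < s" "t \<le> 1" and ab: "\<And>n. s \<le> a n \<and> a n < b n \<and> b n \<le> t" "(\<lambda>n. b n - a n) \<longlonglongrightarrow> 0"
    and c: "\<And>n w. \<bar>discounted_value G (b n) $ w - discounted_value G (a n) $ w\<bar> \<le> c * (b n - a n)"
  shows "\<exists>l x y p. s \<le> l \<and> l \<le> t \<and> opt1 G l (discounted_value G l) x \<and> opt2 G l (discounted_value G l) y \<and>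
    (\<forall>w. \<bar>p$w\<bar> \<le> c) \<and>
    (\<forall>w. mexp (\<lambda>i j. payoff G w i j - nextv G (discounted_value G l) w i j + (1 - l) * nextv G p w i j) (x$w) (y$w) = p$w)"
proof -
  let ?v = "discounted_value G"
  have an: "0 < a n" "a n \<le> 1" "0 < b n" "b n \<le> 1" for n using ab(1)[of n] s by auto
  define p where "p n = (1 / (b n - a n)) *\<^sub>R (?v (b n) - ?v (a n))" for n
  have pc: "\<bar>p n $ w\<bar> \<le> c" for n w
  proof -
    have "p n $ w = (?v (b n) $ w - ?v (a n) $ w) / (b n - a n)" by (simp add: p_def)
    then show ?thesis using c[of n w] ab(1)[of n] by (simp add: pos_divide_le_eq)
  qed
  obtain xa where xa: "\<And>n. opt1 G (a n) (?v (a n)) (xa n)" using discounted_value(2)[OF an(1,2)] by metis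
  obtain ya where ya: "\<And>n. opt2 G (a n) (?v (a n)) (ya n)" using discounted_value(3)[OF an(1,2)] by metis
  obtain xb where xb: "\<And>n. opt1 G (b n) (?v (b n)) (xb n)" using discounted_value(2)[OF an(3,4)] by metis
  obtain yb where yb: "\<And>n. opt2 G (b n) (?v (b n)) (yb n)" using discounted_value(3)[OF an(3,4)] by metis
  \<comment> \<open>One compact set holds all the sequences, so that a single subsequence makes the
    discount factors, the quotients and the four strategies converge together.\<close>
  define P :: "(real^'w) set" where "P = cbox (\<chi> w. - c) (\<chi> w. c)"
  define S where "S = {s..t} \<times> P \<times> (stationary \<times> stationary :: ((real^'i^'w) \<times> (real^'i^'w)) set) \<times> (stationary \<times> stationary :: ((real^'j^'w) \<times> (real^'j^'w)) set)"
  define z where "z n = (a n, p n, (xa n, xb n :: real^'i^'w), (ya n, yb n))" for n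
  have "compact S" unfolding S_def P_def by (intro compact_Times compact_stationary compact_Icc compact_cbox)
  moreover have "z n \<in> S" for n
    using xa[of n] xb[of n] ya[of n] yb[of n] ab(1)[of n] pc[of n]
    unfolding z_def S_def P_def stationary_def opt1_def opt2_def
    by (auto simp: mem_box_cart abs_le_iff minus_le_iff)
  ultimately obtain z' r where r: "z' \<in> S" "strict_mono r" "(z \<circ> r) \<longlonglongrightarrow> z'"
    unfolding compact_def by blast
  obtain l p' xa' xb' ya' yb' where z': "z' = (l, p', (xa', xb'), (ya', yb'))" by (metis prod.exhaust)
  have lim: "(\<lambda>n. a (r n)) \<longlonglongrightarrow> l" "(\<lambda>n. p (r n)) \<longlonglongrightarrow> p'" "(\<lambda>n. xa (r n)) \<longlonglongrightarrow> xa'"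
    "(\<lambda>n. xb (r n)) \<longlonglongrightarrow> xb'" "(\<lambda>n. ya (r n)) \<longlonglongrightarrow> ya'" "(\<lambda>n. yb (r n)) \<longlonglongrightarrow> yb'"
    using tendsto_fst[OF r(3)] tendsto_fst[OF tendsto_snd[OF r(3)]]
      tendsto_fst[OF tendsto_fst[OF tendsto_snd[OF tendsto_snd[OF r(3)]]]]
      tendsto_snd[OF tendsto_fst[OF tendsto_snd[OF tendsto_snd[OF r(3)]]]]
      tendsto_fst[OF tendsto_snd[OF tendsto_snd[OF tendsto_snd[OF r(3)]]]]
      tendsto_snd[OF tendsto_snd[OF tendsto_snd[OF tendsto_snd[OF r(3)]]]]
    by (simp_all add: z_def z' o_def)
  have mem: "s \<le> l" "l \<le> t" "\<And>w. \<bar>p'$w\<bar> \<le> c" "xa' \<in> stationary" "xb' \<in> stationary" "ya' \<in> stationary" "yb' \<in> stationary"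
    using r(1) unfolding z' S_def P_def by (auto simp: mem_box_cart abs_le_iff minus_le_iff)
  have "(\<lambda>n. a (r n) + (b (r n) - a (r n))) \<longlonglongrightarrow> l + 0"
    by (intro tendsto_add lim LIMSEQ_subseq_LIMSEQ[OF ab(2) r(2), unfolded o_def])
  then have bl: "(\<lambda>n. b (r n)) \<longlonglongrightarrow> l" by simp
  have l: "l \<in> {0<..1}" using mem s by auto
  have vlim: "(\<lambda>n. ?v (f n)) \<longlonglongrightarrow> ?v l" if "f \<longlonglongrightarrow> l" "\<And>n. f n \<in> {0<..1}" for f :: "nat \<Rightarrow> real"
  proof (rule vec_tendstoI)
    fix w
    show "(\<lambda>n. ?v (f n) $ w) \<longlonglongrightarrow> ?v l $ w"
      using continuous_on_tendsto_compose[OF continuous_on_discounted_value that(1) l] that(2) by simp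
  qed
  have va: "(\<lambda>n. ?v (a (r n))) \<longlonglongrightarrow> ?v l" by (rule vlim[OF lim(1)]) (use an in auto)
  have vb: "(\<lambda>n. ?v (b (r n))) \<longlonglongrightarrow> ?v l" by (rule vlim[OF bl]) (use an in auto)
  have oxa: "opt1 G l (?v l) xa'" by (rule opt1_limit[OF xa lim(1) va lim(3) mem(4)])
  have oxb: "opt1 G l (?v l) xb'" by (rule opt1_limit[OF xb bl vb lim(4) mem(5)])
  have oya: "opt2 G l (?v l) ya'" by (rule opt2_limit[OF ya lim(1) va lim(5) mem(6)])
  have oyb: "opt2 G l (?v l) yb'" by (rule opt2_limit[OF yb bl vb lim(6) mem(7)])
  define F where "F w i j = payoff G w i j - nextv G (?v l) w i j + (1 - l) * nextv G p' w i j" for w i j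
  have Flim: "(\<lambda>n. payoff G w i j - nextv G (?v (a (r n))) w i j + (1 - b (r n)) * nextv G (p (r n)) w i j) \<longlonglongrightarrow> F w i j" for w i j
    unfolding F_def by (intro tendsto_intros tendsto_nextv va bl lim)
  have le: "p'$w \<le> mexp (F w) (xb'$w) (ya'$w)" for w
  proof (rule LIMSEQ_le)
    show "(\<lambda>n. p (r n) $ w) \<longlonglongrightarrow> p'$w" by (intro tendsto_intros lim)
    show "(\<lambda>n. mexp (\<lambda>i j. payoff G w i j - nextv G (?v (a (r n))) w i j + (1 - b (r n)) * nextv G (p (r n)) w i j)
        (xb (r n) $ w) (ya (r n) $ w)) \<longlonglongrightarrow> mexp (F w) (xb'$w) (ya'$w)"
      by (intro tendsto_mexp Flim tendsto_vec_nth lim)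
    show "\<exists>N. \<forall>n\<ge>N. p (r n) $ w \<le> mexp (\<lambda>i j. payoff G w i j - nextv G (?v (a (r n))) w i j + (1 - b (r n)) * nextv G (p (r n)) w i j)
        (xb (r n) $ w) (ya (r n) $ w)"
      using increment_le[OF _ xb ya p_def] ab(1) by blast
  qed
  have ge: "mexp (F w) (xa'$w) (yb'$w) \<le> p'$w" for w
  proof (rule LIMSEQ_le)
    show "(\<lambda>n. p (r n) $ w) \<longlonglongrightarrow> p'$w" by (intro tendsto_intros lim)
    show "(\<lambda>n. mexp (\<lambda>i j. payoff G w i j - nextv G (?v (a (r n))) w i j + (1 - b (r n)) * nextv G (p (r n)) w i j)
        (xa (r n) $ w) (yb (r n) $ w)) \<longlonglongrightarrow> mexp (F w) (xa'$w) (yb'$w)"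
      by (intro tendsto_mexp Flim tendsto_vec_nth lim)
    show "\<exists>N. \<forall>n\<ge>N. mexp (\<lambda>i j. payoff G w i j - nextv G (?v (a (r n))) w i j + (1 - b (r n)) * nextv G (p (r n)) w i j)
        (xa (r n) $ w) (yb (r n) $ w) \<le> p (r n) $ w"
      using increment_ge[OF _ xa yb p_def] ab(1) by blast
  qed
  \<comment> \<open>\<open>Y\<close> runs in the order opposite to \<open>X\<close>, so that u = 0
    and u = 1 are the pairs of \<open>ge\<close> and \<open>le\<close>. The parameter may differ
    from state to state, because optimality is a condition on each state and is preserved by convex
    combinations.\<close>
  define X where "X u w = (1 - u) *\<^sub>R xa'$w + u *\<^sub>R xb'$w" for u w
  define Y where "Y u w = (1 - u) *\<^sub>R yb'$w + u *\<^sub>R ya'$w" for u w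
  have "\<exists>u. 0 \<le> u \<and> u \<le> 1 \<and> mexp (F w) (X u w) (Y u w) = p'$w" for w
  proof (rule IVT')
    show "continuous_on {0..1} (\<lambda>u. mexp (F w) (X u w) (Y u w))"
      unfolding mexp_def X_def Y_def by (intro continuous_intros)
  qed (use le ge in \<open>auto simp: X_def Y_def\<close>)
  then obtain u where u: "\<And>w. 0 \<le> u w" "\<And>w. u w \<le> 1" "\<And>w. mexp (F w) (X (u w) w) (Y (u w) w) = p'$w" by metis
  define x where "x = (\<chi> w. X (u w) w)"
  define y where "y = (\<chi> w. Y (u w) w)"
  have "opt1 G l (?v l) x" unfolding opt1_def
  proof (intro allI conjI ballI)
    fix w
    show "x$w \<in> mixed"
      using convexD[OF convex_mixed, of "xa'$w" "xb'$w" "1 - u w" "u w"] u(1,2)[of w] mem(4,5)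
      unfolding x_def X_def stationary_def by simp
    fix q :: "real^'j" assume q: "q \<in> mixed"
    have "(1 - u w) * ?v l $ w + u w * ?v l $ w \<le> mexp (shapley_mat G l (?v l) w) (x$w) q"
      unfolding x_def X_def vec_lambda_beta mexp_convex_left
      using oxa oxb q u(1,2)[of w] unfolding opt1_def by (intro add_mono mult_left_mono) auto
    then show "?v l $ w \<le> mexp (shapley_mat G l (?v l) w) (x$w) q" by (simp add: algebra_simps)
  qed
  moreover have "opt2 G l (?v l) y" unfolding opt2_def
  proof (intro allI conjI ballI)
    fix w
    show "y$w \<in> mixed"
      using convexD[OF convex_mixed, of "yb'$w" "ya'$w" "1 - u w" "u w"] u(1,2)[of w] mem(6,7)
      unfolding y_def Y_def stationary_def by simp
    fix q :: "real^'i" assume q: "q \<in> mixed"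
    have "mexp (shapley_mat G l (?v l) w) q (y$w) \<le> (1 - u w) * ?v l $ w + u w * ?v l $ w"
      unfolding y_def Y_def vec_lambda_beta mexp_convex_right
      using oya oyb q u(1,2)[of w] unfolding opt2_def by (intro add_mono mult_left_mono) auto
    then show "mexp (shapley_mat G l (?v l) w) q (y$w) \<le> ?v l $ w" by (simp add: algebra_simps)
  qed
  moreover have "mexp (F w) (x$w) (y$w) = p'$w" for w unfolding x_def y_def by (simp add: u(3))
  ultimately show ?thesis using mem(1,2,3) unfolding F_def
    by (intro exI[of _ l] exI[of _ x] exI[of _ y] exI[of _ p'] conjI allI)
qed

text \<open>By the last condition, the expectation of v - \<pi> changes in one stage by -l times the
  expectation of \<pi> at the next state, so by at most l e.\<close>

definition balanced_pair ::
  "('w::finite, 'i::finite, 'j::finite) stochastic_game \<Rightarrow> real \<Rightarrow> real \<Rightarrow> real^'i^'w \<Rightarrow> real^'j^'w \<Rightarrow> real^'w \<Rightarrow> bool" where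
  "balanced_pair G e l x y \<pi> \<longleftrightarrow>
    opt1 G l (discounted_value G l) x \<and> opt2 G l (discounted_value G l) y \<and> (\<forall>w. \<bar>\<pi>$w\<bar> \<le> e) \<and>
    (\<forall>w. mexp (nextv G (discounted_value G l - (1 - l) *\<^sub>R \<pi>) w) (x$w) (y$w) = (discounted_value G l - \<pi>)$w)"

text \<open>For small s the value is within \<open>\<delta>\<close> of its limit on [s, a s], so its
  variation there, summed over the states, is at most \<open>\<tau>\<close>. Among n + 1 equal
  subintervals one has at most its share of it; its difference quotients are bounded by
  \<open>c\<close>, which does not depend on n, and the envelope argument applies as n
  grows.\<close>

lemma ex_balanced_pair:
  fixes G :: "('w::finite, 'i::finite, 'j::finite) stochastic_game"
  assumes a: "1 < a" and e: "0 < e"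
  shows "\<exists>s0>0. \<forall>s. 0 < s \<and> s \<le> s0 \<longrightarrow> (\<exists>l x y \<pi>. s \<le> l \<and> l \<le> a * s \<and> balanced_pair G e l x y \<pi>)"
proof -
  let ?v = "discounted_value G"
  obtain V where "\<forall>w. ((\<lambda>l. ?v l $ w) \<longlongrightarrow> V$w) (at_right 0)" using discounted_value_converges[of G] ..
  then have V: "((\<lambda>l. ?v l $ w) \<longlongrightarrow> V$w) (at_right 0)" for w ..
  define good where "good k d E \<longleftrightarrow> finite E \<and> (\<forall>c. c \<notin> E \<longrightarrow>
    finite {l \<in> {0<..1}. ?v l $ k = c} \<and> card {l \<in> {0<..1}. ?v l $ k = c} \<le> d)" for k d E
  have "\<forall>k. \<exists>d E. good k d E" unfolding good_def using discounted_value_level_sets[of G] ..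
  then obtain d E where "\<forall>k. good k (d k) (E k)" by metis
  then have E: "finite (E k)" and dE: "c \<notin> E k \<Longrightarrow>
      finite {l \<in> {0<..1}. ?v l $ k = c} \<and> card {l \<in> {0<..1}. ?v l $ k = c} \<le> d k" for k c
    unfolding good_def by auto
  define D where "D = (\<Sum>k\<in>UNIV. real (d k))"
  have D: "0 \<le> D" unfolding D_def by (intro sum_nonneg) auto
  \<comment> \<open>Chosen to give a \<open>\<tau>\<close> / (a - 1) \<le> e; D + 1 avoids a
    division by 0.\<close>
  define \<delta> where "\<delta> = e * (a - 1) / (2 * a * (D + 1))"
  have \<delta>: "0 < \<delta>" unfolding \<delta>_def using e a D by (intro divide_pos_pos mult_pos_pos) auto
  define \<tau> where "\<tau> = 2 * \<delta> * D"
  have \<tau>: "0 \<le> \<tau>" unfolding \<tau>_def using \<delta> D by simp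
  have "2 * \<delta> * D \<le> 2 * \<delta> * (D + 1)" using \<delta> by simp
  also have "\<dots> = e * (a - 1) / a" unfolding \<delta>_def using D a by (simp add: field_simps add_nonneg_eq_0_iff)
  finally have \<tau>e: "a * \<tau> / (a - 1) \<le> e" unfolding \<tau>_def using a by (simp add: field_simps)
  have "\<forall>\<^sub>F l in at_right 0. \<forall>w. \<bar>?v l $ w - V$w\<bar> < \<delta>"
    by (rule eventually_all_finite) (use tendstoD[OF V \<delta>] in \<open>simp add: dist_real_def\<close>)
  then obtain b where b: "b > 0" "\<And>l w. 0 < l \<Longrightarrow> l < b \<Longrightarrow> \<bar>?v l $ w - V$w\<bar> < \<delta>"
    unfolding eventually_at_right_field by auto
  define s0 where "s0 = min b 1 / (2 * a)"
  have s0: "0 < s0" unfolding s0_def using a b by simp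
  have "\<exists>l x y \<pi>. s \<le> l \<and> l \<le> a * s \<and> balanced_pair G e l x y \<pi>"
    if s: "0 < s" "s \<le> s0" for s
  proof -
    have "a * s \<le> a * s0" using s a by simp
    also have "\<dots> = min b 1 / 2" unfolding s0_def using a by simp
    finally have as: "a * s < b" "a * s < 1" using b by auto
    have "1 * s < a * s" using a s by (intro mult_strict_right_mono) auto
    then have sas: "s < a * s" by simp
    define h where "h n = (a * s - s) / real (Suc n)" for n
    have h: "0 < h n" for n unfolding h_def using sas by simp
    have hn: "real (Suc n) * h n = a * s - s" for n unfolding h_def by simp
    have step: "\<exists>k<Suc n. (\<Sum>w\<in>UNIV. \<bar>?v (s + real (Suc k) * h n) $ w - ?v (s + real k * h n) $ w\<bar>) \<le> \<tau> / real (Suc n)" for n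
    proof (rule ccontr)
      define q where "q k = s + real k * h n" for k
      have q: "q k \<in> {s..a * s}" if "k \<le> Suc n" for k
      proof -
        have "real k * h n \<le> real (Suc n) * h n" using h[of n] that by (intro mult_right_mono) auto
        then have "real k * h n \<le> a * s - s" unfolding hn .
        then show ?thesis using h[of n] unfolding q_def by simp
      qed
      assume "\<not> ?thesis"
      then have "\<And>k. k < Suc n \<Longrightarrow> \<tau> / real (Suc n) < (\<Sum>w\<in>UNIV. \<bar>?v (q (Suc k)) $ w - ?v (q k) $ w\<bar>)"
        unfolding q_def by (auto simp: not_le)
      then have "(\<Sum>k<Suc n. \<tau> / real (Suc n)) < (\<Sum>k<Suc n. \<Sum>w\<in>UNIV. \<bar>?v (q (Suc k)) $ w - ?v (q k) $ w\<bar>)"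
        by (intro sum_strict_mono) auto
      also have "\<dots> = (\<Sum>w\<in>UNIV. \<Sum>k<Suc n. \<bar>?v (q (Suc k)) $ w - ?v (q k) $ w\<bar>)" by (rule sum.swap)
      also have "\<dots> \<le> (\<Sum>w\<in>UNIV. 2 * \<delta> * real (d w))"
      proof (intro sum_mono)
        fix w
        show "(\<Sum>k<Suc n. \<bar>?v (q (Suc k)) $ w - ?v (q k) $ w\<bar>) \<le> 2 * \<delta> * real (d w)"
        proof (rule variation_le_level_sets[where f = "\<lambda>l. ?v l $ w" and p = q and s = s and t = "a * s" and L = "V$w" and E = "E w"])
          show "continuous_on {s..a * s} (\<lambda>l. ?v l $ w)"
            by (rule continuous_on_subset[OF continuous_on_discounted_value]) (use s as in auto)
          show "finite (E w)" by (rule E)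
          fix c assume c: "c \<notin> E w"
          have "{l \<in> {s..a * s}. ?v l $ w = c} \<subseteq> {l \<in> {0<..1}. ?v l $ w = c}" using s as by auto
          then show "finite {l \<in> {s..a * s}. ?v l $ w = c} \<and> card {l \<in> {s..a * s}. ?v l $ w = c} \<le> d w"
            using dE[OF c] by (meson card_mono finite_subset le_trans)
        next
          fix l assume "l \<in> {s..a * s}"
          then show "\<bar>?v l $ w - V$w\<bar> \<le> \<delta>" using b(2)[of l w] s as by auto
        next
          show "q k < q (Suc k)" for k using h[of n] unfolding q_def by (simp add: algebra_simps)
        qed (use \<delta> q in auto)
      qed
      also have "\<dots> = \<tau>" unfolding \<tau>_def D_def by (simp add: sum_distrib_left)
      finally show False by (simp del: of_nat_Suc)
    qed
    then obtain k where k: "\<And>n. k n < Suc n"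
      "\<And>n. (\<Sum>w\<in>UNIV. \<bar>?v (s + real (Suc (k n)) * h n) $ w - ?v (s + real (k n) * h n) $ w\<bar>) \<le> \<tau> / real (Suc n)"
      by metis
    define c where "c = \<tau> / (a * s - s)"
    have "\<exists>l x y p. s \<le> l \<and> l \<le> a * s \<and> opt1 G l (?v l) x \<and> opt2 G l (?v l) y \<and> (\<forall>w. \<bar>p$w\<bar> \<le> c) \<and>
      (\<forall>w. mexp (\<lambda>i j. payoff G w i j - nextv G (?v l) w i j + (1 - l) * nextv G p w i j) (x$w) (y$w) = p$w)"
    proof (rule ex_envelope_pair[where a = "\<lambda>n. s + real (k n) * h n" and b = "\<lambda>n. s + real (Suc (k n)) * h n"])
      fix n
      have "real (Suc (k n)) * h n \<le> real (Suc n) * h n" using h[of n] k(1)[of n] by (intro mult_right_mono) auto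
      then have "real (Suc (k n)) * h n \<le> a * s - s" unfolding hn .
      then show "s \<le> s + real (k n) * h n \<and> s + real (k n) * h n < s + real (Suc (k n)) * h n \<and> s + real (Suc (k n)) * h n \<le> a * s"
        using h[of n] by (auto simp: algebra_simps)
    next
      have "(\<lambda>n. (a * s - s) * inverse (real (Suc n))) \<longlonglongrightarrow> (a * s - s) * 0"
        by (intro tendsto_intros LIMSEQ_inverse_real_of_nat)
      then show "(\<lambda>n. s + real (Suc (k n)) * h n - (s + real (k n) * h n)) \<longlonglongrightarrow> 0"
        by (simp add: h_def algebra_simps divide_inverse)
    next
      fix n w
      have "\<bar>?v (s + real (Suc (k n)) * h n) $ w - ?v (s + real (k n) * h n) $ w\<bar>
          \<le> (\<Sum>w\<in>UNIV. \<bar>?v (s + real (Suc (k n)) * h n) $ w - ?v (s + real (k n) * h n) $ w\<bar>)"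
        by (rule member_le_sum) auto
      also have "\<dots> \<le> \<tau> / real (Suc n)" by (rule k(2))
      also have "\<dots> = c * h n" unfolding c_def h_def using sas a s by simp
      also have "\<dots> = c * (s + real (Suc (k n)) * h n - (s + real (k n) * h n))" by (simp add: algebra_simps)
      finally show "\<bar>?v (s + real (Suc (k n)) * h n) $ w - ?v (s + real (k n) * h n) $ w\<bar>
          \<le> c * (s + real (Suc (k n)) * h n - (s + real (k n) * h n))" .
    qed (use s as in auto)
    then obtain l x y p where l: "s \<le> l" "l \<le> a * s" and x: "opt1 G l (?v l) x" and y: "opt2 G l (?v l) y"
      and pc: "\<And>w. \<bar>p$w\<bar> \<le> c"
      and p: "\<And>w. mexp (\<lambda>i j. payoff G w i j - nextv G (?v l) w i j + (1 - l) * nextv G p w i j) (x$w) (y$w) = p$w"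
      by blast
    have l1: "0 < l" "l \<le> 1" using l s as by auto
    \<comment> \<open>The witness for \<pi> is l p: the bound l \<le> a s cancels the factor s in
      the denominator of \<open>c\<close>. Multiplying the envelope identity by l and using the
      Shapley equation gives the drift identity.\<close>
    have "\<bar>(l *\<^sub>R p)$w\<bar> \<le> e" for w
    proof -
      have "\<bar>(l *\<^sub>R p)$w\<bar> \<le> l * c" using pc[of w] l1 by (simp add: abs_mult)
      also have "\<dots> \<le> a * s * c" using l unfolding c_def by (intro mult_right_mono) (use \<tau> sas in auto)
      also have "\<dots> = a * \<tau> / (a - 1)"
      proof -
        have "a * s - s = (a - 1) * s" by (simp add: algebra_simps)
        then show ?thesis unfolding c_def using s a by simp
      qed
      also have "\<dots> \<le> e" by (rule \<tau>e)
      finally show ?thesis .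
    qed
    moreover have "mexp (\<lambda>i j. nextv G (?v l - (1 - l) *\<^sub>R (l *\<^sub>R p)) w i j) (x$w) (y$w) = ?v l $ w - (l *\<^sub>R p)$w" for w
    proof -
      have m: "x$w \<in> mixed" "y$w \<in> mixed" using x y unfolding opt1_def opt2_def by auto
      have val: "mexp (shapley_mat G l (?v l) w) (x$w) (y$w) = ?v l $ w"
        using x y m unfolding opt1_def opt2_def by (intro antisym) auto
      have "(\<lambda>i j. nextv G (?v l - (1 - l) *\<^sub>R (l *\<^sub>R p)) w i j) = (\<lambda>i j. shapley_mat G l (?v l) w i j -
          l * (payoff G w i j - nextv G (?v l) w i j + (1 - l) * nextv G p w i j))"
        by (intro ext) (simp only: nextv_diff nextv_scaleR shapley_mat_def, simp add: algebra_simps)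
      then show ?thesis by (simp add: mexp_diff mexp_cmult val p)
    qed
    ultimately have "balanced_pair G e l x y (l *\<^sub>R p)" using x y unfolding balanced_pair_def by simp
    then show ?thesis using l by blast
  qed
  then show ?thesis using s0 by blast
qed

section \<open>Laws of plays\<close>

primrec hist_law ::
  "('w, 'i, 'j) stochastic_game \<Rightarrow> 'w \<Rightarrow> ('w, 'i, 'j, 'i) strategy \<Rightarrow> ('w, 'i, 'j, 'j) strategy
    \<Rightarrow> nat \<Rightarrow> ('w \<times> 'i \<times> 'j) list pmf" where
  "hist_law G \<omega> \<sigma> \<rho> 0 = return_pmf []"
| "hist_law G \<omega> \<sigma> \<rho> (Suc n) =
     bind_pmf (hist_law G \<omega> \<sigma> \<rho> n) (\<lambda>h. map_pmf (\<lambda>z. h @ [z]) (stage_law G \<omega> \<sigma> \<rho> h))"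

text \<open>Both laws are indexed from \<open>0\<close>, so that index \<open>n\<close> corresponds to stage \<open>n + 1\<close>.\<close>

definition joint_law ::
  "('w, 'i, 'j) stochastic_game \<Rightarrow> 'w \<Rightarrow> ('w, 'i, 'j, 'i) strategy \<Rightarrow> ('w, 'i, 'j, 'j) strategy
    \<Rightarrow> nat \<Rightarrow> ('w \<times> 'i \<times> 'j) pmf" where
  "joint_law G \<omega> \<sigma> \<rho> n = bind_pmf (hist_law G \<omega> \<sigma> \<rho> n) (stage_law G \<omega> \<sigma> \<rho>)"

definition current_state_law ::
  "('w, 'i, 'j) stochastic_game \<Rightarrow> 'w \<Rightarrow> ('w, 'i, 'j, 'i) strategy \<Rightarrow> ('w, 'i, 'j, 'j) strategy
    \<Rightarrow> nat \<Rightarrow> 'w pmf" where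
  "current_state_law G \<omega> \<sigma> \<rho> n = bind_pmf (hist_law G \<omega> \<sigma> \<rho> n) (state_law G \<omega>)"

lemma length_hist_law: "h \<in> set_pmf (hist_law G \<omega> \<sigma> \<rho> n) \<Longrightarrow> length h = n"
  by (induction n arbitrary: h) auto

lemma pmf_hist_law:
  "length h = n \<Longrightarrow> pmf (hist_law G \<omega> \<sigma> \<rho> n) h = (\<Prod>k<n. pmf (stage_law G \<omega> \<sigma> \<rho> (take k h)) (h ! k))"
proof (induction n arbitrary: h)
  case (Suc n)
  then obtain h' z where h: "h = h' @ [z]" "length h' = n" by (metis length_Suc_conv_rev)
  have "pmf (map_pmf (\<lambda>z. y @ [z]) (stage_law G \<omega> \<sigma> \<rho> y)) h =
      (if y = h' then pmf (stage_law G \<omega> \<sigma> \<rho> h') z else 0)" for y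
  proof (cases "y = h'")
    case True
    then show ?thesis unfolding h(1) using pmf_map_inj'[of "\<lambda>z. h' @ [z]" "stage_law G \<omega> \<sigma> \<rho> h'" z] by (simp add: inj_def)
  next
    case False
    then have "h \<notin> set_pmf (map_pmf (\<lambda>z. y @ [z]) (stage_law G \<omega> \<sigma> \<rho> y))" unfolding h(1) by auto
    then have "pmf (map_pmf (\<lambda>z. y @ [z]) (stage_law G \<omega> \<sigma> \<rho> y)) h = 0" by (subst pmf_eq_0_set_pmf)
    then show ?thesis using False by simp
  qed
  then have "pmf (hist_law G \<omega> \<sigma> \<rho> (Suc n)) h =
      (\<integral>y. (if y = h' then pmf (stage_law G \<omega> \<sigma> \<rho> h') z else 0) \<partial>measure_pmf (hist_law G \<omega> \<sigma> \<rho> n))"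
    by (simp add: pmf_bind)
  also have "\<dots> = pmf (stage_law G \<omega> \<sigma> \<rho> h') z * pmf (hist_law G \<omega> \<sigma> \<rho> n) h'"
    by (subst integral_measure_pmf_real[of "{h'}"]) (auto split: if_splits)
  also have "\<dots> = (\<Prod>k<Suc n. pmf (stage_law G \<omega> \<sigma> \<rho> (take k h)) (h ! k))"
    unfolding Suc.IH[OF h(2)] h(1) using h(2) by (simp add: nth_append)
  finally show ?case .
qed simp

text \<open>A function of the first n triples is a finite combination of cylinder indicators, and
  the measures of cylinders are the products in \<open>pmf_hist_law\<close>. This carries all
  further computations over to probability mass functions with finite support.\<close>

lemma expect_hist_law:
  fixes G :: "('w::finite, 'i::finite, 'j::finite) stochastic_game"
  shows "expect G \<omega> \<sigma> \<rho> (\<lambda>x. f (map x [0..<n])) = measure_pmf.expectation (hist_law G \<omega> \<sigma> \<rho> n) f"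
proof -
  define M where "M = play_measure G \<omega> \<sigma> \<rho>"
  interpret prob_space M unfolding M_def by (rule prob_space_play_measure)
  define L where "L = {l :: ('w \<times> 'i \<times> 'j) list. length l = n}"
  have fL: "finite L" unfolding L_def using finite_lists_length_eq[of "UNIV :: ('w \<times> 'i \<times> 'j) set" n] by simp
  have spM: "space M = UNIV"
    using sets_eq_imp_space_eq[OF sets_play_measure[of G \<omega> \<sigma> \<rho>]] unfolding M_def by (simp add: space_PiM)
  define A where "A l = {x. map x [0..<n] = l}" for l :: "('w \<times> 'i \<times> 'j) list"
  have A: "A l = {x. \<forall>k<n. x k = l ! k}" if "l \<in> L" for l
    using that unfolding A_def L_def by (auto simp: list_eq_iff_nth_eq)
  have sA: "A l \<in> sets M" if "l \<in> L" for l
  proof -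
    have "{x. \<forall>k<m. x k = l ! k} \<in> sets (PiM UNIV (\<lambda>_. count_space UNIV))" for m
    proof (induction m)
      case 0
      show ?case using sets.top[of "PiM UNIV (\<lambda>_. count_space UNIV)"] by (simp add: space_PiM)
    next
      case (Suc m)
      have "(\<lambda>x. x m) -` {l ! m} \<inter> space (PiM UNIV (\<lambda>_. count_space UNIV)) \<in> sets (PiM UNIV (\<lambda>_. count_space UNIV))"
        by (rule measurable_sets[OF measurable_component_singleton]) auto
      then have "{x. \<forall>k<m. x k = l ! k} \<inter> {x. x m = l ! m} \<in> sets (PiM UNIV (\<lambda>_. count_space UNIV))"
        using Suc by (auto simp: space_PiM vimage_def)
      moreover have "{x. \<forall>k<Suc m. x k = l ! k} = {x. \<forall>k<m. x k = l ! k} \<inter> {x. x m = l ! m}"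
        by (auto simp: less_Suc_eq)
      ultimately show ?case by simp
    qed
    then show ?thesis unfolding A[OF that] M_def sets_play_measure .
  qed
  have "f (map x [0..<n]) = (\<Sum>l\<in>L. f l * indicator (A l) x)" for x
  proof -
    have "map x [0..<n] \<in> L" unfolding L_def by simp
    then have "(\<Sum>l\<in>L. f l * indicator (A l) x) = (\<Sum>l\<in>{map x [0..<n]}. f l * indicator (A l) x)"
      using fL by (intro sum.mono_neutral_right) (auto simp: A_def indicator_def)
    then show ?thesis by (simp add: A_def)
  qed
  then have "expect G \<omega> \<sigma> \<rho> (\<lambda>x. f (map x [0..<n])) = (\<integral>x. (\<Sum>l\<in>L. f l * indicator (A l) x) \<partial>M)"
    unfolding expect_def M_def by simp
  also have "\<dots> = (\<Sum>l\<in>L. f l * measure M (A l))"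
    by (subst Bochner_Integration.integral_sum)
      (auto intro!: integrable_mult_right integrable_real_indicator simp: sA emeasure_eq_measure spM)
  also have "\<dots> = (\<Sum>l\<in>L. f l * pmf (hist_law G \<omega> \<sigma> \<rho> n) l)"
  proof (intro sum.cong refl)
    fix l assume l: "l \<in> L"
    have "measure M (A l) = (\<Prod>k<n. pmf (stage_law G \<omega> \<sigma> \<rho> (map ((!) l) [0..<k])) (l ! k))"
      unfolding A[OF l] M_def by (rule measure_play_cylinder)
    also have "\<dots> = (\<Prod>k<n. pmf (stage_law G \<omega> \<sigma> \<rho> (take k l)) (l ! k))"
    proof (intro prod.cong refl)
      fix k assume "k \<in> {..<n}"
      then have "map ((!) l) [0..<k] = take k l"
        using l unfolding L_def by (intro nth_equalityI) auto
      then show "pmf (stage_law G \<omega> \<sigma> \<rho> (map ((!) l) [0..<k])) (l ! k) = pmf (stage_law G \<omega> \<sigma> \<rho> (take k l)) (l ! k)"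
        by simp
    qed
    also have "\<dots> = pmf (hist_law G \<omega> \<sigma> \<rho> n) l" using l unfolding L_def by (simp add: pmf_hist_law)
    finally show "f l * measure M (A l) = f l * pmf (hist_law G \<omega> \<sigma> \<rho> n) l" by simp
  qed
  also have "\<dots> = measure_pmf.expectation (hist_law G \<omega> \<sigma> \<rho> n) f"
    by (subst integral_measure_pmf_real[OF fL]) (auto simp: L_def dest: length_hist_law)
  finally show ?thesis .
qed

lemma expect_stage:
  fixes G :: "('w::finite, 'i::finite, 'j::finite) stochastic_game"
  shows "expect G \<omega> \<sigma> \<rho> (\<lambda>x. f (x n)) = measure_pmf.expectation (joint_law G \<omega> \<sigma> \<rho> n) f"
proof -
  have "map_pmf (\<lambda>l. l ! n) (hist_law G \<omega> \<sigma> \<rho> (Suc n)) =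
      bind_pmf (hist_law G \<omega> \<sigma> \<rho> n) (\<lambda>h. map_pmf (\<lambda>z. (h @ [z]) ! n) (stage_law G \<omega> \<sigma> \<rho> h))"
    by (simp add: map_bind_pmf pmf.map_comp o_def)
  also have "\<dots> = joint_law G \<omega> \<sigma> \<rho> n"
    unfolding joint_law_def
    by (intro bind_pmf_cong refl) (auto dest!: length_hist_law simp: map_pmf_idI)
  finally have eq: "map_pmf (\<lambda>l. l ! n) (hist_law G \<omega> \<sigma> \<rho> (Suc n)) = joint_law G \<omega> \<sigma> \<rho> n" .
  have "expect G \<omega> \<sigma> \<rho> (\<lambda>x. f (x n)) = expect G \<omega> \<sigma> \<rho> (\<lambda>x. f (map x [0..<Suc n] ! n))"
    by (simp add: nth_append del: upt_Suc)
  also have "\<dots> = measure_pmf.expectation (hist_law G \<omega> \<sigma> \<rho> (Suc n)) (\<lambda>l. f (l ! n))"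
    by (rule expect_hist_law)
  also have "\<dots> = measure_pmf.expectation (joint_law G \<omega> \<sigma> \<rho> n) f"
    unfolding eq[symmetric] by simp
  finally show ?thesis .
qed

lemma expect_sum_stage:
  fixes G :: "('w::finite, 'i::finite, 'j::finite) stochastic_game"
  shows "expect G \<omega> \<sigma> \<rho> (\<lambda>h. c * (\<Sum>m = 1..n. stage_payoff G m h)) =
    c * (\<Sum>m<n. measure_pmf.expectation (joint_law G \<omega> \<sigma> \<rho> m) (\<lambda>(w, i, j). payoff G w i j))"
proof -
  have fs: "finite (set_pmf (hist_law G \<omega> \<sigma> \<rho> k))" for k
    by (rule finite_subset[OF _ finite_lists_length_eq[of "UNIV :: ('w \<times> 'i \<times> 'j) set" k]])
      (auto dest: length_hist_law)
  define g where "g = (\<lambda>(w, i, j). payoff G w i j)"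
  have sum1: "(\<Sum>m = 1..n. stage_payoff G m h) = (\<Sum>m<n. g (h m))" for h
    by (induction n) (simp_all add: stage_payoff_def g_def)
  have "expect G \<omega> \<sigma> \<rho> (\<lambda>h. c * (\<Sum>m = 1..n. stage_payoff G m h)) =
      expect G \<omega> \<sigma> \<rho> (\<lambda>x. c * (\<Sum>m<n. g (map x [0..<n] ! m)))"
    unfolding sum1 by (intro arg_cong[where f = "expect G \<omega> \<sigma> \<rho>"] ext arg_cong[where f = "(*) c"] sum.cong) auto
  also have "\<dots> = measure_pmf.expectation (hist_law G \<omega> \<sigma> \<rho> n) (\<lambda>l. c * (\<Sum>m<n. g (l ! m)))"
    by (rule expect_hist_law)
  also have "measure_pmf.expectation (hist_law G \<omega> \<sigma> \<rho> n) (\<lambda>l. c * (\<Sum>m<n. g (l ! m))) =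
      c * measure_pmf.expectation (hist_law G \<omega> \<sigma> \<rho> n) (\<lambda>l. \<Sum>m<n. g (l ! m))"
    by simp
  also have "measure_pmf.expectation (hist_law G \<omega> \<sigma> \<rho> n) (\<lambda>l. \<Sum>m<n. g (l ! m)) =
      (\<Sum>m<n. measure_pmf.expectation (hist_law G \<omega> \<sigma> \<rho> n) (\<lambda>l. g (l ! m)))"
    by (rule Bochner_Integration.integral_sum) (rule integrable_measure_pmf_finite[OF fs])
  also have "c * (\<Sum>m<n. measure_pmf.expectation (hist_law G \<omega> \<sigma> \<rho> n) (\<lambda>l. g (l ! m))) =
      c * (\<Sum>m<n. measure_pmf.expectation (joint_law G \<omega> \<sigma> \<rho> m) g)"
  proof (intro arg_cong[where f = "(*) c"] sum.cong refl)
    fix m assume m: "m \<in> {..<n}"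
    have "measure_pmf.expectation (hist_law G \<omega> \<sigma> \<rho> n) (\<lambda>l. g (l ! m)) = expect G \<omega> \<sigma> \<rho> (\<lambda>x. g (map x [0..<n] ! m))"
      by (rule expect_hist_law[symmetric])
    also have "\<dots> = expect G \<omega> \<sigma> \<rho> (\<lambda>x. g (x m))" using m by simp
    also have "\<dots> = measure_pmf.expectation (joint_law G \<omega> \<sigma> \<rho> m) g" by (rule expect_stage)
    finally show "measure_pmf.expectation (hist_law G \<omega> \<sigma> \<rho> n) (\<lambda>l. g (l ! m)) = measure_pmf.expectation (joint_law G \<omega> \<sigma> \<rho> m) g" .
  qed
  finally show ?thesis unfolding g_def .
qed

lemma current_state_law_0: "current_state_law G \<omega> \<sigma> \<rho> 0 = return_pmf \<omega>"
  by (simp add: current_state_law_def bind_return_pmf state_law_def)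

lemma current_state_law_Suc:
  "current_state_law G \<omega> \<sigma> \<rho> (Suc n) = bind_pmf (joint_law G \<omega> \<sigma> \<rho> n) (\<lambda>(w, i, j). transition G w i j)"
  by (simp add: current_state_law_def joint_law_def bind_assoc_pmf bind_map_pmf state_law_def)

section \<open>Mixed actions as probability mass functions and expectations at one stage\<close>

definition vec_pmf :: "real^'i \<Rightarrow> 'i pmf" where
  "vec_pmf x = embed_pmf (($) x)"

lemma pmf_vec_pmf: "x \<in> mixed \<Longrightarrow> pmf (vec_pmf x) i = x$i"
  unfolding vec_pmf_def
  by (rule pmf_embed_pmf) (auto simp: mixed_nonneg nn_integral_count_space_finite sum_ennreal mixed_sum)

definition pmf_vec :: "'i pmf \<Rightarrow> real^'i" where
  "pmf_vec p = (\<chi> i. pmf p i)"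

lemma pmf_vec_mixed: "pmf_vec p \<in> mixed"
  by (auto simp: mixed_def pmf_vec_def sum_pmf_UNIV)

lemma pmf_vec_vec_pmf: "x \<in> mixed \<Longrightarrow> pmf_vec (vec_pmf x) = x"
  by (simp add: pmf_vec_def pmf_vec_pmf vec_eq_iff)

lemma expectation_pair_pmf:
  fixes p :: "'i::finite pmf" and q :: "'j::finite pmf"
  shows "measure_pmf.expectation (pair_pmf p q) (\<lambda>(i, j). A i j) = mexp A (pmf_vec p) (pmf_vec q)"
  by (subst integral_measure_pmf_real[of UNIV])
    (auto simp: mexp_def pmf_vec_def sum.cartesian_product pmf_pair case_prod_unfold mult.commute
      simp flip: UNIV_Times_UNIV intro!: sum.cong)

definition stage_expectation ::
  "('w::finite, 'i::finite, 'j::finite) stochastic_game \<Rightarrow> 'w \<Rightarrow> ('w, 'i, 'j, 'i) strategy \<Rightarrow> ('w, 'i, 'j, 'j) strategy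
    \<Rightarrow> nat \<Rightarrow> ('w \<Rightarrow> 'i \<Rightarrow> 'j \<Rightarrow> real) \<Rightarrow> real" where
  "stage_expectation G \<omega> \<sigma> \<rho> n F = measure_pmf.expectation (joint_law G \<omega> \<sigma> \<rho> n) (\<lambda>(w, i, j). F w i j)"

definition state_expectation ::
  "('w::finite, 'i::finite, 'j::finite) stochastic_game \<Rightarrow> 'w \<Rightarrow> ('w, 'i, 'j, 'i) strategy \<Rightarrow> ('w, 'i, 'j, 'j) strategy
    \<Rightarrow> nat \<Rightarrow> real^'w \<Rightarrow> real" where
  "state_expectation G \<omega> \<sigma> \<rho> n v = measure_pmf.expectation (current_state_law G \<omega> \<sigma> \<rho> n) (\<lambda>w. v$w)"

lemma state_expectation_sum:
  "state_expectation G \<omega> \<sigma> \<rho> n v = (\<Sum>w\<in>UNIV. v$w * pmf (current_state_law G \<omega> \<sigma> \<rho> n) w)"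
  unfolding state_expectation_def by (rule integral_measure_pmf_real) auto

lemma state_expectation_0: "state_expectation G \<omega> \<sigma> \<rho> 0 v = v$\<omega>"
  by (simp add: state_expectation_def current_state_law_0)

lemma state_expectation_diff:
  "state_expectation G \<omega> \<sigma> \<rho> n (u - v) = state_expectation G \<omega> \<sigma> \<rho> n u - state_expectation G \<omega> \<sigma> \<rho> n v"
  and state_expectation_scaleR:
  "state_expectation G \<omega> \<sigma> \<rho> n (c *\<^sub>R v) = c * state_expectation G \<omega> \<sigma> \<rho> n v"
  by (simp_all add: state_expectation_sum algebra_simps sum_subtractf sum_distrib_left)

lemma expectation_abs_le:
  fixes p :: "'a::finite pmf" and f :: "'a \<Rightarrow> real"
  assumes "\<And>a. \<bar>f a\<bar> \<le> c"
  shows "\<bar>measure_pmf.expectation p f\<bar> \<le> c"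
proof -
  have "\<bar>\<Sum>a\<in>UNIV. f a * pmf p a\<bar> \<le> (\<Sum>a\<in>UNIV. \<bar>f a * pmf p a\<bar>)" by (rule sum_abs)
  also have "\<dots> \<le> (\<Sum>a\<in>UNIV. c * pmf p a)"
    by (intro sum_mono) (auto simp: abs_mult assms intro: mult_right_mono)
  also have "\<dots> = c" by (simp add: sum_distrib_left[symmetric] sum_pmf_UNIV)
  finally show ?thesis by (subst integral_measure_pmf_real[of UNIV]) auto
qed

lemma state_expectation_abs_le: "(\<And>w. \<bar>v$w\<bar> \<le> c) \<Longrightarrow> \<bar>state_expectation G \<omega> \<sigma> \<rho> n v\<bar> \<le> c"
  unfolding state_expectation_def by (rule expectation_abs_le)

lemma stage_expectation_abs_le: "(\<And>w i j. \<bar>F w i j\<bar> \<le> c) \<Longrightarrow> \<bar>stage_expectation G \<omega> \<sigma> \<rho> n F\<bar> \<le> c"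
  unfolding stage_expectation_def by (rule expectation_abs_le) auto

lemma stage_expectation_sum:
  "stage_expectation G \<omega> \<sigma> \<rho> n F = (\<Sum>(w, i, j)\<in>UNIV. F w i j * pmf (joint_law G \<omega> \<sigma> \<rho> n) (w, i, j))"
  unfolding stage_expectation_def by (subst integral_measure_pmf_real[of UNIV]) (auto simp: case_prod_unfold)

lemma stage_expectation_linear:
  "stage_expectation G \<omega> \<sigma> \<rho> n (\<lambda>w i j. a * F w i j + b * F' w i j) =
    a * stage_expectation G \<omega> \<sigma> \<rho> n F + b * stage_expectation G \<omega> \<sigma> \<rho> n F'"
  by (simp add: stage_expectation_sum case_prod_unfold algebra_simps sum.distrib sum_distrib_left)

lemma stage_expectation_minus:
  "stage_expectation G \<omega> \<sigma> \<rho> n (\<lambda>w i j. - F w i j) = - stage_expectation G \<omega> \<sigma> \<rho> n F"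
  using stage_expectation_linear[of G \<omega> \<sigma> \<rho> n "-1" F 0 F] by simp

lemma state_expectation_Suc:
  "state_expectation G \<omega> \<sigma> \<rho> (Suc n) v = stage_expectation G \<omega> \<sigma> \<rho> n (nextv G v)"
proof -
  have "state_expectation G \<omega> \<sigma> \<rho> (Suc n) v =
      (\<Sum>z\<in>UNIV. pmf (joint_law G \<omega> \<sigma> \<rho> n) z *\<^sub>R measure_pmf.expectation (case z of (w, i, j) \<Rightarrow> transition G w i j) (\<lambda>w. v$w))"
    unfolding state_expectation_def current_state_law_Suc by (rule pmf_expectation_bind) auto
  moreover have "measure_pmf.expectation (transition G w i j) (\<lambda>w. v$w) = nextv G v w i j" for w i j
    by (subst integral_measure_pmf_real[of UNIV]) (auto simp: nextv_def mult.commute)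
  ultimately show ?thesis unfolding stage_expectation_sum by (simp add: case_prod_unfold mult.commute)
qed

text \<open>Given the history, the state is drawn first and the actions are then independent, so an
  inequality at each history and state can be averaged. Hypotheses of this kind hold against
  opponents with arbitrary history dependence.\<close>

lemma stage_expectation_ge:
  assumes "\<And>h w. length h = n \<Longrightarrow> c$w \<le> mexp (F w) (pmf_vec (\<sigma> h w)) (pmf_vec (\<rho> h w))"
  shows "state_expectation G \<omega> \<sigma> \<rho> n c \<le> stage_expectation G \<omega> \<sigma> \<rho> n F"
proof -
  define L where "L = {l :: ('a \<times> 'b \<times> 'c) list. length l = n}"
  have fL: "finite L" unfolding L_def using finite_lists_length_eq[of "UNIV :: ('a \<times> 'b \<times> 'c) set" n] by simp
  have sL: "set_pmf (hist_law G \<omega> \<sigma> \<rho> n) \<subseteq> L" unfolding L_def by (auto dest: length_hist_law)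
  define F' where "F' = (\<lambda>(w, i, j). F w i j)"
  have le: "measure_pmf.expectation (state_law G \<omega> h) (\<lambda>w. c$w) \<le> measure_pmf.expectation (stage_law G \<omega> \<sigma> \<rho> h) F'"
    if h: "h \<in> L" for h
  proof -
    have "measure_pmf.expectation (state_law G \<omega> h) (\<lambda>w. c$w) = (\<Sum>w\<in>UNIV. c$w * pmf (state_law G \<omega> h) w)"
      by (rule integral_measure_pmf_real) auto
    also have "\<dots> \<le> (\<Sum>w\<in>UNIV. mexp (F w) (pmf_vec (\<sigma> h w)) (pmf_vec (\<rho> h w)) * pmf (state_law G \<omega> h) w)"
      by (intro sum_mono mult_right_mono assms) (use h in \<open>auto simp: L_def\<close>)
    also have "\<dots> = (\<Sum>w\<in>UNIV. pmf (state_law G \<omega> h) w *\<^sub>R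
        measure_pmf.expectation (map_pmf (\<lambda>(i, j). (w, i, j)) (pair_pmf (\<sigma> h w) (\<rho> h w))) F')"
    proof (intro sum.cong refl)
      fix w
      have "measure_pmf.expectation (map_pmf (\<lambda>(i, j). (w, i, j)) (pair_pmf (\<sigma> h w) (\<rho> h w))) F' =
          measure_pmf.expectation (pair_pmf (\<sigma> h w) (\<rho> h w)) (\<lambda>(i, j). F w i j)"
        by (simp add: F'_def case_prod_unfold)
      then show "mexp (F w) (pmf_vec (\<sigma> h w)) (pmf_vec (\<rho> h w)) * pmf (state_law G \<omega> h) w =
          pmf (state_law G \<omega> h) w *\<^sub>R
          measure_pmf.expectation (map_pmf (\<lambda>(i, j). (w, i, j)) (pair_pmf (\<sigma> h w) (\<rho> h w))) F'"
        by (simp add: expectation_pair_pmf)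
    qed
    also have "\<dots> = measure_pmf.expectation (stage_law G \<omega> \<sigma> \<rho> h) F'"
      unfolding stage_law_def by (rule pmf_expectation_bind[symmetric]) auto
    finally show ?thesis .
  qed
  have "state_expectation G \<omega> \<sigma> \<rho> n c =
      (\<Sum>h\<in>L. pmf (hist_law G \<omega> \<sigma> \<rho> n) h *\<^sub>R measure_pmf.expectation (state_law G \<omega> h) (\<lambda>w. c$w))"
    unfolding state_expectation_def current_state_law_def by (rule pmf_expectation_bind[OF fL _ sL]) auto
  also have "\<dots> \<le> (\<Sum>h\<in>L. pmf (hist_law G \<omega> \<sigma> \<rho> n) h *\<^sub>R measure_pmf.expectation (stage_law G \<omega> \<sigma> \<rho> h) F')"
    using le by (intro sum_mono) (auto intro: mult_left_mono)
  also have "\<dots> = stage_expectation G \<omega> \<sigma> \<rho> n F"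
    unfolding stage_expectation_def joint_law_def F'_def by (rule pmf_expectation_bind[OF fL _ sL, symmetric]) auto
  finally show ?thesis .
qed

lemma stage_expectation_le:
  assumes "\<And>h w. length h = n \<Longrightarrow> mexp (F w) (pmf_vec (\<sigma> h w)) (pmf_vec (\<rho> h w)) \<le> c$w"
  shows "stage_expectation G \<omega> \<sigma> \<rho> n F \<le> state_expectation G \<omega> \<sigma> \<rho> n c"
proof -
  have "mexp (\<lambda>i j. - F w i j) x y = - mexp (F w) x y" for w x y
    using mexp_cmult[of "-1" "F w" x y] by simp
  then have "state_expectation G \<omega> \<sigma> \<rho> n (- c) \<le> stage_expectation G \<omega> \<sigma> \<rho> n (\<lambda>w i j. - F w i j)"
    using assms by (intro stage_expectation_ge) auto
  moreover have "state_expectation G \<omega> \<sigma> \<rho> n (- c) = - state_expectation G \<omega> \<sigma> \<rho> n c"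
    using state_expectation_scaleR[of G \<omega> \<sigma> \<rho> n "-1" c] by simp
  ultimately show ?thesis by (simp add: stage_expectation_minus)
qed

lemma stage_expectation_shapley_mat:
  "stage_expectation G \<omega> \<sigma> \<rho> n (shapley_mat G l v) =
    l * stage_expectation G \<omega> \<sigma> \<rho> n (payoff G) + (1 - l) * state_expectation G \<omega> \<sigma> \<rho> (Suc n) v"
  unfolding shapley_mat_def stage_expectation_linear state_expectation_Suc ..

lemma opt1_stage:
  assumes "opt1 G l v x" "\<And>h w. length h = n \<Longrightarrow> \<sigma> h w = vec_pmf (x$w)"
  shows "state_expectation G \<omega> \<sigma> \<rho> n v \<le>
    l * stage_expectation G \<omega> \<sigma> \<rho> n (payoff G) + (1 - l) * state_expectation G \<omega> \<sigma> \<rho> (Suc n) v"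
  unfolding stage_expectation_shapley_mat[symmetric]
  using assms by (intro stage_expectation_ge) (auto simp: opt1_def pmf_vec_vec_pmf pmf_vec_mixed)

lemma opt2_stage:
  assumes "opt2 G l v y" "\<And>h w. length h = n \<Longrightarrow> \<rho> h w = vec_pmf (y$w)"
  shows "l * stage_expectation G \<omega> \<sigma> \<rho> n (payoff G) + (1 - l) * state_expectation G \<omega> \<sigma> \<rho> (Suc n) v
    \<le> state_expectation G \<omega> \<sigma> \<rho> n v"
  unfolding stage_expectation_shapley_mat[symmetric]
  using assms by (intro stage_expectation_le) (auto simp: opt2_def pmf_vec_vec_pmf pmf_vec_mixed)

lemma balanced_stage:
  assumes "\<And>w. x$w \<in> mixed" "\<And>w. y$w \<in> mixed" "\<And>w. mexp (nextv G u w) (x$w) (y$w) = u'$w"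
    and "\<And>h w. length h = n \<Longrightarrow> \<sigma> h w = vec_pmf (x$w)" "\<And>h w. length h = n \<Longrightarrow> \<rho> h w = vec_pmf (y$w)"
  shows "state_expectation G \<omega> \<sigma> \<rho> (Suc n) u = state_expectation G \<omega> \<sigma> \<rho> n u'"
  unfolding state_expectation_Suc
  using assms by (intro antisym stage_expectation_le stage_expectation_ge) (auto simp: pmf_vec_vec_pmf)

section \<open>Block strategies\<close>

text \<open>With N = n - k stages left and l N = 1 + \<theta>, the inequality of stage k times N
  becomes N V k \<le> \<gamma> k + (N - 1) V' k, up to 2 C \<theta>. The factor N - 1 is the N of
  the next stage, so the sum telescopes; \<open>d k\<close> is the price for replacing the
  continuation value \<open>V' k\<close> by \<open>V (Suc k)\<close> when the discount factor
  changes.\<close>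

lemma payoff_sum_ge:
  fixes V V' l \<gamma> d :: "nat \<Rightarrow> real"
  assumes T: "T < n"
    and V: "\<And>k. k \<le> T \<Longrightarrow> V k \<le> l k * \<gamma> k + (1 - l k) * V' k"
    and C: "\<And>k. k \<le> T \<Longrightarrow> \<bar>\<gamma> k\<bar> \<le> C" "\<And>k. k \<le> T \<Longrightarrow> \<bar>V' k\<bar> \<le> C"
    and l: "\<And>k. k \<le> T \<Longrightarrow> 1 \<le> l k * (real n - real k)" "\<And>k. k \<le> T \<Longrightarrow> l k * (real n - real k) \<le> 1 + \<eta>"
    and d: "\<And>k. k < T \<Longrightarrow> V' k \<le> V (Suc k) + d k" "\<And>k. k < T \<Longrightarrow> 0 \<le> d k"
  shows "real n * V 0 - (real n - real (Suc T)) * V' T - 2 * C * \<eta> * real (Suc T) - real n * (\<Sum>k<T. d k)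
    \<le> (\<Sum>k<Suc T. \<gamma> k)"
proof -
  have step: "(real n - real k) * V k - (real n - real k - 1) * V' k - 2 * C * \<eta> \<le> \<gamma> k" if k: "k \<le> T" for k
  proof -
    define N where "N = real n - real k"
    have N: "0 \<le> N" unfolding N_def using k T by simp
    define \<theta> where "\<theta> = l k * N - 1"
    have \<theta>: "0 \<le> \<theta>" "\<theta> \<le> \<eta>" using l[OF k] unfolding \<theta>_def N_def by auto
    have "N * V k \<le> N * (l k * \<gamma> k + (1 - l k) * V' k)" by (intro mult_left_mono V k N)
    also have "\<dots> = (1 + \<theta>) * \<gamma> k + (N - 1 - \<theta>) * V' k" unfolding \<theta>_def by (simp add: algebra_simps)
    finally have "N * V k - (N - 1) * V' k \<le> \<gamma> k + \<theta> * (\<gamma> k - V' k)" by (simp add: algebra_simps)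
    also have "\<theta> * (\<gamma> k - V' k) \<le> \<eta> * (2 * C)"
    proof -
      have C': "\<gamma> k - V' k \<le> 2 * C" "0 \<le> 2 * C" using C[OF k] by auto
      have "\<theta> * (\<gamma> k - V' k) \<le> \<theta> * (2 * C)" using \<theta> C' by (intro mult_left_mono) auto
      also have "\<dots> \<le> \<eta> * (2 * C)" using \<theta> C' by (intro mult_right_mono) auto
      finally show ?thesis .
    qed
    finally show ?thesis unfolding N_def by (simp add: algebra_simps)
  qed
  show ?thesis
    using T V C l d step
  proof (induction T)
    case 0
    then show ?case by (simp add: algebra_simps)
  next
    case (Suc T)
    have IH: "real n * V 0 - (real n - real (Suc T)) * V' T - 2 * C * \<eta> * real (Suc T) - real n * (\<Sum>k<T. d k)
        \<le> (\<Sum>k<Suc T. \<gamma> k)"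
      by (rule Suc.IH) (use Suc.prems in auto)
    define N where "N = real n - real (Suc T)"
    have N: "0 \<le> N" "N \<le> real n" unfolding N_def using Suc.prems(1) by auto
    have "N * V' T \<le> N * (V (Suc T) + d T)" using Suc.prems(7)[of T] N by (intro mult_left_mono) auto
    moreover have "N * d T \<le> real n * d T" using Suc.prems(8)[of T] N by (intro mult_right_mono) auto
    ultimately have "N * V' T \<le> N * V (Suc T) + real n * d T" by (simp add: algebra_simps)
    moreover have "N * V (Suc T) - (N - 1) * V' (Suc T) - 2 * C * \<eta> \<le> \<gamma> (Suc T)"
      using Suc.prems(9)[of "Suc T"] unfolding N_def by simp
    moreover have "real n * V 0 - N * V' T - 2 * C * \<eta> * real (Suc T) - real n * (\<Sum>k<T. d k) \<le> (\<Sum>k<Suc T. \<gamma> k)"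
      using IH unfolding N_def .
    moreover have "real n - real (Suc (Suc T)) = N - 1" unfolding N_def by simp
    moreover have "2 * C * \<eta> * real (Suc (Suc T)) = 2 * C * \<eta> * real (Suc T) + 2 * C * \<eta>" by (simp add: algebra_simps)
    moreover have "real n * (\<Sum>k<Suc T. d k) = real n * (\<Sum>k<T. d k) + real n * d T" by (simp add: algebra_simps)
    moreover have "(\<Sum>k<Suc (Suc T). \<gamma> k) = (\<Sum>k<Suc T. \<gamma> k) + \<gamma> (Suc T)" by simp
    ultimately show ?case by (simp del: sum.lessThan_Suc of_nat_Suc)
  qed
qed

lemma drift_le:
  fixes u u' c d :: "nat \<Rightarrow> real"
  assumes "\<And>k. k \<le> T \<Longrightarrow> \<bar>u' k - u k\<bar> \<le> c k" "\<And>k. k < T \<Longrightarrow> \<bar>u (Suc k) - u' k\<bar> \<le> d k"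
  shows "\<bar>u' T - u 0\<bar> \<le> (\<Sum>k\<le>T. c k) + (\<Sum>k<T. d k)"
  using assms
proof (induction T)
  case (Suc T)
  have "\<bar>u' T - u 0\<bar> \<le> (\<Sum>k\<le>T. c k) + (\<Sum>k<T. d k)" by (rule Suc.IH) (use Suc.prems in auto)
  then show ?case using Suc.prems(1)[of "Suc T"] Suc.prems(2)[of T] by simp
qed simp

text \<open>Index k stands for stage k + 1, so n - k counts the stages left, this one included.
  \<open>b k\<close> is the block of the stage, and l, x, y, \<pi> are indexed by blocks. Nothing is
  required once fewer than \<theta> n stages are left.\<close>

definition schedule ::
  "('w::finite, 'i::finite, 'j::finite) stochastic_game \<Rightarrow> real^'w \<Rightarrow> real \<Rightarrow> real \<Rightarrow> real \<Rightarrow> nat \<Rightarrow> nat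
    \<Rightarrow> (nat \<Rightarrow> nat) \<Rightarrow> (nat \<Rightarrow> real) \<Rightarrow> (nat \<Rightarrow> real^'i^'w) \<Rightarrow> (nat \<Rightarrow> real^'j^'w) \<Rightarrow> (nat \<Rightarrow> real^'w) \<Rightarrow> bool" where
  "schedule G V \<theta> \<eta> \<delta> K n b l x y \<pi> \<longleftrightarrow> (\<forall>k<n. \<theta> * real n \<le> real n - real k \<longrightarrow>
    (\<forall>k'<k. b k' \<le> b k) \<and> b k \<le> K \<and>
    1 \<le> l (b k) * (real n - real k) \<and> l (b k) * (real n - real k) \<le> 1 + \<eta> \<and>
    balanced_pair G \<delta> (l (b k)) (x (b k)) (y (b k)) (\<pi> (b k)) \<and>
    (\<forall>w. \<bar>discounted_value G (l (b k)) $ w - V$w\<bar> \<le> \<delta>))"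

text \<open>Stages are grouped into blocks according to the integer part of the logarithm of
  \<open>n / (n - k)\<close>; the number of blocks before the last \<open>\<theta> n\<close> stages does not depend on \<open>n\<close>.\<close>

lemma ex_schedule:
  fixes G :: "('w::finite, 'i::finite, 'j::finite) stochastic_game" and V :: "real^'w"
  assumes V: "\<And>w. ((\<lambda>l. discounted_value G l $ w) \<longlongrightarrow> V$w) (at_right 0)"
    and \<eta>: "0 < \<eta>" and \<theta>: "0 < \<theta>"
  shows "\<exists>K. \<forall>\<delta>>0. \<exists>n0. \<forall>n\<ge>n0. \<exists>b l x y \<pi>. schedule G V \<theta> \<eta> \<delta> K n b l x y \<pi>"
proof -
  \<comment> \<open>One factor a is lost by rounding the logarithm in \<open>b\<close>, another by
    choosing l in [s, a s]; together they amount to 1 + \<open>\<eta>\<close>.\<close>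
  define a where "a = sqrt (1 + \<eta>)"
  have a: "1 < a" "a * a = 1 + \<eta>" unfolding a_def using \<eta> by auto
  define K where "K = nat \<lceil>log a (1 / \<theta>)\<rceil>"
  let ?v = "discounted_value G"
  show ?thesis
  proof (rule exI[of _ K], intro allI impI)
    fix \<delta> :: real assume \<delta>: "0 < \<delta>"
    obtain s0 where s0: "0 < s0" "\<And>s. 0 < s \<Longrightarrow> s \<le> s0 \<Longrightarrow>
      \<exists>l x y \<pi>. s \<le> l \<and> l \<le> a * s \<and> balanced_pair G \<delta> l x y \<pi>"
      using ex_balanced_pair[OF a(1) \<delta>, of G] by blast
    have "\<forall>\<^sub>F l in at_right 0. \<forall>w. \<bar>?v l $ w - V$w\<bar> < \<delta>"
      by (rule eventually_all_finite) (use tendstoD[OF V \<delta>] in \<open>simp add: dist_real_def\<close>)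
    then obtain l0 where l0: "l0 > 0" "\<And>l w. 0 < l \<Longrightarrow> l < l0 \<Longrightarrow> \<bar>?v l $ w - V$w\<bar> < \<delta>"
      unfolding eventually_at_right_field by auto
    define m where "m = min s0 (l0 / 2)"
    have m: "0 < m" unfolding m_def using s0 l0 by simp
    \<comment> \<open>Every discount factor of the blocks up to K is at most a ^ (K + 2) / n; for
      these n it is at most m, hence in the range of both smallness conditions.\<close>
    define n0 where "n0 = Suc (nat \<lceil>a ^ (K + 2) / m\<rceil>)"
    have "\<exists>b l x y \<pi>. schedule G V \<theta> \<eta> \<delta> K n b l x y \<pi>" if n: "n \<ge> n0" for n
    proof -
      have n1: "0 < real n" using n unfolding n0_def by simp
      have "a ^ (K + 2) / m \<le> real n0" unfolding n0_def by linarith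
      also have "\<dots> \<le> real n" using n by simp
      finally have nm: "a ^ (K + 2) / real n \<le> m" using m n1 by (simp add: field_simps)
      have pw: "a ^ i / real n \<le> m" if "i \<le> K + 2" for i
      proof -
        have "a ^ i \<le> a ^ (K + 2)" using a that by (intro power_increasing) auto
        then have "a ^ i / real n \<le> a ^ (K + 2) / real n" using n1 by (intro divide_right_mono) auto
        then show ?thesis using nm by simp
      qed
      \<comment> \<open>In block c the ratio n / (n - k) is at least a ^ c and below a ^ (c + 1).
        Starting the search for l at a ^ (c + 1) / n therefore ensures l (n - k) \<ge> 1 throughout
        the block.\<close>
      define P where "P c l x y \<pi> \<longleftrightarrow> a ^ (c + 1) / real n \<le> l \<and> l \<le> a * (a ^ (c + 1) / real n) \<and>
        balanced_pair G \<delta> l x y \<pi>" for c :: nat and l x y \<pi>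
      have "\<exists>l x y \<pi>. P c l x y \<pi>" if "c \<le> K" for c
        unfolding P_def
      proof (rule s0(2))
        show "0 < a ^ (c + 1) / real n" using a n1 by simp
        show "a ^ (c + 1) / real n \<le> s0" using pw[of "c + 1"] that unfolding m_def by simp
      qed
      then have "\<forall>c. \<exists>l x y \<pi>. c \<le> K \<longrightarrow> P c l x y \<pi>" by blast
      then obtain l x y \<pi> where lxy: "\<And>c. c \<le> K \<Longrightarrow> P c (l c) (x c) (y c) (\<pi> c)" by metis
      define b where "b k = nat \<lfloor>log a (real n / (real n - real k))\<rfloor>" for k
      have "(\<forall>k'<k. b k' \<le> b k) \<and> b k \<le> K \<and>
        1 \<le> l (b k) * (real n - real k) \<and> l (b k) * (real n - real k) \<le> 1 + \<eta> \<and>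
        balanced_pair G \<delta> (l (b k)) (x (b k)) (y (b k)) (\<pi> (b k)) \<and>
        (\<forall>w. \<bar>?v (l (b k)) $ w - V$w\<bar> \<le> \<delta>)"
        if k: "k < n" "\<theta> * real n \<le> real n - real k" for k
      proof -
        define N where "N = real n - real k"
        have N: "0 < N" "N \<le> real n" unfolding N_def using k by auto
        have mono: "b k' \<le> b k" if "k' < k" for k'
          unfolding b_def using that k a n1 by (intro nat_mono floor_mono log_mono divide_left_mono) auto
        have nN: "1 \<le> real n / N" using N by simp
        have lg: "0 \<le> log a (real n / N)" using a nN by simp
        have "real n / N \<le> 1 / \<theta>" using k(2) N \<theta> unfolding N_def[symmetric] by (simp add: field_simps)
        then have "log a (real n / N) \<le> log a (1 / \<theta>)" using a nN by (intro log_mono) auto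
        then have bK: "b k \<le> K" unfolding b_def K_def N_def by (intro nat_mono) linarith
        have rb: "real (b k) = of_int \<lfloor>log a (real n / N)\<rfloor>" unfolding b_def N_def[symmetric] using lg by simp
        have "real (b k) \<le> log a (real n / N)" unfolding rb by linarith
        moreover have "log a (real n / N) < real (b k + 1)" using rb by (simp add: of_nat_Suc) linarith
        ultimately have "a powr real (b k) \<le> real n / N" "real n / N < a powr real (b k + 1)"
          using a nN by (auto simp: le_log_iff log_less_iff)
        then have "a ^ b k \<le> real n / N" "real n / N < a ^ (b k + 1)"
          using powr_realpow[of a] a by (simp_all only: order.strict_trans[OF zero_less_one])
        then have ab: "a ^ b k * N \<le> real n" "real n \<le> a ^ (b k + 1) * N" using N by (simp_all add: field_simps)
        have Pb: "a ^ (b k + 1) / real n \<le> l (b k)" "l (b k) \<le> a * (a ^ (b k + 1) / real n)"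
          "balanced_pair G \<delta> (l (b k)) (x (b k)) (y (b k)) (\<pi> (b k))"
          using lxy[OF bK] unfolding P_def by simp_all
        have "1 \<le> a ^ (b k + 1) / real n * N" using ab(2) n1 by (simp add: field_simps)
        also have "\<dots> \<le> l (b k) * N" using Pb(1) N by (intro mult_right_mono) auto
        finally have l1: "1 \<le> l (b k) * N" .
        have "l (b k) * N \<le> a * (a ^ (b k + 1) / real n) * N" using Pb(2) N by (intro mult_right_mono) auto
        also have "\<dots> = a * a * (a ^ b k * N / real n)" by simp
        also have "\<dots> \<le> a * a * 1" using ab(1) n1 a \<eta> by (intro mult_left_mono) auto
        finally have l2: "l (b k) * N \<le> 1 + \<eta>" using a(2) by simp
        have "0 < a ^ (b k + 1) / real n" using a n1 by simp
        then have lpos: "0 < l (b k)" using Pb(1) by linarith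
        have "l (b k) \<le> a ^ (b k + 2) / real n" using Pb(2) by simp
        also have "\<dots> \<le> m" by (rule pw) (use bK in simp)
        also have "m < l0" unfolding m_def using l0(1) by simp
        finally have "\<bar>?v (l (b k)) $ w - V$w\<bar> \<le> \<delta>" for w using l0(2)[OF lpos, of w] by simp
        then show ?thesis using mono bK l1 l2 Pb(3) unfolding N_def by simp
      qed
      then show ?thesis unfolding schedule_def by blast
    qed
    then show "\<exists>n0. \<forall>n\<ge>n0. \<exists>b l x y \<pi>. schedule G V \<theta> \<eta> \<delta> K n b l x y \<pi>" by blast
  qed
qed

section \<open>Payoff and drift estimates for the block strategies\<close>

lemma payoff_sums_bound:
  fixes G :: "('w::finite, 'i::finite, 'j::finite) stochastic_game"
  shows "\<bar>\<Sum>k\<in>A. stage_expectation G \<omega> \<sigma> \<rho> k (payoff G)\<bar> \<le> real (card A) * payoff_bound G"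
proof -
  have "\<bar>\<Sum>k\<in>A. stage_expectation G \<omega> \<sigma> \<rho> k (payoff G)\<bar> \<le> (\<Sum>k\<in>A. \<bar>stage_expectation G \<omega> \<sigma> \<rho> k (payoff G)\<bar>)"
    by (rule sum_abs)
  also have "\<dots> \<le> (\<Sum>k\<in>A. payoff_bound G)"
    by (intro sum_mono stage_expectation_abs_le payoff_le_bound)
  finally show ?thesis by simp
qed

lemma sum_jumps_le:
  fixes b :: "nat \<Rightarrow> nat"
  assumes "b T \<le> K" "0 \<le> c"
  shows "(\<Sum>k<T. c * (real (b (Suc k)) - real (b k))) \<le> c * real K"
proof -
  have "(\<Sum>k<T. c * (real (b (Suc k)) - real (b k))) = c * (real (b T) - real (b 0))"
    unfolding sum_distrib_left[symmetric] by (subst sum_lessThan_telescope) simp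
  also have "\<dots> \<le> c * real K" using assms by (intro mult_left_mono) auto
  finally show ?thesis .
qed

text \<open>The telescoped bounds say that the first T payoffs add up to n V minus n - T times the
  expected value at that time, one inequality for each player. For T near n the subtracted term is
  negligible, which gives the guarantees. For the pair both inequalities hold, and since the
  expected value stays near V, the sum is near T V.\<close>

lemma block_strategies:
  fixes G :: "('w::finite, 'i::finite, 'j::finite) stochastic_game" and V :: "real^'w"
  assumes V: "\<And>w. ((\<lambda>l. discounted_value G l $ w) \<longlongrightarrow> V$w) (at_right 0)" and e: "0 < e"
  shows "\<exists>n0. \<forall>n\<ge>n0. \<exists>\<sigma> \<rho>. markov \<sigma> \<and> markov \<rho> \<and>
    (\<forall>\<rho>' \<omega>. real n * (V$\<omega> - e) \<le> (\<Sum>k<n. stage_expectation G \<omega> \<sigma> \<rho>' k (payoff G))) \<and>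
    (\<forall>\<sigma>' \<omega>. (\<Sum>k<n. stage_expectation G \<omega> \<sigma>' \<rho> k (payoff G)) \<le> real n * (V$\<omega> + e)) \<and>
    (\<forall>\<omega> T. real T \<le> (1 - e) * real n \<longrightarrow>
      \<bar>(\<Sum>k<T. stage_expectation G \<omega> \<sigma> \<rho> k (payoff G)) - real T * V$\<omega>\<bar> \<le> e * real n)"
proof -
  let ?v = "discounted_value G"
  define C where "C = payoff_bound G + 1"
  have C: "1 \<le> C" unfolding C_def using payoff_bound_nonneg[of G] by simp
  \<comment> \<open>The error budget: the mismatch between l and the stages left costs at most 2 C
    \<open>\<eta>\<close> n = e n / 5; the final stages cost e n / 10 in payoffs and e n / 10 in
    continuation value. The bound \<open>\<theta>\<close> \<le> e puts the first (1 - e) n stages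
    into the scheduled range.\<close>
  define \<eta> where "\<eta> = e / (10 * C)"
  define \<theta> where "\<theta> = min (1 / 2) (min e (e / (10 * C)))"
  have \<eta>: "0 < \<eta>" "2 * C * \<eta> = e / 5" unfolding \<eta>_def using e C by auto
  have \<theta>: "0 < \<theta>" "\<theta> \<le> 1 / 2" "\<theta> \<le> e" "\<theta> \<le> e / (10 * C)" unfolding \<theta>_def using e C by auto
  have \<theta>C: "2 * C * \<theta> \<le> e / 5" using \<theta>(4) C by (simp add: field_simps)
  obtain K where K: "\<And>\<delta>. \<delta> > 0 \<Longrightarrow> \<exists>n0. \<forall>n\<ge>n0. \<exists>b l x y \<pi>. schedule G V \<theta> \<eta> \<delta> K n b l x y \<pi>"
    using ex_schedule[OF V \<eta>(1) \<theta>(1)] by blast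
  \<comment> \<open>Collects the multiples of \<open>\<delta>\<close>: 1 + 2 K from the payoff
    bounds and 3 + 4 K + (1 + \<open>\<eta>\<close>) / \<open>\<theta>\<close> from the
    drift.\<close>
  define D where "D = 4 + 6 * real K + (1 + \<eta>) / \<theta>"
  have D: "4 + 6 * real K \<le> D" unfolding D_def using \<eta> \<theta> by simp
  define \<delta> where "\<delta> = min 1 (e / (5 * D))"
  have D0: "0 < D" using D by linarith
  have \<delta>: "0 < \<delta>" "\<delta> \<le> 1" "\<delta> \<le> e / (5 * D)" unfolding \<delta>_def using e D0 by auto
  have \<delta>D: "\<delta> * D \<le> e / 5" using \<delta>(3) D0 by (simp add: field_simps)
  obtain n1 where n1: "\<And>n. n \<ge> n1 \<Longrightarrow> \<exists>b l x y \<pi>. schedule G V \<theta> \<eta> \<delta> K n b l x y \<pi>"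
    using K[OF \<delta>(1)] by blast
  define n0 where "n0 = max n1 2"
  have "\<exists>\<sigma> \<rho>. markov \<sigma> \<and> markov \<rho> \<and>
    (\<forall>\<rho>' \<omega>. real n * (V$\<omega> - e) \<le> (\<Sum>k<n. stage_expectation G \<omega> \<sigma> \<rho>' k (payoff G))) \<and>
    (\<forall>\<sigma>' \<omega>. (\<Sum>k<n. stage_expectation G \<omega> \<sigma>' \<rho> k (payoff G)) \<le> real n * (V$\<omega> + e)) \<and>
    (\<forall>\<omega> T. real T \<le> (1 - e) * real n \<longrightarrow>
      \<bar>(\<Sum>k<T. stage_expectation G \<omega> \<sigma> \<rho> k (payoff G)) - real T * V$\<omega>\<bar> \<le> e * real n)" if n: "n0 \<le> n" for n
  proof -
    have n2: "2 \<le> n" "n1 \<le> n" using n unfolding n0_def by auto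
    obtain b l x y \<pi> where sch: "schedule G V \<theta> \<eta> \<delta> K n b l x y \<pi>"
      using n1[OF n2(2)] by blast
    define S where "S k \<longleftrightarrow> k < n \<and> \<theta> * real n \<le> real n - real k" for k
    have S_le: "S k'" if "S k" "k' \<le> k" for k k' using that unfolding S_def by auto
    have mono: "b k' \<le> b k" if "S k" "k' < k" for k k' using sch that unfolding S_def schedule_def balanced_pair_def by blast
    have bK: "b k \<le> K" if "S k" for k using sch that unfolding S_def schedule_def balanced_pair_def by blast
    have lN: "1 \<le> l (b k) * (real n - real k)" "l (b k) * (real n - real k) \<le> 1 + \<eta>" if "S k" for k
      using sch that unfolding S_def schedule_def balanced_pair_def by blast+
    have opt: "opt1 G (l (b k)) (?v (l (b k))) (x (b k))" "opt2 G (l (b k)) (?v (l (b k))) (y (b k))" if "S k" for k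
      using sch that unfolding S_def schedule_def balanced_pair_def by blast+
    have vV: "\<bar>?v (l (b k)) $ w - V$w\<bar> \<le> \<delta>" and pi: "\<bar>\<pi> (b k) $ w\<bar> \<le> \<delta>" if "S k" for k w
      using sch that unfolding S_def schedule_def balanced_pair_def by blast+
    have bal: "mexp (nextv G (?v (l (b k)) - (1 - l (b k)) *\<^sub>R \<pi> (b k)) w) (x (b k) $ w) (y (b k) $ w)
        = (?v (l (b k)) - \<pi> (b k))$w" if "S k" for k w
      using sch that unfolding S_def schedule_def balanced_pair_def by blast
    have lpos: "0 < l (b k)" and lle: "l (b k) \<le> (1 + \<eta>) / (\<theta> * real n)" if "S k" for k
    proof -
      have N: "0 < real n - real k" "\<theta> * real n \<le> real n - real k" using that unfolding S_def by auto
      show "0 < l (b k)"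
      proof (rule ccontr)
        assume "\<not> 0 < l (b k)"
        then have "l (b k) * (real n - real k) \<le> 0" using N by (simp add: mult_le_0_iff)
        then show False using lN(1)[OF that] by simp
      qed
      then have "l (b k) * (\<theta> * real n) \<le> l (b k) * (real n - real k)" using N by (intro mult_left_mono) auto
      also have "\<dots> \<le> 1 + \<eta>" by (rule lN(2)[OF that])
      finally show "l (b k) \<le> (1 + \<eta>) / (\<theta> * real n)" using \<theta>(1) n2 by (simp add: pos_le_divide_eq)
    qed
    have VC: "\<bar>V$w\<bar> \<le> payoff_bound G" for w
    proof (rule tendsto_upperbound[OF tendsto_rabs[OF V]])
      have "\<forall>\<^sub>F l in at_right (0::real). l \<in> {0<..<1}" by (rule eventually_at_right_real) simp
      then show "\<forall>\<^sub>F l in at_right 0. \<bar>?v l $ w\<bar> \<le> payoff_bound G"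
        by eventually_elim (rule discounted_value, auto)
    qed simp
    have vC: "\<bar>?v (l (b k)) $ w\<bar> \<le> C" if "S k" for k w
      using vV[OF that, of w] VC[of w] \<delta>(2) unfolding C_def by linarith
    \<comment> \<open>A change of block raises the integer \<open>b\<close> by at least 1, so its
      cost c can be charged to the increment of \<open>b\<close>. These increments telescope to at
      most K.\<close>
    have jump: "\<bar>state_expectation G \<omega> \<sigma>' \<rho>' m (f (b k)) - state_expectation G \<omega> \<sigma>' \<rho>' m (f (b (Suc k)))\<bar>
        \<le> c * (real (b (Suc k)) - real (b k))"
      if "S (Suc k)" "\<And>w. \<bar>f (b k) $ w - f (b (Suc k)) $ w\<bar> \<le> c" "0 \<le> c" for f k c \<omega> \<sigma>' \<rho>' m
    proof (cases "b k = b (Suc k)")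
      case False
      then have "1 \<le> real (b (Suc k)) - real (b k)" using mono[OF that(1), of k] by simp
      then have "c * 1 \<le> c * (real (b (Suc k)) - real (b k))" using that(3) by (rule mult_left_mono)
      moreover have "\<bar>state_expectation G \<omega> \<sigma>' \<rho>' m (f (b k) - f (b (Suc k)))\<bar> \<le> c"
        by (rule state_expectation_abs_le) (use that(2) in simp)
      ultimately show ?thesis by (simp add: state_expectation_diff)
    qed simp
    \<comment> \<open>A history of length k precedes the stage with index k. Beyond the scheduled
      range the vector need not be a mixed action and \<open>vec_pmf\<close> is just some
      distribution; those stages are estimated by the payoff bound alone.\<close>
    define \<sigma> where "\<sigma> h w = vec_pmf (x (b (length h)) $ w)" for h :: "('w \<times> 'i \<times> 'j) list" and w
    define \<rho> where "\<rho> h w = vec_pmf (y (b (length h)) $ w)" for h :: "('w \<times> 'i \<times> 'j) list" and w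
    have "markov \<sigma>" unfolding markov_def \<sigma>_def
      by (rule exI[of _ "\<lambda>m w. vec_pmf (x (b (m - 1)) $ w)"]) simp
    have "markov \<rho>" unfolding markov_def \<rho>_def
      by (rule exI[of _ "\<lambda>m w. vec_pmf (y (b (m - 1)) $ w)"]) simp
    define d where "d k = 2 * \<delta> * (real (b (Suc k)) - real (b k))" for k
    have d0: "0 \<le> d k" if "S (Suc k)" for k
      unfolding d_def using mono[OF that, of k] \<delta>(1) by (intro mult_nonneg_nonneg) auto
    have dK: "real n * (\<Sum>k<T. d k) \<le> real n * (2 * \<delta> * real K)" if "S T" for T
      unfolding d_def using sum_jumps_le[of b T K, OF bK[OF that], of "2 * \<delta>"] \<delta>(1) by (intro mult_left_mono) auto
    have vdiff: "\<bar>?v (l (b k)) $ w - ?v (l (b (Suc k))) $ w\<bar> \<le> 2 * \<delta>" if "S (Suc k)" for k w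
      using vV[OF that, of w] vV[OF S_le[OF that, of k], of w] by linarith
    have vjump: "\<bar>state_expectation G \<omega> \<sigma>' \<rho>' m (?v (l (b k))) - state_expectation G \<omega> \<sigma>' \<rho>' m (?v (l (b (Suc k))))\<bar> \<le> d k"
      if "S (Suc k)" for k m \<omega> \<sigma>' \<rho>'
      unfolding d_def using jump[OF that, of "\<lambda>c. ?v (l c)" "2 * \<delta>"] vdiff[OF that] \<delta>(1) by simp
    have \<eta>T: "2 * C * \<eta> * real (Suc T) \<le> e / 5 * real n" if "S T" for T
      unfolding \<eta>(2) using that e unfolding S_def by (intro mult_left_mono) auto
    have C\<gamma>: "\<bar>stage_expectation G \<omega> \<sigma>' \<rho>' k (payoff G)\<bar> \<le> C" for \<omega> \<sigma>' \<rho>' k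
    proof -
      have "\<bar>stage_expectation G \<omega> \<sigma>' \<rho>' k (payoff G)\<bar> \<le> payoff_bound G"
        by (rule stage_expectation_abs_le) (rule payoff_le_bound)
      then show ?thesis unfolding C_def by simp
    qed
    have lower: "real n * ?v (l (b 0)) $ \<omega> - (real n - real (Suc T)) * state_expectation G \<omega> \<sigma> \<rho>' (Suc T) (?v (l (b T)))
        - e / 5 * real n - real n * (2 * \<delta> * real K) \<le> (\<Sum>k<Suc T. stage_expectation G \<omega> \<sigma> \<rho>' k (payoff G))"
      if T: "S T" for T \<omega> \<rho>'
    proof -
      have Tn: "T < n" using T unfolding S_def by simp
      have "real n * state_expectation G \<omega> \<sigma> \<rho>' 0 (?v (l (b 0)))
          - (real n - real (Suc T)) * state_expectation G \<omega> \<sigma> \<rho>' (Suc T) (?v (l (b T)))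
          - 2 * C * \<eta> * real (Suc T) - real n * (\<Sum>k<T. d k)
        \<le> (\<Sum>k<Suc T. stage_expectation G \<omega> \<sigma> \<rho>' k (payoff G))"
      proof (rule payoff_sum_ge[OF Tn, where l = "\<lambda>k. l (b k)" and V = "\<lambda>k. state_expectation G \<omega> \<sigma> \<rho>' k (?v (l (b k)))"
            and V' = "\<lambda>k. state_expectation G \<omega> \<sigma> \<rho>' (Suc k) (?v (l (b k)))"])
        fix k assume "k \<le> T"
        then have k: "S k" using S_le[OF T] by simp
        show "state_expectation G \<omega> \<sigma> \<rho>' k (?v (l (b k))) \<le> l (b k) * stage_expectation G \<omega> \<sigma> \<rho>' k (payoff G) +
            (1 - l (b k)) * state_expectation G \<omega> \<sigma> \<rho>' (Suc k) (?v (l (b k)))"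
          by (rule opt1_stage[OF opt(1)[OF k]]) (simp add: \<sigma>_def)
        show "\<bar>state_expectation G \<omega> \<sigma> \<rho>' (Suc k) (?v (l (b k)))\<bar> \<le> C"
          by (rule state_expectation_abs_le) (rule vC[OF k])
        show "1 \<le> l (b k) * (real n - real k)" "l (b k) * (real n - real k) \<le> 1 + \<eta>" using lN[OF k] .
      next
        fix k assume "k < T"
        then have k: "S (Suc k)" using S_le[OF T] by simp
        show "state_expectation G \<omega> \<sigma> \<rho>' (Suc k) (?v (l (b k))) \<le> state_expectation G \<omega> \<sigma> \<rho>' (Suc k) (?v (l (b (Suc k)))) + d k"
          using vjump[OF k, of \<omega> \<sigma> \<rho>' "Suc k"] by linarith
        show "0 \<le> d k" by (rule d0[OF k])
      qed (rule C\<gamma>)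
      then show ?thesis using \<eta>T[OF T] dK[OF T] by (simp add: state_expectation_0)
    qed
    have upper: "(\<Sum>k<Suc T. stage_expectation G \<omega> \<sigma>' \<rho> k (payoff G)) \<le>
        real n * ?v (l (b 0)) $ \<omega> - (real n - real (Suc T)) * state_expectation G \<omega> \<sigma>' \<rho> (Suc T) (?v (l (b T)))
        + e / 5 * real n + real n * (2 * \<delta> * real K)"
      if T: "S T" for T \<omega> \<sigma>'
    proof -
      have Tn: "T < n" using T unfolding S_def by simp
      \<comment> \<open>The telescoping lemma for player 2, with payoffs and values negated.\<close>
      have "real n * - state_expectation G \<omega> \<sigma>' \<rho> 0 (?v (l (b 0)))
          - (real n - real (Suc T)) * - state_expectation G \<omega> \<sigma>' \<rho> (Suc T) (?v (l (b T)))
          - 2 * C * \<eta> * real (Suc T) - real n * (\<Sum>k<T. d k)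
        \<le> (\<Sum>k<Suc T. - stage_expectation G \<omega> \<sigma>' \<rho> k (payoff G))"
      proof (rule payoff_sum_ge[OF Tn, where l = "\<lambda>k. l (b k)" and V = "\<lambda>k. - state_expectation G \<omega> \<sigma>' \<rho> k (?v (l (b k)))"
            and V' = "\<lambda>k. - state_expectation G \<omega> \<sigma>' \<rho> (Suc k) (?v (l (b k)))"])
        fix k assume "k \<le> T"
        then have k: "S k" using S_le[OF T] by simp
        have "l (b k) * stage_expectation G \<omega> \<sigma>' \<rho> k (payoff G) +
            (1 - l (b k)) * state_expectation G \<omega> \<sigma>' \<rho> (Suc k) (?v (l (b k))) \<le> state_expectation G \<omega> \<sigma>' \<rho> k (?v (l (b k)))"
          by (rule opt2_stage[OF opt(2)[OF k]]) (simp add: \<rho>_def)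
        then show "- state_expectation G \<omega> \<sigma>' \<rho> k (?v (l (b k))) \<le> l (b k) * - stage_expectation G \<omega> \<sigma>' \<rho> k (payoff G) +
            (1 - l (b k)) * - state_expectation G \<omega> \<sigma>' \<rho> (Suc k) (?v (l (b k)))" by simp
        show "\<bar>- state_expectation G \<omega> \<sigma>' \<rho> (Suc k) (?v (l (b k)))\<bar> \<le> C"
          unfolding abs_minus_cancel by (rule state_expectation_abs_le) (rule vC[OF k])
        show "1 \<le> l (b k) * (real n - real k)" "l (b k) * (real n - real k) \<le> 1 + \<eta>" using lN[OF k] .
      next
        fix k assume "k < T"
        then have k: "S (Suc k)" using S_le[OF T] by simp
        show "- state_expectation G \<omega> \<sigma>' \<rho> (Suc k) (?v (l (b k))) \<le> - state_expectation G \<omega> \<sigma>' \<rho> (Suc k) (?v (l (b (Suc k)))) + d k"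
          using vjump[OF k, of \<omega> \<sigma>' \<rho> "Suc k"] by linarith
        show "0 \<le> d k" by (rule d0[OF k])
      qed (unfold abs_minus_cancel, rule C\<gamma>)
      then show ?thesis using \<eta>T[OF T] dK[OF T] by (simp add: state_expectation_0 sum_negf)
    qed
    have S0: "S 0" unfolding S_def using n2 \<theta> by (simp add: mult_left_le_one_le)
    have v0: "\<bar>real n * ?v (l (b 0)) $ \<omega> - real n * V$\<omega>\<bar> \<le> real n * \<delta>" for \<omega>
    proof -
      have "real n * \<bar>?v (l (b 0)) $ \<omega> - V$\<omega>\<bar> \<le> real n * \<delta>" by (intro mult_left_mono vV[OF S0]) simp
      then show ?thesis by (metis abs_mult abs_of_nat right_diff_distrib)
    qed
    have \<delta>K: "real n * \<delta> + real n * (2 * \<delta> * real K) \<le> real n * (e / 5)"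
    proof -
      have "\<delta> * (1 + 2 * real K) \<le> \<delta> * D" using D \<delta>(1) by (intro mult_left_mono) auto
      then have "real n * (\<delta> * (1 + 2 * real K)) \<le> real n * (e / 5)" using \<delta>D by (intro mult_left_mono) auto
      then show ?thesis by (simp add: algebra_simps)
    qed
    \<comment> \<open>The last index at which at least \<open>\<theta>\<close> n stages are
      left.\<close>
    define T0 where "T0 = nat \<lfloor>(1 - \<theta>) * real n\<rfloor>"
    have "0 \<le> (1 - \<theta>) * real n" using \<theta> by simp
    then have T0: "real T0 \<le> (1 - \<theta>) * real n" "(1 - \<theta>) * real n < real (Suc T0)" unfolding T0_def by linarith+
    have T0n: "real T0 < real n"
    proof -
      have "0 < \<theta> * real n" using \<theta>(1) n2 by simp
      then show ?thesis using T0(1) by (simp add: algebra_simps)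
    qed
    have ST0: "S T0" unfolding S_def using T0n T0(1) by (simp add: algebra_simps)
    have rest: "0 \<le> real n - real (Suc T0)" "C * (real n - real (Suc T0)) \<le> real n * (e / 10)"
    proof -
      show "0 \<le> real n - real (Suc T0)" using T0n by simp
      have "C * (real n - real (Suc T0)) \<le> C * (\<theta> * real n)" using T0(2) C by (intro mult_left_mono) (auto simp: algebra_simps)
      also have "\<dots> = real n * (2 * C * \<theta>) / 2" by simp
      also have "\<dots> \<le> real n * (e / 5) / 2" using \<theta>C by (intro divide_right_mono mult_left_mono) auto
      finally show "C * (real n - real (Suc T0)) \<le> real n * (e / 10)" by simp
    qed
    have tail: "\<bar>\<Sum>k\<in>{Suc T0..<n}. stage_expectation G \<omega> \<sigma>' \<rho>' k (payoff G)\<bar> \<le> real n * (e / 10)" for \<omega> \<sigma>' \<rho>'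
    proof -
      have "\<bar>\<Sum>k\<in>{Suc T0..<n}. stage_expectation G \<omega> \<sigma>' \<rho>' k (payoff G)\<bar> \<le> real (card {Suc T0..<n}) * payoff_bound G"
        by (rule payoff_sums_bound)
      also have "\<dots> = payoff_bound G * (real n - real (Suc T0))" using T0n by (simp add: of_nat_diff)
      also have "\<dots> \<le> C * (real n - real (Suc T0))" using rest(1) unfolding C_def by (intro mult_right_mono) auto
      finally show ?thesis using rest(2) by linarith
    qed
    have last: "\<bar>(real n - real (Suc T0)) * state_expectation G \<omega> \<sigma>' \<rho>' (Suc T0) (?v (l (b T0)))\<bar> \<le> real n * (e / 10)" for \<omega> \<sigma>' \<rho>'
    proof -
      have "\<bar>state_expectation G \<omega> \<sigma>' \<rho>' (Suc T0) (?v (l (b T0)))\<bar> \<le> C"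
        by (rule state_expectation_abs_le) (rule vC[OF ST0])
      then have "(real n - real (Suc T0)) * \<bar>state_expectation G \<omega> \<sigma>' \<rho>' (Suc T0) (?v (l (b T0)))\<bar> \<le> (real n - real (Suc T0)) * C"
        using rest(1) by (rule mult_left_mono)
      then show ?thesis using rest unfolding abs_mult by (simp add: mult.commute)
    qed
    have split: "(\<Sum>k<n. f k) = (\<Sum>k<Suc T0. f k) + (\<Sum>k\<in>{Suc T0..<n}. f k)" for f :: "nat \<Rightarrow> real"
      using sum.atLeastLessThan_concat[of 0 "Suc T0" n f] T0n by (simp add: atLeast0LessThan)
    have sc: "real n * (e / 5) = e * real n / 5" "e / 5 * real n = e * real n / 5" "real n * (e / 10) = e * real n / 10"
      "0 \<le> e * real n" using e by simp_all
    have 1: "real n * (V$\<omega> - e) \<le> (\<Sum>k<n. stage_expectation G \<omega> \<sigma> \<rho>' k (payoff G))" for \<rho>' \<omega>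
    proof -
      have "real n * (V$\<omega> - e) = real n * V$\<omega> - e * real n" by (simp add: algebra_simps)
      then show ?thesis unfolding split[of "\<lambda>k. stage_expectation G \<omega> \<sigma> \<rho>' k (payoff G)"]
        using lower[OF ST0, of \<omega> \<rho>'] tail[of \<omega> \<sigma> \<rho>'] last[of \<omega> \<sigma> \<rho>'] v0[of \<omega>] \<delta>K
        unfolding sc(1-3) abs_le_iff using sc(4) by linarith
    qed
    have 2: "(\<Sum>k<n. stage_expectation G \<omega> \<sigma>' \<rho> k (payoff G)) \<le> real n * (V$\<omega> + e)" for \<sigma>' \<omega>
    proof -
      have "real n * (V$\<omega> + e) = real n * V$\<omega> + e * real n" by (simp add: algebra_simps)
      then show ?thesis unfolding split[of "\<lambda>k. stage_expectation G \<omega> \<sigma>' \<rho> k (payoff G)"]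
        using upper[OF ST0, of \<omega> \<sigma>'] tail[of \<omega> \<sigma>' \<rho>] last[of \<omega> \<sigma>' \<rho>] v0[of \<omega>] \<delta>K
        unfolding sc(1-3) abs_le_iff using sc(4) by linarith
    qed
    \<comment> \<open>The expectation of v - \<pi> moves by at most l \<open>\<delta>\<close> per
      stage and 4 \<open>\<delta>\<close> per unit of block change. As l is at most (1 +
      \<open>\<eta>\<close>) / (\<open>\<theta>\<close> n), the stages contribute
      \<open>\<delta>\<close> (1 + \<open>\<eta>\<close>) / \<open>\<theta>\<close> in total.
      Removing \<pi> at both ends and replacing the initial value by V cost \<open>\<delta>\<close>
      each.\<close>
    have drift: "\<bar>state_expectation G \<omega> \<sigma> \<rho> (Suc T) (?v (l (b T))) - V$\<omega>\<bar> \<le> \<delta> * (3 + 4 * real K + (1 + \<eta>) / \<theta>)"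
      if T: "S T" for T \<omega>
    proof -
      let ?u = "\<lambda>c. ?v (l c) - \<pi> c"
      let ?E = "state_expectation G \<omega> \<sigma> \<rho>"
      have "\<bar>?E (Suc T) (?u (b T)) - ?E 0 (?u (b 0))\<bar> \<le>
        (\<Sum>k\<le>T. l (b k) * \<delta>) + (\<Sum>k<T. 4 * \<delta> * (real (b (Suc k)) - real (b k)))"
      proof (rule drift_le[where u = "\<lambda>k. ?E k (?u (b k))" and u' = "\<lambda>k. ?E (Suc k) (?u (b k))"])
        fix k assume "k \<le> T"
        then have k: "S k" using S_le[OF T] by simp
        have "?E (Suc k) (?v (l (b k)) - (1 - l (b k)) *\<^sub>R \<pi> (b k)) = ?E k (?u (b k))"
        proof (rule balanced_stage)
          show "x (b k) $ w \<in> mixed" "y (b k) $ w \<in> mixed" for w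
            using opt[OF k] unfolding opt1_def opt2_def by auto
        qed (use bal[OF k] in \<open>auto simp: \<sigma>_def \<rho>_def\<close>)
        then have "?E (Suc k) (?u (b k)) - ?E k (?u (b k)) = - (l (b k) * ?E (Suc k) (\<pi> (b k)))"
          unfolding state_expectation_diff state_expectation_scaleR by (simp add: algebra_simps)
        moreover have "l (b k) * \<bar>?E (Suc k) (\<pi> (b k))\<bar> \<le> l (b k) * \<delta>"
          using lpos[OF k] by (intro mult_left_mono state_expectation_abs_le pi[OF k]) auto
        ultimately show "\<bar>?E (Suc k) (?u (b k)) - ?E k (?u (b k))\<bar> \<le> l (b k) * \<delta>"
          using lpos[OF k] by (simp add: abs_mult)
      next
        fix k assume "k < T"
        then have k: "S (Suc k)" using S_le[OF T] by simp
        have "\<bar>?u (b k) $ w - ?u (b (Suc k)) $ w\<bar> \<le> 4 * \<delta>" for w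
          using vdiff[OF k, of w] pi[OF k, of w] pi[OF S_le[OF k, of k], of w] by simp
        then have "\<bar>?E (Suc k) (?u (b k)) - ?E (Suc k) (?u (b (Suc k)))\<bar> \<le> 4 * \<delta> * (real (b (Suc k)) - real (b k))"
          using jump[OF k, of ?u "4 * \<delta>"] \<delta>(1) by simp
        then show "\<bar>?E (Suc k) (?u (b (Suc k))) - ?E (Suc k) (?u (b k))\<bar> \<le> 4 * \<delta> * (real (b (Suc k)) - real (b k))"
          by (simp add: abs_minus_commute)
      qed
      also have "(\<Sum>k<T. 4 * \<delta> * (real (b (Suc k)) - real (b k))) \<le> 4 * \<delta> * real K"
        by (rule sum_jumps_le[of b T K, OF bK[OF T]]) (use \<delta> in simp)
      also have "(\<Sum>k\<le>T. l (b k) * \<delta>) \<le> (\<Sum>k\<le>T. (1 + \<eta>) / (\<theta> * real n) * \<delta>)"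
        using lle S_le[OF T] \<delta>(1) by (intro sum_mono mult_right_mono) auto
      also have "\<dots> = real (Suc T) * ((1 + \<eta>) / (\<theta> * real n) * \<delta>)" by simp
      also have "\<dots> \<le> real n * ((1 + \<eta>) / (\<theta> * real n) * \<delta>)"
        using T \<eta> \<theta> \<delta>(1) unfolding S_def by (intro mult_right_mono mult_nonneg_nonneg divide_nonneg_nonneg) auto
      also have "\<dots> = \<delta> * ((1 + \<eta>) / \<theta>)" using n2 by simp
      finally have "\<bar>?E (Suc T) (?u (b T)) - ?E 0 (?u (b 0))\<bar> \<le> \<delta> * ((1 + \<eta>) / \<theta>) + 4 * \<delta> * real K"
        by simp
      moreover have "\<bar>?E (Suc T) (\<pi> (b T))\<bar> \<le> \<delta>" by (rule state_expectation_abs_le) (rule pi[OF T])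
      moreover have "?E (Suc T) (?u (b T)) = ?E (Suc T) (?v (l (b T))) - ?E (Suc T) (\<pi> (b T))"
        by (rule state_expectation_diff)
      moreover have "?E 0 (?u (b 0)) = ?v (l (b 0)) $ \<omega> - \<pi> (b 0) $ \<omega>" by (simp add: state_expectation_0)
      moreover have "\<bar>?v (l (b 0)) $ \<omega> - V$\<omega>\<bar> \<le> \<delta>" "\<bar>\<pi> (b 0) $ \<omega>\<bar> \<le> \<delta>" by (rule vV[OF S0], rule pi[OF S0])
      moreover have "\<delta> * (3 + 4 * real K + (1 + \<eta>) / \<theta>) = 3 * \<delta> + 4 * \<delta> * real K + \<delta> * ((1 + \<eta>) / \<theta>)"
        by (simp add: distrib_left)
      ultimately show ?thesis by linarith
    qed
    have 3: "\<bar>(\<Sum>k<T. stage_expectation G \<omega> \<sigma> \<rho> k (payoff G)) - real T * V$\<omega>\<bar> \<le> e * real n"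
      if T: "real T \<le> (1 - e) * real n" for \<omega> T
    proof (cases T)
      case 0
      then show ?thesis using e by simp
    next
      case (Suc T')
      have "real T \<le> (1 - \<theta>) * real n" using T \<theta>(3) by (meson diff_left_mono mult_right_mono of_nat_0_le_iff order_trans)
      moreover have "0 < \<theta> * real n" using \<theta>(1) n2 by simp
      ultimately have ST: "S T'" unfolding S_def Suc by (simp add: algebra_simps)
      let ?R = "real n - real (Suc T')" and ?W = "state_expectation G \<omega> \<sigma> \<rho> (Suc T') (?v (l (b T')))"
      have R: "0 \<le> ?R" "?R \<le> real n" using ST unfolding S_def by auto
      have "?R * \<bar>?W - V$\<omega>\<bar> \<le> real n * (\<delta> * (3 + 4 * real K + (1 + \<eta>) / \<theta>))"
        using R drift[OF ST, of \<omega>] by (intro mult_mono) auto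
      then have W: "\<bar>?R * ?W - ?R * V$\<omega>\<bar> \<le> real n * (\<delta> * (3 + 4 * real K + (1 + \<eta>) / \<theta>))"
        using R by (simp add: abs_mult flip: right_diff_distrib)
      have "real n * (\<delta> * D) \<le> real n * (e / 5)" using \<delta>D by (intro mult_left_mono) auto
      moreover have "real n * (\<delta> * D) = real n * \<delta> + real n * (2 * \<delta> * real K) + real n * (\<delta> * (3 + 4 * real K + (1 + \<eta>) / \<theta>))"
        unfolding D_def by (simp add: algebra_simps)
      moreover have "?R * V$\<omega> = real n * V$\<omega> - real T * V$\<omega>" unfolding Suc by (simp add: algebra_simps)
      moreover have "0 \<le> e * real n" using e by simp
      moreover have "real n * (e / 5) = e * real n / 5" "e / 5 * real n = e * real n / 5" by simp_all
      ultimately show ?thesis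
        using lower[OF ST, of \<omega> \<rho>] upper[OF ST, of \<omega> \<sigma>] W v0[of \<omega>] unfolding Suc abs_le_iff by linarith
    qed
    show ?thesis using \<open>markov \<sigma>\<close> \<open>markov \<rho>\<close> 1 2 3 by blast
  qed
  then show ?thesis by blast
qed

section \<open>The constant payoff property\<close>

lemma nstage_payoff_sum:
  fixes G :: "('w::finite, 'i::finite, 'j::finite) stochastic_game"
  shows "nstage_payoff G n \<omega> \<sigma> \<rho> = (1 / real n) * (\<Sum>k<n. stage_expectation G \<omega> \<sigma> \<rho> k (payoff G))"
  unfolding nstage_payoff_def expect_sum_stage stage_expectation_def ..

lemma nstage_payoff_abs_le:
  fixes G :: "('w::finite, 'i::finite, 'j::finite) stochastic_game"
  assumes "1 \<le> n"
  shows "\<bar>nstage_payoff G n \<omega> \<sigma> \<rho>\<bar> \<le> payoff_bound G"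
  using payoff_sums_bound[of G \<omega> \<sigma> \<rho> "{..<n}"] assms
  unfolding nstage_payoff_sum by (simp add: abs_mult field_simps)

text \<open>The strategy \<open>\<sigma>0\<close> bounds the supremum from below, and
  \<open>\<rho>0\<close> bounds every infimum from above. Payoffs are bounded, so the real suprema
  and infima obey the usual rules.\<close>

lemma nstage_value_bounds:
  fixes G :: "('w::finite, 'i::finite, 'j::finite) stochastic_game"
  assumes n: "1 \<le> n"
    and a: "\<And>\<rho>. a \<le> nstage_payoff G n \<omega> \<sigma>0 \<rho>" and b: "\<And>\<sigma>. nstage_payoff G n \<omega> \<sigma> \<rho>0 \<le> b"
  shows "a \<le> nstage_value G n \<omega>" "nstage_value G n \<omega> \<le> b"
proof -
  let ?f = "nstage_payoff G n \<omega>"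
  have bb: "bdd_below (range (?f \<sigma>))" for \<sigma>
    using nstage_payoff_abs_le[OF n, of G \<omega> \<sigma>]
    by (intro bdd_belowI2[of _ "- payoff_bound G"]) (auto simp: abs_le_iff minus_le_iff)
  have inf_le: "(INF \<rho>. ?f \<sigma> \<rho>) \<le> b" for \<sigma>
    by (rule order_trans[OF cINF_lower[OF bb] b]) simp
  have "a \<le> (INF \<rho>. ?f \<sigma>0 \<rho>)" by (rule cINF_greatest) (auto intro: a)
  also have "\<dots> \<le> (SUP \<sigma>. INF \<rho>. ?f \<sigma> \<rho>)"
    by (rule cSUP_upper) (auto intro!: bdd_aboveI2[of _ _ b] inf_le)
  finally show "a \<le> nstage_value G n \<omega>" unfolding nstage_value_def .
  show "nstage_value G n \<omega> \<le> b" unfolding nstage_value_def by (rule cSUP_least) (auto intro: inf_le)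
qed

text \<open>At n the accuracy 1 / (j + 1) is used for the largest j \<le> n whose threshold
  \<open>N j\<close> has been passed; each fixed j is eventually available, so the accuracy tends to
  0.\<close>

lemma ex_diagonal_choice:
  fixes P :: "real \<Rightarrow> nat \<Rightarrow> 'a \<Rightarrow> bool"
  assumes "\<And>e. 0 < e \<Longrightarrow> \<exists>n0. \<forall>n\<ge>n0. \<exists>s. P e n s"
  shows "\<exists>e s. e \<longlonglongrightarrow> 0 \<and> (\<forall>n. 0 < e n) \<and> (\<forall>\<^sub>F n in sequentially. P (e n) n (s n))"
proof -
  have "\<forall>j. \<exists>n0. \<forall>n\<ge>n0. \<exists>s. P (1 / real (Suc j)) n s" using assms by simp
  then obtain N where N: "\<And>j n. N j \<le> n \<Longrightarrow> \<exists>s. P (1 / real (Suc j)) n s" by metis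
  define A where "A n = {j. j \<le> n \<and> N j \<le> n}" for n
  \<comment> \<open>Inserting 0 gives \<open>Max\<close> a value for the n below \<open>N 0\<close>,
    where \<open>A n\<close> may be empty.\<close>
  define r where "r n = Max (insert 0 (A n))" for n
  have fA: "finite (A n)" for n unfolding A_def by simp
  have ex: "\<exists>s. P (1 / real (Suc (r n))) n s" if "N 0 \<le> n" for n
  proof -
    have "0 \<in> A n" using that unfolding A_def by simp
    then have "insert 0 (A n) = A n" "A n \<noteq> {}" by auto
    then have "r n \<in> A n" unfolding r_def using Max_in[OF fA] by simp
    then show ?thesis using N unfolding A_def by simp
  qed
  define s where "s n = (SOME s. P (1 / real (Suc (r n))) n s)" for n
  have "\<forall>\<^sub>F n in sequentially. P (1 / real (Suc (r n))) n (s n)"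
    unfolding s_def by (rule eventually_sequentiallyI[of "N 0"], rule someI_ex, rule ex)
  moreover have "filterlim r at_top sequentially"
    unfolding filterlim_at_top
  proof
    fix J
    show "\<forall>\<^sub>F n in sequentially. J \<le> r n"
    proof (rule eventually_sequentiallyI[of "max J (N J)"])
      fix n assume "max J (N J) \<le> n"
      then have "J \<in> A n" unfolding A_def by simp
      then show "J \<le> r n" unfolding r_def using fA by simp
    qed
  qed
  then have "(\<lambda>n. 1 / real (Suc (r n))) \<longlonglongrightarrow> 0"
    using filterlim_compose[OF LIMSEQ_inverse_real_of_nat, of r sequentially] by (simp add: inverse_eq_divide)
  ultimately show ?thesis
    by (intro exI[of _ "\<lambda>n. 1 / real (Suc (r n))"] exI[of _ s]) simp
qed

theorem theorem1p8:
  fixes G :: "('w::finite, 'i::finite, 'j::finite) stochastic_game"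
  shows "\<exists>(\<sigma> :: nat \<Rightarrow> ('w, 'i, 'j, 'i) strategy) (\<rho> :: nat \<Rightarrow> ('w, 'i, 'j, 'j) strategy).
    (\<forall>n\<ge>1. markov (\<sigma> n) \<and> markov (\<rho> n)) \<and>
    (\<exists>\<epsilon> :: nat \<Rightarrow> real. \<epsilon> \<longlonglongrightarrow> 0 \<and>
       (\<forall>n\<ge>1. eps_optimal1 G n (\<epsilon> n) (\<sigma> n) \<and> eps_optimal2 G n (\<epsilon> n) (\<rho> n))) \<and>
    (\<forall>t\<in>{0<..<1}. \<forall>\<omega>.
       (\<lambda>n. expect G \<omega> (\<sigma> n) (\<rho> n)
               (\<lambda>h. (1 / (t * real n)) * (\<Sum>m = 1..nat \<lceil>t * real n\<rceil>. stage_payoff G m h)))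
         \<longlonglongrightarrow> limit_value G \<omega>)"
proof -
  obtain V :: "real^'w" where "\<forall>w. ((\<lambda>l. discounted_value G l $ w) \<longlongrightarrow> V$w) (at_right 0)"
    using discounted_value_converges[of G] ..
  then have V: "((\<lambda>l. discounted_value G l $ w) \<longlongrightarrow> V$w) (at_right 0)" for w ..
  define P where "P e n s \<longleftrightarrow> markov (fst s) \<and> markov (snd s) \<and>
    (\<forall>\<rho>' \<omega>. real n * (V$\<omega> - e) \<le> (\<Sum>k<n. stage_expectation G \<omega> (fst s) \<rho>' k (payoff G))) \<and>
    (\<forall>\<sigma>' \<omega>. (\<Sum>k<n. stage_expectation G \<omega> \<sigma>' (snd s) k (payoff G)) \<le> real n * (V$\<omega> + e)) \<and>
    (\<forall>\<omega> T. real T \<le> (1 - e) * real n \<longrightarrow>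
      \<bar>(\<Sum>k<T. stage_expectation G \<omega> (fst s) (snd s) k (payoff G)) - real T * V$\<omega>\<bar> \<le> e * real n)"
    for e n and s :: "('w, 'i, 'j, 'i) strategy \<times> ('w, 'i, 'j, 'j) strategy"
  have "\<exists>n0. \<forall>n\<ge>n0. \<exists>s. P e n s" if "0 < e" for e
    using block_strategies[OF V that] unfolding P_def by (simp add: split_paired_Ex)
  then obtain e s where e: "e \<longlonglongrightarrow> 0" "\<And>n. 0 < e n" and ev: "\<forall>\<^sub>F n in sequentially. P (e n) n (s n)"
    using ex_diagonal_choice[of P] by blast
  define ok where "ok n \<longleftrightarrow> P (e n) n (s n)" for n
  \<comment> \<open>Finitely many n may fail \<open>ok\<close>; a constant strategy is Markov and
    serves there.\<close>
  define \<sigma> where "\<sigma> n = (if ok n then fst (s n) else (\<lambda>h w. return_pmf undefined))" for n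
  define \<rho> where "\<rho> n = (if ok n then snd (s n) else (\<lambda>h w. return_pmf undefined))" for n
  \<comment> \<open>The guarantees are relative to V, and V differs from the value by up to another
    \<open>e n\<close>, hence the factor 2. In the exceptional case payoff and value both lie within
    the payoff bound.\<close>
  define \<epsilon> where "\<epsilon> n = (if ok n then 2 * e n else 2 * payoff_bound G)" for n
  have ev_ok: "\<forall>\<^sub>F n in sequentially. ok n" using ev unfolding ok_def .
  have const: "markov (\<lambda>h w. return_pmf c)" for c unfolding markov_def by auto
  have markov: "markov (\<sigma> n)" "markov (\<rho> n)" for n
    unfolding \<sigma>_def \<rho>_def using const by (auto simp: ok_def P_def)
  have pay: "V$\<omega> - e n \<le> nstage_payoff G n \<omega> (\<sigma> n) \<rho>'" "nstage_payoff G n \<omega> \<sigma>' (\<rho> n) \<le> V$\<omega> + e n"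
    if "ok n" "1 \<le> n" for n \<omega> \<sigma>' \<rho>'
    using that unfolding nstage_payoff_sum ok_def P_def \<sigma>_def \<rho>_def by (simp_all add: field_simps)
  have val: "V$\<omega> - e n \<le> nstage_value G n \<omega>" "nstage_value G n \<omega> \<le> V$\<omega> + e n" if "ok n" "1 \<le> n" for n \<omega>
    by (rule nstage_value_bounds[OF that(2) pay[OF that]])+
  have valC: "\<bar>nstage_value G n \<omega>\<bar> \<le> payoff_bound G" if "1 \<le> n" for n \<omega>
  proof -
    have "- payoff_bound G \<le> nstage_payoff G n \<omega> \<sigma>' \<rho>'" "nstage_payoff G n \<omega> \<sigma>' \<rho>' \<le> payoff_bound G" for \<sigma>' \<rho>'
      using nstage_payoff_abs_le[OF that, of G \<omega> \<sigma>' \<rho>'] by auto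
    then have "- payoff_bound G \<le> nstage_value G n \<omega>" "nstage_value G n \<omega> \<le> payoff_bound G"
      by (rule nstage_value_bounds[OF that])+
    then show ?thesis by simp
  qed
  \<comment> \<open>The guarantees enclose the n-stage value within \<open>e n\<close> of V, so the
    sequence in \<open>limit_value\<close> does converge and \<open>lim\<close> denotes its
    limit.\<close>
  have "(\<lambda>n. nstage_value G n \<omega>) \<longlonglongrightarrow> V$\<omega>" for \<omega>
  proof (rule LIM_zero_cancel, rule Lim_null_comparison[OF _ e(1)])
    have "norm (nstage_value G n \<omega> - V$\<omega>) \<le> e n" if "ok n" "1 \<le> n" for n
      using val[OF that, of \<omega>] by (simp add: abs_le_iff)
    then show "\<forall>\<^sub>F n in sequentially. norm (nstage_value G n \<omega> - V$\<omega>) \<le> e n"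
      using eventually_conj[OF ev_ok eventually_ge_at_top[of 1]] by (auto elim: eventually_mono)
  qed
  then have lv: "limit_value G \<omega> = V$\<omega>" for \<omega> unfolding limit_value_def by (rule limI)
  have opt: "eps_optimal1 G n (\<epsilon> n) (\<sigma> n)" "eps_optimal2 G n (\<epsilon> n) (\<rho> n)" if n: "1 \<le> n" for n
  proof -
    have "nstage_value G n \<omega> - \<epsilon> n \<le> nstage_payoff G n \<omega> (\<sigma> n) \<rho>'"
      "nstage_payoff G n \<omega> \<sigma>' (\<rho> n) \<le> nstage_value G n \<omega> + \<epsilon> n" for \<omega> \<sigma>' \<rho>'
      using pay(1)[of n \<omega> \<rho>'] pay(2)[of n \<omega> \<sigma>'] val[of n \<omega>] valC[OF n, of \<omega>] n
        nstage_payoff_abs_le[OF n, of G \<omega> "\<sigma> n" \<rho>'] nstage_payoff_abs_le[OF n, of G \<omega> \<sigma>' "\<rho> n"]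
      unfolding \<epsilon>_def by (cases "ok n"; simp; linarith)+
    then show "eps_optimal1 G n (\<epsilon> n) (\<sigma> n)" "eps_optimal2 G n (\<epsilon> n) (\<rho> n)"
      unfolding eps_optimal1_def eps_optimal2_def by simp_all
  qed
  have \<epsilon>: "\<epsilon> \<longlonglongrightarrow> 0"
  proof (rule Lim_transform_eventually)
    show "(\<lambda>n. 2 * e n) \<longlonglongrightarrow> 0" using tendsto_mult_right[OF e(1), of 2] by simp
    show "\<forall>\<^sub>F n in sequentially. 2 * e n = \<epsilon> n" using ev_ok by eventually_elim (simp add: \<epsilon>_def)
  qed
  have lim: "(\<lambda>n. expect G \<omega> (\<sigma> n) (\<rho> n)
      (\<lambda>h. (1 / (t * real n)) * (\<Sum>m = 1..nat \<lceil>t * real n\<rceil>. stage_payoff G m h))) \<longlonglongrightarrow> V$\<omega>"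
    if t: "0 < t" "t < 1" for t \<omega>
  proof (rule LIM_zero_cancel, rule Lim_null_comparison)
    \<comment> \<open>The second term pays for the ceiling, which adds at most one stage.\<close>
    have "(\<lambda>n. e n / t + (\<bar>V$\<omega>\<bar> / t) * (1 / real n)) \<longlonglongrightarrow> 0 / t + (\<bar>V$\<omega>\<bar> / t) * 0"
      using t by (intro tendsto_intros e(1) lim_1_over_n) auto
    then show "(\<lambda>n. e n / t + (\<bar>V$\<omega>\<bar> / t) * (1 / real n)) \<longlonglongrightarrow> 0" by simp
    \<comment> \<open>Leaves room for the rounding: together with (1 - t) n \<ge> 2 it places the t
      n + 1 stages within the first (1 - \<open>e n\<close>) n, where the estimate in
      \<open>P\<close> applies.\<close>
    have ev_e: "\<forall>\<^sub>F n in sequentially. e n < (1 - t) / 2"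
      using order_tendstoD(2)[OF e(1), of "(1 - t) / 2"] t by simp
    show "\<forall>\<^sub>F n in sequentially. norm (expect G \<omega> (\<sigma> n) (\<rho> n)
        (\<lambda>h. (1 / (t * real n)) * (\<Sum>m = 1..nat \<lceil>t * real n\<rceil>. stage_payoff G m h)) - V$\<omega>) \<le> e n / t + (\<bar>V$\<omega>\<bar> / t) * (1 / real n)"
      using ev_ok ev_e eventually_ge_at_top[of "Suc (nat \<lceil>2 / (1 - t)\<rceil>)"]
    proof eventually_elim
      case (elim n)
      define T where "T = nat \<lceil>t * real n\<rceil>"
      define \<Sigma> where "\<Sigma> = (\<Sum>k<T. stage_expectation G \<omega> (\<sigma> n) (\<rho> n) k (payoff G))"
      have "2 / (1 - t) \<le> real n" using elim(3) by linarith
      then have n: "1 \<le> (1 - t) / 2 * real n" "0 < real n" using t elim(3) by (auto simp: field_simps)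
      have "0 \<le> t * real n" using t by simp
      then have T: "t * real n \<le> real T" "real T \<le> t * real n + 1" unfolding T_def by linarith+
      have "e n * real n \<le> (1 - t) / 2 * real n" using elim(2) by (intro mult_right_mono) auto
      then have "real T \<le> (1 - e n) * real n" using T(2) n(1) by (simp add: algebra_simps)
      then have b: "\<bar>\<Sigma> - real T * V$\<omega>\<bar> \<le> e n * real n"
        using elim(1) unfolding \<Sigma>_def ok_def P_def \<sigma>_def \<rho>_def by simp
      have "\<bar>real T * V$\<omega> - t * real n * V$\<omega>\<bar> = \<bar>real T - t * real n\<bar> * \<bar>V$\<omega>\<bar>"
        unfolding left_diff_distrib[symmetric] by (rule abs_mult)
      also have "\<dots> \<le> 1 * \<bar>V$\<omega>\<bar>" using T by (intro mult_right_mono) auto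
      finally have "\<bar>\<Sigma> - t * real n * V$\<omega>\<bar> \<le> e n * real n + \<bar>V$\<omega>\<bar>" using b by linarith
      then have "\<bar>\<Sigma> - t * real n * V$\<omega>\<bar> / (t * real n) \<le> (e n * real n + \<bar>V$\<omega>\<bar>) / (t * real n)"
        using t by (intro divide_right_mono) auto
      moreover have "\<bar>\<Sigma> - t * real n * V$\<omega>\<bar> / (t * real n) = \<bar>(1 / (t * real n)) * \<Sigma> - V$\<omega>\<bar>"
      proof -
        have "(1 / (t * real n)) * \<Sigma> - V$\<omega> = (\<Sigma> - t * real n * V$\<omega>) / (t * real n)" using t n(2) by (simp add: field_simps)
        then show ?thesis using t by (simp add: abs_mult)
      qed
      moreover have "(e n * real n + \<bar>V$\<omega>\<bar>) / (t * real n) = e n / t + (\<bar>V$\<omega>\<bar> / t) * (1 / real n)"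
        using t n(2) by (simp add: field_simps)
      ultimately show ?case
        unfolding expect_sum_stage T_def[symmetric] by (simp add: \<Sigma>_def stage_expectation_def)
    qed
  qed
  show ?thesis
  proof (intro exI conjI)
    show "\<forall>n\<ge>1. markov (\<sigma> n) \<and> markov (\<rho> n)" using markov by simp
    show "\<epsilon> \<longlonglongrightarrow> 0" by (rule \<epsilon>)
    show "\<forall>n\<ge>1. eps_optimal1 G n (\<epsilon> n) (\<sigma> n) \<and> eps_optimal2 G n (\<epsilon> n) (\<rho> n)" using opt by simp
    show "\<forall>t\<in>{0<..<1}. \<forall>\<omega>. (\<lambda>n. expect G \<omega> (\<sigma> n) (\<rho> n)
        (\<lambda>h. (1 / (t * real n)) * (\<Sum>m = 1..nat \<lceil>t * real n\<rceil>. stage_payoff G m h))) \<longlonglongrightarrow> limit_value G \<omega>"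
      using lim unfolding lv by simp
  qed
qed

end
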